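(* Let $\mathbb H$ be the graded affine Hecke algebra attached to a real root system $\Phi$ with Weyl group $W$ and a $W$-invariant parameter function $k:\Phi\to\mathbb C$. Let $(\pi,M)$ be an $\mathbb H$-module with a central character and with a nondegenerate $*$-invariant hermitian form $\langle\,,\,\rangle_M$, and let $\sigma$ be an irreducible $W$-representation such that $M(\sigma)\neq0$. If $x=m\otimes p\in M(\sigma)\otimes S(V_0)$ is a simple tensor, then $$\langle D^+x,D^+x\rangle_{M\otimes\mathcal P}-\langle D^-x,D^-x\rangle_{M\otimes\mathcal P}=\big(-\pi(\Omega)+\sigma(\Omega_W)\big)\langle x,x\rangle_{M\otimes\mathcal P}.$$
   Context: $(V_0^*,\Phi,V_0,\Phi^\vee)$ is a real root system with coroots $\alpha^\vee\in V_0$, reflections $s_\alpha(v)=v-\alpha(v)\alpha^\vee$, finite Weyl group $W$, and $B$ a positive-definite $W$-invariant symmetric bilinear form on $V_0$; $V=\mathbb C\otimes_{\mathbb R}V_0$, $B$ is extended complex-bilinearly, and $B$ also denotes the dual form on $V^*$. Fix positive roots $\Phi^+$ with simple roots $\Pi$. $\mathbb H$ is the associative unital algebra generated by $\mathbb C[W]$ and $V$, with elements of $V$ commuting with each other and $v\cdot s_\alpha-s_\alpha\cdot s_\alpha(v)=k_\alpha\alpha(v)$ for $v\in V,\alpha\in\Pi$. Put $\widetilde v=v-\frac12\sum_{\alpha>0}k_\alpha\alpha(v)s_\alpha$. The star operation $*$ on $\mathbb H$ is the conjugate-linear anti-involution defined on generators by $w^*=w^{-1}$ ($w\in W$), $\widetilde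 v^*=-\widetilde v$ ($v\in V_0$); $*$-invariance means $\langle\pi(h)m,m'\rangle_M=\langle m,\pi(h^* )m'\rangle_M$. $\mathcal W=\mathcal W(V\oplus V^*,\omega)$ is the Weyl algebra: the quotient of the tensor algebra of $V\oplus V^*$ by $vw-wv=\omega(v,w)$, where $V,V^*$ are isotropic and $\omega(\lambda,v)=\lambda(v)$. It acts on $\mathcal P=S(V)$: $v\in V$ by multiplication, $\lambda\in V^*$ by the derivation $\partial_\lambda$ with $v\mapsto\lambda(v)$. The hermitian form on $\mathcal P$ is $\langle P_1,P_2\rangle_{\mathcal P}=\partial_{P_2}(\overline{P_1})$ evaluated at $0$, where the bar is conjugation with real points $S(V_0)$ and $\partial_P$ is the constant-coefficient differential operator defined by $P$ via $v_i\mapsto v_i^*$ for a $B$-orthonormal basis $\{v_i\}$ of $V_0$. Hermitian forms are conjugate-linear in the first and linear in the second variable; $\langle\,,\,\rangle_{M\otimes\mathcal P}=\langle\,,\,\rangle_M\langle\,,\,\rangle_{\mathcal P}$ is the product form. For a basis $\{v_i\}$ of $V$ with $B$-dual basis $\{v^i\}\subset V$ and dual basis $\{v_i^*\}\subset V^*$: $D^-=\sum_i\widetilde v_i\otimes v_i^*$, $D^+=\sum_i\widetilde v_i\otimes v^i$ in $\mathbb H\otimes\mathcal W$, acting on $M\otimes\mathcal P$. $M(\sigma)$ is the $\sigma$-isotypic component of $M|_W$. $\pi(\Omega)$ is the scalar by which the central element $\Omega=\sum_iv_iv^i\in Z(\mathbb H)$ acts on $M$, and $\sigma(\Omega_W)$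 the scalar by which the central element $\Omega_W=\frac14\sum_{\alpha,\beta>0}k_\alpha k_\beta B(\alpha,\beta)s_\alpha s_\beta$ of $\mathbb C[W]$ acts on $\sigma$. *)

theory Defs
  imports "HOL-Analysis.Analysis" "HOL-Library.Poly_Mapping" "HOL-Algebra.QuotRing"
begin

section \<open>Algebras given by generators and relations\<close>

text \<open>The free monoid on a type of letters is written additively, so that the convolution product
  of finitely supported functions on it is the product of the free complex algebra.\<close>

datatype 'g word = Word (letters: "'g list")

instantiation word :: (type) monoid_add
begin
definition zero_word :: "'g word" where "zero_word = Word []"
definition plus_word :: "'g word \<Rightarrow> 'g word \<Rightarrow> 'g word"
  where "plus_word a b = Word (letters a @ letters b)"
instance by standard (simp_all add: zero_word_def plus_word_def)
end

type_synonym 'g free = "'g word \<Rightarrow>\<^sub>0 complex"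

definition free_algebra :: "'g set \<Rightarrow> 'g free ring" where
  "free_algebra G =
    \<lparr>carrier = {p. \<forall>w \<in> Poly_Mapping.keys p. set (letters w) \<subseteq> G}, mult = (*), one = 1, zero = 0, add = (+)\<rparr>"

definition gen :: "'g \<Rightarrow> 'g free" where
  "gen x = Poly_Mapping.single (Word [x]) 1"

text \<open>The scalar \<open>c\<close> in any of the algebras \<open>'a \<Rightarrow>\<^sub>0 complex\<close>; multiplication by it is scalar
  multiplication.\<close>

definition const :: "complex \<Rightarrow> ('a::zero \<Rightarrow>\<^sub>0 complex)" where
  "const c = Poly_Mapping.single 0 c"

definition presented_algebra :: "'g set \<Rightarrow> 'g free set \<Rightarrow> 'g free set ring" where
  "presented_algebra G R = free_algebra G Quot genideal (free_algebra G) R"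

definition presented_class :: "'g set \<Rightarrow> 'g free set \<Rightarrow> 'g free \<Rightarrow> 'g free set" where
  "presented_class G R p = a_r_coset (free_algebra G) (genideal (free_algebra G) R) p"

definition free_act ::
  "(complex \<Rightarrow> 'm \<Rightarrow> 'm::comm_monoid_add) \<Rightarrow> ('g \<Rightarrow> 'm \<Rightarrow> 'm) \<Rightarrow> 'g free \<Rightarrow> 'm \<Rightarrow> 'm" where
  "free_act s \<phi> p m = (\<Sum>w\<in>Poly_Mapping.keys p. s (Poly_Mapping.lookup p w) (foldr \<phi> (letters w) m))"


section \<open>Representations on complex vector spaces\<close>

definition End_ring ::
  "(complex \<Rightarrow> 'm \<Rightarrow> 'm::ab_group_add) \<Rightarrow> ('m \<Rightarrow> 'm) ring" where
  "End_ring s = \<lparr>carrier = {f. Vector_Spaces.linear s s f}, mult = (\<circ>), one = id,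
     zero = (\<lambda>_. 0), add = (\<lambda>f g x. f x + g x)\<rparr>"

definition ring_center :: "('a, 'b) ring_scheme \<Rightarrow> 'a set" where
  "ring_center R = {z \<in> carrier R. \<forall>a \<in> carrier R. z \<otimes>\<^bsub>R\<^esub> a = a \<otimes>\<^bsub>R\<^esub> z}"

text \<open>The scalar by which \<open>T\<close> acts; meaningful if \<open>T\<close> is a scalar operator on a nonzero space.\<close>

definition scalar_of :: "(complex \<Rightarrow> 'm \<Rightarrow> 'm) \<Rightarrow> ('m \<Rightarrow> 'm) \<Rightarrow> complex" where
  "scalar_of s T = (THE c. \<forall>m. T m = s c m)"

text \<open>Hermitian forms are conjugate-linear in the first variable.\<close>

definition hermitian_form ::
  "(complex \<Rightarrow> 'm \<Rightarrow> 'm::ab_group_add) \<Rightarrow> ('m \<Rightarrow> 'm \<Rightarrow> complex) \<Rightarrow> bool" where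
  "hermitian_form s h \<longleftrightarrow>
     (\<forall>x. Vector_Spaces.linear s (*) (h x)) \<and> (\<forall>x y. h y x = cnj (h x y))"

definition nondegenerate_form :: "('m::zero \<Rightarrow> 'm \<Rightarrow> complex) \<Rightarrow> bool" where
  "nondegenerate_form h \<longleftrightarrow> (\<forall>x. (\<forall>y. h x y = 0) \<longrightarrow> x = 0)"


section \<open>Root systems\<close>

text \<open>\<open>V\<^sub>0\<close> is \<^typ>\<open>real^'n\<close>, \<open>V\<close> is \<^typ>\<open>complex^'n\<close>, and elements of the dual spaces are linear
  functionals.  A coroot map \<open>cr\<close> sends \<open>\<alpha>\<close> to \<open>\<alpha>\<^sup>\<or>\<close>.\<close>

type_synonym 'n root = "real^'n \<Rightarrow> real"
type_synonym 'n cofun = "complex^'n \<Rightarrow> complex"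

definition reflection :: "('n::finite root \<Rightarrow> real^'n) \<Rightarrow> 'n root \<Rightarrow> real^'n \<Rightarrow> real^'n" where
  "reflection cr \<alpha> v = v - \<alpha> v *\<^sub>R cr \<alpha>"

text \<open>Since \<open>s\<^sub>\<beta>\<close> is an involution, its action on \<open>V\<^sub>0\<^sup>*\<close> is \<open>\<alpha> \<mapsto> \<alpha> \<circ> s\<^sub>\<beta>\<close>.
  Root systems are reduced; neither integrality nor spanning is required.\<close>

definition root_system :: "'n::finite root set \<Rightarrow> ('n root \<Rightarrow> real^'n) \<Rightarrow> bool" where
  "root_system \<Phi> cr \<longleftrightarrow>
     finite \<Phi> \<and> (\<forall>\<alpha>\<in>\<Phi>. linear \<alpha>) \<and> inj_on cr \<Phi> \<and>
     (\<forall>\<alpha>\<in>\<Phi>. \<alpha> (cr \<alpha>) = 2) \<and>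
     (\<forall>\<alpha>\<in>\<Phi>. \<forall>\<beta>\<in>\<Phi>. \<alpha> \<circ> reflection cr \<beta> \<in> \<Phi>) \<and>
     (\<forall>\<alpha>\<in>\<Phi>. \<forall>\<beta>\<in>\<Phi>. reflection cr \<beta> (cr \<alpha>) \<in> cr ` \<Phi>) \<and>
     (\<forall>\<alpha>\<in>\<Phi>. \<forall>c. (\<lambda>v. c * \<alpha> v) \<in> \<Phi> \<longrightarrow> c = 1 \<or> c = - 1)"

text \<open>Reflections are involutions, so closure under them gives the generated group.\<close>

inductive_set weyl_group :: "'n root set \<Rightarrow> ('n root \<Rightarrow> real^'n) \<Rightarrow> (real^'n \<Rightarrow> real^'n) set"
  for \<Phi> :: "'n root set" and cr :: "'n root \<Rightarrow> real^'n" where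
  one: "id \<in> weyl_group \<Phi> cr"
| step: "\<alpha> \<in> \<Phi> \<Longrightarrow> w \<in> weyl_group \<Phi> cr \<Longrightarrow> reflection cr \<alpha> \<circ> w \<in> weyl_group \<Phi> cr"

definition positive_roots :: "'n::finite root set \<Rightarrow> 'n root set \<Rightarrow> 'n root set" where
  "positive_roots \<Phi> \<Delta> =
     {\<alpha>\<in>\<Phi>. \<exists>c. (\<forall>\<beta>\<in>\<Delta>. 0 \<le> c \<beta>) \<and> \<alpha> = (\<lambda>v. \<Sum>\<beta>\<in>\<Delta>. c \<beta> * \<beta> v)}"

definition simple_roots :: "'n::finite root set \<Rightarrow> 'n root set \<Rightarrow> bool" where
  "simple_roots \<Phi> \<Delta> \<longleftrightarrow>
     \<Delta> \<subseteq> \<Phi> \<and>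
     (\<forall>c. (\<forall>v. (\<Sum>\<beta>\<in>\<Delta>. c \<beta> * \<beta> v) = 0) \<longrightarrow> (\<forall>\<beta>\<in>\<Delta>. c \<beta> = 0)) \<and>
     (\<forall>\<alpha>\<in>\<Phi>. \<alpha> \<in> positive_roots \<Phi> \<Delta> \<or> (\<lambda>v. - \<alpha> v) \<in> positive_roots \<Phi> \<Delta>)"

definition invariant_inner_product ::
  "'n::finite root set \<Rightarrow> ('n root \<Rightarrow> real^'n) \<Rightarrow> (real^'n \<Rightarrow> real^'n \<Rightarrow> real) \<Rightarrow> bool" where
  "invariant_inner_product \<Phi> cr B \<longleftrightarrow>
     bilinear B \<and> (\<forall>u v. B u v = B v u) \<and> (\<forall>v. v \<noteq> 0 \<longrightarrow> 0 < B v v) \<and>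
     (\<forall>w\<in>weyl_group \<Phi> cr. \<forall>u v. B (w u) (w v) = B u v)"

definition dual_form :: "(real^'n \<Rightarrow> real^'n \<Rightarrow> real) \<Rightarrow> 'n::finite root \<Rightarrow> 'n root \<Rightarrow> real" where
  "dual_form B \<alpha> \<beta> =
     B (THE a. \<forall>v. B a v = \<alpha> v) (THE b. \<forall>v. B b v = \<beta> v)"

definition invariant_parameter ::
  "'n::finite root set \<Rightarrow> ('n root \<Rightarrow> real^'n) \<Rightarrow> ('n root \<Rightarrow> complex) \<Rightarrow> bool" where
  "invariant_parameter \<Phi> cr k \<longleftrightarrow> (\<forall>w\<in>weyl_group \<Phi> cr. \<forall>\<alpha>\<in>\<Phi>. k (\<alpha> \<circ> w) = k \<alpha>)"


section \<open>Complexification and bases\<close>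

definition re_vec :: "complex^'n \<Rightarrow> real^'n" where "re_vec v = (\<chi> i. Re (v $ i))"
definition im_vec :: "complex^'n \<Rightarrow> real^'n" where "im_vec v = (\<chi> i. Im (v $ i))"
definition of_real_vec :: "real^'n \<Rightarrow> complex^'n" where "of_real_vec v = (\<chi> i. of_real (v $ i))"

definition cx_fun :: "'n::finite root \<Rightarrow> 'n cofun" where
  "cx_fun \<alpha> v = Complex (\<alpha> (re_vec v)) (\<alpha> (im_vec v))"

definition cx_form :: "(real^'n \<Rightarrow> real^'n \<Rightarrow> real) \<Rightarrow> complex^'n \<Rightarrow> complex^'n \<Rightarrow> complex" where
  "cx_form B u v = Complex
     (B (re_vec u) (re_vec v) - B (im_vec u) (im_vec v))
     (B (re_vec u) (im_vec v) + B (im_vec u) (re_vec v))"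

definition cx_reflection :: "('n::finite root \<Rightarrow> real^'n) \<Rightarrow> 'n root \<Rightarrow> complex^'n \<Rightarrow> complex^'n" where
  "cx_reflection cr \<alpha> v = v - cx_fun \<alpha> v *s of_real_vec (cr \<alpha>)"

definition cx_linear :: "'n::finite cofun \<Rightarrow> bool" where
  "cx_linear f \<longleftrightarrow> Vector_Spaces.linear (*s) (*) f"

definition cx_basis :: "('n::finite \<Rightarrow> complex^'n) \<Rightarrow> bool" where
  "cx_basis v \<longleftrightarrow> inj v \<and> vec.independent (range v) \<and> vec.span (range v) = UNIV"

text \<open>The element \<open>v\<^sub>i\<^sup>*\<close> of the basis of \<open>V\<^sup>*\<close> dual to \<open>v\<close>, and the element \<open>v\<^sup>i\<close> of the basis of
  \<open>V\<close> that is \<open>B\<close>-dual to \<open>v\<close>.\<close>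

definition dual_functional :: "('n \<Rightarrow> complex^'n) \<Rightarrow> 'n \<Rightarrow> 'n::finite cofun" where
  "dual_functional v i = (THE f. cx_linear f \<and> (\<forall>j. f (v j) = (if i = j then 1 else 0)))"

definition B_dual_vector ::
  "(real^'n \<Rightarrow> real^'n \<Rightarrow> real) \<Rightarrow> ('n::finite \<Rightarrow> complex^'n) \<Rightarrow> 'n \<Rightarrow> complex^'n" where
  "B_dual_vector B v i = (THE u. \<forall>j. cx_form B u (v j) = (if i = j then 1 else 0))"

definition orthonormal_basis ::
  "(real^'n \<Rightarrow> real^'n \<Rightarrow> real) \<Rightarrow> ('n::finite \<Rightarrow> real^'n) \<Rightarrow> bool" where
  "orthonormal_basis B b \<longleftrightarrow> (\<forall>i j. B (b i) (b j) = (if i = j then 1 else 0)) \<and> span (range b) = UNIV"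


section \<open>The graded affine Hecke algebra\<close>

datatype 'n hgen = GW "real^'n \<Rightarrow> real^'n" | GV "complex^'n"

definition hecke_gens :: "'n::finite root set \<Rightarrow> ('n root \<Rightarrow> real^'n) \<Rightarrow> 'n hgen set" where
  "hecke_gens \<Phi> cr = GW ` weyl_group \<Phi> cr \<union> range GV"

text \<open>The relations of \<open>\<complex>[W]\<close>, linearity in \<open>V\<close>, commutativity of \<open>V\<close>, and the cross relations.\<close>

definition hecke_rels ::
  "'n::finite root set \<Rightarrow> ('n root \<Rightarrow> real^'n) \<Rightarrow> 'n root set \<Rightarrow> ('n root \<Rightarrow> complex) \<Rightarrow> 'n hgen free set" where
  "hecke_rels \<Phi> cr \<Delta> k =
     {gen (GW w) * gen (GW w') - gen (GW (w \<circ> w')) | w w'.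
        w \<in> weyl_group \<Phi> cr \<and> w' \<in> weyl_group \<Phi> cr} \<union>
     {gen (GW id) - 1} \<union>
     {gen (GV (a *s u + b *s v)) - (const a * gen (GV u) + const b * gen (GV v)) | a b u v. True} \<union>
     {gen (GV u) * gen (GV v) - gen (GV v) * gen (GV u) | u v. True} \<union>
     {gen (GV v) * gen (GW (reflection cr \<alpha>))
        - gen (GW (reflection cr \<alpha>)) * gen (GV (cx_reflection cr \<alpha> v))
        - const (k \<alpha> * cx_fun \<alpha> v) | v \<alpha>. \<alpha> \<in> \<Delta>}"

definition hecke_algebra ::
  "'n::finite root set \<Rightarrow> ('n root \<Rightarrow> real^'n) \<Rightarrow> 'n root set \<Rightarrow> ('n root \<Rightarrow> complex) \<Rightarrow> 'n hgen free set ring" where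
  "hecke_algebra \<Phi> cr \<Delta> k = presented_algebra (hecke_gens \<Phi> cr) (hecke_rels \<Phi> cr \<Delta> k)"

definition hecke_class ::
  "'n::finite root set \<Rightarrow> ('n root \<Rightarrow> real^'n) \<Rightarrow> 'n root set \<Rightarrow> ('n root \<Rightarrow> complex) \<Rightarrow>
   'n hgen free \<Rightarrow> 'n hgen free set" where
  "hecke_class \<Phi> cr \<Delta> k = presented_class (hecke_gens \<Phi> cr) (hecke_rels \<Phi> cr \<Delta> k)"

definition tilde ::
  "'n::finite root set \<Rightarrow> ('n root \<Rightarrow> real^'n) \<Rightarrow> 'n root set \<Rightarrow> ('n root \<Rightarrow> complex) \<Rightarrow>
   complex^'n \<Rightarrow> 'n hgen free" where
  "tilde \<Phi> cr \<Delta> k v =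
     gen (GV v) - const (1/2) *
       (\<Sum>\<alpha>\<in>positive_roots \<Phi> \<Delta>. const (k \<alpha> * cx_fun \<alpha> v) * gen (GW (reflection cr \<alpha>)))"

text \<open>The star operation is determined by these conditions, but it exists only for suitable \<open>k\<close>
  (for instance real \<open>k\<close>).\<close>

definition hecke_star ::
  "'n::finite root set \<Rightarrow> ('n root \<Rightarrow> real^'n) \<Rightarrow> 'n root set \<Rightarrow> ('n root \<Rightarrow> complex) \<Rightarrow>
   ('n hgen free set \<Rightarrow> 'n hgen free set) \<Rightarrow> bool" where
  "hecke_star \<Phi> cr \<Delta> k st \<longleftrightarrow>
     (let H = hecke_algebra \<Phi> cr \<Delta> k; cl = hecke_class \<Phi> cr \<Delta> k in
       (\<forall>x\<in>carrier H. st x \<in> carrier H \<and> st (st x) = x) \<and>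
       (\<forall>x\<in>carrier H. \<forall>y\<in>carrier H. st (x \<oplus>\<^bsub>H\<^esub> y) = st x \<oplus>\<^bsub>H\<^esub> st y) \<and>
       (\<forall>x\<in>carrier H. \<forall>y\<in>carrier H. st (x \<otimes>\<^bsub>H\<^esub> y) = st y \<otimes>\<^bsub>H\<^esub> st x) \<and>
       (\<forall>c. \<forall>x\<in>carrier H. st (cl (const c) \<otimes>\<^bsub>H\<^esub> x) = cl (const (cnj c)) \<otimes>\<^bsub>H\<^esub> st x) \<and>
       (\<forall>w\<in>weyl_group \<Phi> cr. st (cl (gen (GW w))) = cl (gen (GW (inv_into UNIV w)))) \<and>
       (\<forall>v. st (cl (tilde \<Phi> cr \<Delta> k (of_real_vec v))) = cl (- tilde \<Phi> cr \<Delta> k (of_real_vec v))))"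

definition hecke_module ::
  "'n::finite root set \<Rightarrow> ('n root \<Rightarrow> real^'n) \<Rightarrow> 'n root set \<Rightarrow> ('n root \<Rightarrow> complex) \<Rightarrow>
   (complex \<Rightarrow> 'm \<Rightarrow> 'm::ab_group_add) \<Rightarrow> ('n hgen free set \<Rightarrow> 'm \<Rightarrow> 'm) \<Rightarrow> bool" where
  "hecke_module \<Phi> cr \<Delta> k s \<pi> \<longleftrightarrow>
     vector_space s \<and> \<pi> \<in> ring_hom (hecke_algebra \<Phi> cr \<Delta> k) (End_ring s) \<and>
     (\<forall>c. \<pi> (hecke_class \<Phi> cr \<Delta> k (const c)) = s c)"

definition has_central_character ::
  "'n::finite root set \<Rightarrow> ('n root \<Rightarrow> real^'n) \<Rightarrow> 'n root set \<Rightarrow> ('n root \<Rightarrow> complex) \<Rightarrow>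
   (complex \<Rightarrow> 'm \<Rightarrow> 'm) \<Rightarrow> ('n hgen free set \<Rightarrow> 'm \<Rightarrow> 'm) \<Rightarrow> bool" where
  "has_central_character \<Phi> cr \<Delta> k s \<pi> \<longleftrightarrow>
     (\<exists>f. \<forall>z\<in>ring_center (hecke_algebra \<Phi> cr \<Delta> k). \<pi> z = s (f z))"

definition star_invariant ::
  "'n::finite root set \<Rightarrow> ('n root \<Rightarrow> real^'n) \<Rightarrow> 'n root set \<Rightarrow> ('n root \<Rightarrow> complex) \<Rightarrow>
   ('n hgen free set \<Rightarrow> 'n hgen free set) \<Rightarrow> ('n hgen free set \<Rightarrow> 'm \<Rightarrow> 'm) \<Rightarrow>
   ('m \<Rightarrow> 'm \<Rightarrow> complex) \<Rightarrow> bool" where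
  "star_invariant \<Phi> cr \<Delta> k st \<pi> h \<longleftrightarrow>
     (\<forall>x\<in>carrier (hecke_algebra \<Phi> cr \<Delta> k). \<forall>m m'. h (\<pi> x m) m' = h m (\<pi> (st x) m'))"

definition Omega ::
  "'n::finite root set \<Rightarrow> ('n root \<Rightarrow> real^'n) \<Rightarrow> 'n root set \<Rightarrow> ('n root \<Rightarrow> complex) \<Rightarrow>
   (real^'n \<Rightarrow> real^'n \<Rightarrow> real) \<Rightarrow> ('n \<Rightarrow> complex^'n) \<Rightarrow> 'n hgen free set" where
  "Omega \<Phi> cr \<Delta> k B v =
     hecke_class \<Phi> cr \<Delta> k (\<Sum>i\<in>UNIV. gen (GV (v i)) * gen (GV (B_dual_vector B v i)))"


section \<open>Representations of the Weyl group\<close>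

definition weyl_rep ::
  "'n::finite root set \<Rightarrow> ('n root \<Rightarrow> real^'n) \<Rightarrow> (complex \<Rightarrow> 'u \<Rightarrow> 'u::ab_group_add) \<Rightarrow>
   ((real^'n \<Rightarrow> real^'n) \<Rightarrow> 'u \<Rightarrow> 'u) \<Rightarrow> bool" where
  "weyl_rep \<Phi> cr s \<tau> \<longleftrightarrow>
     vector_space s \<and> (\<forall>w\<in>weyl_group \<Phi> cr. Vector_Spaces.linear s s (\<tau> w)) \<and> \<tau> id = id \<and>
     (\<forall>w\<in>weyl_group \<Phi> cr. \<forall>w'\<in>weyl_group \<Phi> cr. \<tau> (w \<circ> w') = \<tau> w \<circ> \<tau> w')"

definition irreducible_weyl_rep ::
  "'n::finite root set \<Rightarrow> ('n root \<Rightarrow> real^'n) \<Rightarrow> (complex \<Rightarrow> 'u \<Rightarrow> 'u::ab_group_add) \<Rightarrow>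
   ((real^'n \<Rightarrow> real^'n) \<Rightarrow> 'u \<Rightarrow> 'u) \<Rightarrow> bool" where
  "irreducible_weyl_rep \<Phi> cr s \<tau> \<longleftrightarrow>
     weyl_rep \<Phi> cr s \<tau> \<and> (\<exists>u::'u. u \<noteq> 0) \<and>
     (\<forall>S. module.subspace s S \<and> (\<forall>w\<in>weyl_group \<Phi> cr. \<tau> w ` S \<subseteq> S) \<longrightarrow> S = {0} \<or> S = UNIV)"

text \<open>The sum of all subrepresentations of \<open>(\<rho>, M)\<close> isomorphic to \<open>(\<tau>, U)\<close>; these are the images
  of the injective intertwining maps \<open>U \<rightarrow> M\<close>.\<close>

definition isotypic_component ::
  "'n::finite root set \<Rightarrow> ('n root \<Rightarrow> real^'n) \<Rightarrow>
   (complex \<Rightarrow> 'u \<Rightarrow> 'u::ab_group_add) \<Rightarrow> ((real^'n \<Rightarrow> real^'n) \<Rightarrow> 'u \<Rightarrow> 'u) \<Rightarrow>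
   (complex \<Rightarrow> 'm \<Rightarrow> 'm::ab_group_add) \<Rightarrow> ((real^'n \<Rightarrow> real^'n) \<Rightarrow> 'm \<Rightarrow> 'm) \<Rightarrow> 'm set" where
  "isotypic_component \<Phi> cr s \<tau> s' \<rho> =
     module.span s' (\<Union> {range f | f. Vector_Spaces.linear s s' f \<and> inj f \<and>
        (\<forall>w\<in>weyl_group \<Phi> cr. \<forall>u. f (\<tau> w u) = \<rho> w (f u))})"

text \<open>Elements of \<open>\<complex>[W]\<close> are finitely supported functions on maps \<open>V\<^sub>0 \<rightarrow> V\<^sub>0\<close>.\<close>

definition Omega_W ::
  "'n::finite root set \<Rightarrow> ('n root \<Rightarrow> real^'n) \<Rightarrow> 'n root set \<Rightarrow> ('n root \<Rightarrow> complex) \<Rightarrow>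
   (real^'n \<Rightarrow> real^'n \<Rightarrow> real) \<Rightarrow> ((real^'n \<Rightarrow> real^'n) \<Rightarrow>\<^sub>0 complex)" where
  "Omega_W \<Phi> cr \<Delta> k B =
     (\<Sum>\<alpha>\<in>positive_roots \<Phi> \<Delta>. \<Sum>\<beta>\<in>positive_roots \<Phi> \<Delta>.
        Poly_Mapping.single (reflection cr \<alpha> \<circ> reflection cr \<beta>)
          (1/4 * k \<alpha> * k \<beta> * of_real (dual_form B \<alpha> \<beta>)))"

definition group_algebra_act ::
  "(complex \<Rightarrow> 'u \<Rightarrow> 'u::ab_group_add) \<Rightarrow> ('w \<Rightarrow> 'u \<Rightarrow> 'u) \<Rightarrow> ('w \<Rightarrow>\<^sub>0 complex) \<Rightarrow> 'u \<Rightarrow> 'u" where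
  "group_algebra_act s \<tau> a u = (\<Sum>w\<in>Poly_Mapping.keys a. s (Poly_Mapping.lookup a w) (\<tau> w u))"


section \<open>The symmetric algebra\<close>

text \<open>\<open>S(V)\<close> is the polynomial algebra on the standard basis of \<^typ>\<open>complex^'n\<close>, so the real points
  \<open>S(V\<^sub>0)\<close> are the polynomials with real coefficients.\<close>

type_synonym 'n sym = "('n \<Rightarrow>\<^sub>0 nat) \<Rightarrow>\<^sub>0 complex"

definition sym_scale :: "complex \<Rightarrow> 'n::finite sym \<Rightarrow> 'n sym" where
  "sym_scale c p = const c * p"

definition sym_vec :: "complex^'n \<Rightarrow> 'n::finite sym" where
  "sym_vec v = (\<Sum>j\<in>UNIV. Poly_Mapping.single (Poly_Mapping.single j 1) (v $ j))"

definition real_sym :: "'n::finite sym set" where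
  "real_sym = {p. \<forall>\<mu>. Poly_Mapping.lookup p \<mu> \<in> \<real>}"

definition sym_cnj :: "'n::finite sym \<Rightarrow> 'n sym" where
  "sym_cnj = Poly_Mapping.map cnj"

text \<open>The partial derivative along the \<open>j\<close>-th standard coordinate; on exponents the subtraction is
  truncated, but then the coefficient vanishes.\<close>

definition sym_partial :: "'n \<Rightarrow> 'n::finite sym \<Rightarrow> 'n sym" where
  "sym_partial j p = (\<Sum>\<mu>\<in>Poly_Mapping.keys p.
     Poly_Mapping.single (\<mu> - Poly_Mapping.single j 1) (of_nat (Poly_Mapping.lookup \<mu> j) * Poly_Mapping.lookup p \<mu>))"

text \<open>The derivation of \<open>S(V)\<close> with \<open>v \<mapsto> f(v)\<close> for \<open>v \<in> V\<close>.\<close>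

definition sym_deriv :: "'n::finite cofun \<Rightarrow> 'n sym \<Rightarrow> 'n sym" where
  "sym_deriv f p = (\<Sum>j\<in>UNIV. sym_scale (f (axis j 1)) (sym_partial j p))"

text \<open>The linear map \<open>V \<rightarrow> V\<^sup>*\<close> with \<open>b\<^sub>i \<mapsto> b\<^sub>i\<^sup>*\<close>.\<close>

definition to_dual :: "('n \<Rightarrow> complex^'n) \<Rightarrow> complex^'n \<Rightarrow> 'n::finite cofun" where
  "to_dual b v = (\<lambda>u. \<Sum>i\<in>UNIV. dual_functional b i v * dual_functional b i u)"

text \<open>The constant-coefficient operator \<open>\<partial>\<^sub>P\<close>: in each monomial of \<open>P\<close>, the basis vector \<open>e\<^sub>j\<close> is
  replaced by the derivation attached to the image of \<open>e\<^sub>j\<close> under \<open>b\<^sub>i \<mapsto> b\<^sub>i\<^sup>*\<close>.  These derivations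
  commute, so the fold is a product of powers in arbitrary order.\<close>

definition const_coeff_op :: "('n \<Rightarrow> complex^'n) \<Rightarrow> 'n::finite sym \<Rightarrow> 'n sym \<Rightarrow> 'n sym" where
  "const_coeff_op b P Q = (\<Sum>\<mu>\<in>Poly_Mapping.keys P. sym_scale (Poly_Mapping.lookup P \<mu>)
     (Finite_Set.fold (\<lambda>j T. (sym_deriv (to_dual b (axis j 1)) ^^ Poly_Mapping.lookup \<mu> j) \<circ> T) id UNIV Q))"

definition sym_form :: "('n \<Rightarrow> real^'n) \<Rightarrow> 'n::finite sym \<Rightarrow> 'n sym \<Rightarrow> complex" where
  "sym_form b P\<^sub>1 P\<^sub>2 = Poly_Mapping.lookup (const_coeff_op (of_real_vec \<circ> b) P\<^sub>2 (sym_cnj P\<^sub>1)) 0"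


section \<open>The Weyl algebra\<close>

definition symplectic :: "(complex^'n) \<times> 'n::finite cofun \<Rightarrow> (complex^'n) \<times> 'n cofun \<Rightarrow> complex" where
  "symplectic x y = snd x (fst y) - snd y (fst x)"

definition weyl_alg_gens :: "((complex^'n) \<times> 'n::finite cofun) set" where
  "weyl_alg_gens = UNIV \<times> {f. cx_linear f}"

text \<open>The first family of relations turns the free algebra on the set \<open>V \<oplus> V\<^sup>*\<close> into the tensor
  algebra.\<close>

definition weyl_alg_rels :: "((complex^'n) \<times> 'n::finite cofun) free set" where
  "weyl_alg_rels =
     {gen (a *s u + b *s v, \<lambda>z. a * f z + b * g z) - (const a * gen (u, f) + const b * gen (v, g))
        | a b u v f g. cx_linear f \<and> cx_linear g} \<union>
     {gen x * gen y - gen y * gen x - const (symplectic x y)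
        | x y. x \<in> weyl_alg_gens \<and> y \<in> weyl_alg_gens}"

definition weyl_class :: "((complex^'n) \<times> 'n::finite cofun) free \<Rightarrow> ((complex^'n) \<times> 'n cofun) free set" where
  "weyl_class = presented_class weyl_alg_gens weyl_alg_rels"

definition weyl_vec :: "complex^'n \<Rightarrow> ((complex^'n) \<times> 'n::finite cofun) free set" where
  "weyl_vec v = weyl_class (gen (v, \<lambda>_. 0))"

definition weyl_cov :: "'n::finite cofun \<Rightarrow> ((complex^'n) \<times> 'n cofun) free set" where
  "weyl_cov f = weyl_class (gen (0, f))"

text \<open>The action of the Weyl algebra on \<open>S(V)\<close>.  The action of the free algebra respects the
  relations, so the choice of a representative is immaterial.\<close>

definition weyl_alg_act :: "((complex^'n) \<times> 'n::finite cofun) free set \<Rightarrow> 'n sym \<Rightarrow> 'n sym" where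
  "weyl_alg_act X =
     free_act sym_scale (\<lambda>(v, f) p. sym_vec v * p + sym_deriv f p) (SOME x. x \<in> X)"


section \<open>The tensor product with the symmetric algebra and the operators D\<close>

text \<open>Since the monomials form a basis of \<open>\<P> = S(V)\<close>, the space \<open>M \<otimes> \<P>\<close> is the space of
  polynomials with coefficients in \<open>M\<close>.\<close>

type_synonym ('m, 'n) tens = "('n \<Rightarrow>\<^sub>0 nat) \<Rightarrow>\<^sub>0 'm"

definition tensor :: "(complex \<Rightarrow> 'm \<Rightarrow> 'm::ab_group_add) \<Rightarrow> 'm \<Rightarrow> 'n::finite sym \<Rightarrow> ('m, 'n) tens" where
  "tensor s m p = (\<Sum>\<mu>\<in>Poly_Mapping.keys p. Poly_Mapping.single \<mu> (s (Poly_Mapping.lookup p \<mu>) m))"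

definition tensor_op ::
  "(complex \<Rightarrow> 'm \<Rightarrow> 'm::ab_group_add) \<Rightarrow> ('m \<Rightarrow> 'm) \<Rightarrow> ('n::finite sym \<Rightarrow> 'n sym) \<Rightarrow>
   ('m, 'n) tens \<Rightarrow> ('m, 'n) tens" where
  "tensor_op s S T t = (\<Sum>\<mu>\<in>Poly_Mapping.keys t. tensor s (S (Poly_Mapping.lookup t \<mu>)) (T (Poly_Mapping.single \<mu> 1)))"

definition tensor_form ::
  "('m::zero \<Rightarrow> 'm \<Rightarrow> complex) \<Rightarrow> ('n::finite sym \<Rightarrow> 'n sym \<Rightarrow> complex) \<Rightarrow>
   ('m, 'n) tens \<Rightarrow> ('m, 'n) tens \<Rightarrow> complex" where
  "tensor_form h h' t t' = (\<Sum>\<mu>\<in>Poly_Mapping.keys t. \<Sum>\<nu>\<in>Poly_Mapping.keys t'.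
     h (Poly_Mapping.lookup t \<mu>) (Poly_Mapping.lookup t' \<nu>) * h' (Poly_Mapping.single \<mu> 1) (Poly_Mapping.single \<nu> 1))"

text \<open>An element \<open>\<Sum> h\<^sub>i \<otimes> w\<^sub>i\<close> of \<open>\<H> \<otimes> \<W>\<close> acts on \<open>M \<otimes> \<P>\<close> by the sum of the operators
  \<open>\<pi>(h\<^sub>i) \<otimes> w\<^sub>i\<close>.\<close>

definition D_minus ::
  "'n::finite root set \<Rightarrow> ('n root \<Rightarrow> real^'n) \<Rightarrow> 'n root set \<Rightarrow> ('n root \<Rightarrow> complex) \<Rightarrow>
   (complex \<Rightarrow> 'm \<Rightarrow> 'm::ab_group_add) \<Rightarrow> ('n hgen free set \<Rightarrow> 'm \<Rightarrow> 'm) \<Rightarrow>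
   ('n \<Rightarrow> complex^'n) \<Rightarrow> ('m, 'n) tens \<Rightarrow> ('m, 'n) tens" where
  "D_minus \<Phi> cr \<Delta> k s \<pi> v t = (\<Sum>i\<in>UNIV.
     tensor_op s (\<pi> (hecke_class \<Phi> cr \<Delta> k (tilde \<Phi> cr \<Delta> k (v i))))
       (weyl_alg_act (weyl_cov (dual_functional v i))) t)"

definition D_plus ::
  "'n::finite root set \<Rightarrow> ('n root \<Rightarrow> real^'n) \<Rightarrow> 'n root set \<Rightarrow> ('n root \<Rightarrow> complex) \<Rightarrow>
   (real^'n \<Rightarrow> real^'n \<Rightarrow> real) \<Rightarrow>
   (complex \<Rightarrow> 'm \<Rightarrow> 'm::ab_group_add) \<Rightarrow> ('n hgen free set \<Rightarrow> 'm \<Rightarrow> 'm) \<Rightarrow>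
   ('n \<Rightarrow> complex^'n) \<Rightarrow> ('m, 'n) tens \<Rightarrow> ('m, 'n) tens" where
  "D_plus \<Phi> cr \<Delta> k B s \<pi> v t = (\<Sum>i\<in>UNIV.
     tensor_op s (\<pi> (hecke_class \<Phi> cr \<Delta> k (tilde \<Phi> cr \<Delta> k (v i))))
       (weyl_alg_act (weyl_vec (B_dual_vector B v i))) t)"

end

theory Submission
  imports Defs "HOL-Computational_Algebra.Fundamental_Theorem_Algebra"
begin

text \<open>
  Let \<open>e\<^sub>i\<close> be a \<open>B\<close>-orthonormal basis of \<open>V\<^sub>0\<close> and \<open>T\<^sub>i\<close> the action of its tilde elements
  on \<open>M\<close>.  Since the canonical tensor of \<open>B\<close> does not depend on the basis,
  \<open>D\<^sup>+ x = \<Sum> T\<^sub>i m \<otimes> e\<^sub>i p\<close> and \<open>D\<^sup>- x = \<Sum> T\<^sub>i m \<otimes> \<partial>\<^sub>i p\<close>.  Multiplication by \<open>e\<^sub>j\<close> and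
  \<open>\<partial>\<^sub>j\<close> are adjoint and satisfy \<open>[\<partial>\<^sub>j, e\<^sub>i] = \<delta>\<^sub>i\<^sub>j\<close>, so in the difference of the two norms only
  \<open>\<Sum> \<langle>T\<^sub>i m, T\<^sub>i m\<rangle> \<langle>p, p\<rangle> = - \<langle>m, \<Sum> T\<^sub>i\<^sup>2 m\<rangle> \<langle>p, p\<rangle>\<close> survives.

  On the other side \<open>\<Omega> = \<Sum> T\<^sub>i\<^sup>2 + \<Omega>\<^sub>W\<close> in the Hecke algebra: writing \<open>v = T(v) + t(v)\<close>, the
  \<open>t\<close>-part squares to \<open>\<Omega>\<^sub>W\<close>, and the cross terms cancel because
  \<open>T(v) s\<^sub>\<alpha> = s\<^sub>\<alpha> T(s\<^sub>\<alpha> v)\<close> for every positive root.  The same relation shows that \<open>\<Sum> T\<^sub>i\<^sup>2\<close>,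
  hence \<open>\<Omega>\<^sub>W\<close>, commutes with \<open>W\<close>, so that \<open>\<Omega>\<^sub>W\<close> acts by a scalar on \<open>\<sigma>\<close> by Schur's lemma.
\<close>

section \<open>Presented algebras\<close>

text \<open>The cross relations are given for simple reflections only, whereas
  \<open>\<Omega>\<^sub>W\<close> involves every positive root. The half sum in the tilde element is
  tuned to absorb the inhomogeneous term \<open>k \<beta> * \<beta> v\<close>: a simple reflection
  permutes the positive roots other than \<beta> and changes the sign of the \<beta>-summand alone,
  so two halves account for the whole term. Freed of this remainder, the relation can be conjugated
  by further simple reflections, which carries it to all positive roots. Reality enters twice. The
  star operation negates the tilde elements of real vectors, so the skewness of
  \<open>T\<^sub>i\<close> uses a basis of \<open>V\<^sub>0\<close>; and derivations along that
  basis commute with conjugation of polynomials. This is why an arbitrary basis of V is first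
  exchanged for the orthonormal one. Schur's lemma requires an eigenvector. Finite-dimensionality of
  \<sigma> is extracted from the finiteness of W, and the commutation of
  \<open>\<Omega>\<^sub>W\<close> with W is proved in the Hecke algebra and pulled back to \<sigma>
  along an embedding into M.\<close>

lemma const_0 [simp]: "const 0 = 0"
  by (simp add: const_def)

lemma const_1 [simp]: "const 1 = 1"
  by (simp add: const_def)

lemma const_add: "const (a + b) = const a + const b"
  by (simp add: const_def single_add)

lemma const_uminus: "const (- a) = - const a"
  by (simp add: const_def single_uminus)

lemma const_diff: "const (a - b) = const a - const b"
  by (simp add: const_def single_diff)

lemma const_mult: "const (a * b) = (const a * const b :: 'a::monoid_add \<Rightarrow>\<^sub>0 complex)"
  by (simp add: const_def mult_single)

lemma const_sum: "const (sum f A) = (\<Sum>x\<in>A. const (f x))"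
  by (induction A rule: infinite_finite_induct) (simp_all add: const_add)

lemma poly_mapping_eq_sum_single:
  "p = (\<Sum>k\<in>Poly_Mapping.keys p. Poly_Mapping.single k (Poly_Mapping.lookup p k))"
proof (rule poly_mapping_eqI)
  fix k
  have "(\<Sum>x\<in>Poly_Mapping.keys p. Poly_Mapping.lookup p x when x = k)
      = (if k \<in> Poly_Mapping.keys p then Poly_Mapping.lookup p k else 0)"
    by (simp add: when_def sum.delta)
  then show "Poly_Mapping.lookup p k = Poly_Mapping.lookup
      (\<Sum>k\<in>Poly_Mapping.keys p. Poly_Mapping.single k (Poly_Mapping.lookup p k)) k"
    by (simp add: lookup_sum lookup_single in_keys_iff)
qed

lemma lookup_const_mult: "Poly_Mapping.lookup (const c * p) k = c * Poly_Mapping.lookup p k"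
  for p :: "'a::monoid_add \<Rightarrow>\<^sub>0 complex"
proof -
  have "const c * p = Poly_Mapping.map ((*) c) p"
    by (simp add: const_def mult_map_scale_conv_mult)
  then show ?thesis
    by (simp add: Poly_Mapping.map.rep_eq when_def)
qed

text \<open>Words do not commute, but scalars do: this lets \<open>const c\<close> be treated as
  scalar multiplication on either side.\<close>

lemma const_commute: "p * const c = const c * p" for p :: "'a::monoid_add \<Rightarrow>\<^sub>0 complex"
proof -
  have "p * const c = (\<Sum>k\<in>Poly_Mapping.keys p. Poly_Mapping.single k (Poly_Mapping.lookup p k)) * const c"
    using poly_mapping_eq_sum_single[of p] by simp
  also have "\<dots> = (\<Sum>k\<in>Poly_Mapping.keys p. const c * Poly_Mapping.single k (Poly_Mapping.lookup p k))"
    by (simp add: sum_distrib_right const_def mult_single mult.commute)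
  also have "\<dots> = const c * p"
    using poly_mapping_eq_sum_single[of p] by (simp flip: sum_distrib_left)
  finally show ?thesis .
qed

lemma const_left_commute: "p * (const c * q) = const c * (p * q)"
  for p q :: "'a::monoid_add \<Rightarrow>\<^sub>0 complex"
  by (metis const_commute mult.assoc)

abbreviation free_carrier :: "'g set \<Rightarrow> 'g free set" where
  "free_carrier G \<equiv> carrier (free_algebra G)"

lemma mem_free_carrier:
  "p \<in> free_carrier G \<longleftrightarrow> (\<forall>w\<in>Poly_Mapping.keys p. set (letters w) \<subseteq> G)"
  by (simp add: free_algebra_def)

lemma free_carrier_0 [simp]: "0 \<in> free_carrier G"
  by (simp add: mem_free_carrier)

lemma free_carrier_const [simp]: "const c \<in> free_carrier G"
  by (simp add: mem_free_carrier const_def zero_word_def)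

lemma free_carrier_1 [simp]: "1 \<in> free_carrier G"
  by (metis const_1 free_carrier_const)

lemma free_carrier_gen [simp]: "gen x \<in> free_carrier G \<longleftrightarrow> x \<in> G"
  by (simp add: mem_free_carrier gen_def)

lemma free_carrier_add [simp]:
  "p \<in> free_carrier G \<Longrightarrow> q \<in> free_carrier G \<Longrightarrow> p + q \<in> free_carrier G"
  using Poly_Mapping.keys_add[of p q] unfolding mem_free_carrier by blast

lemma free_carrier_mult [simp]:
  assumes "p \<in> free_carrier G" "q \<in> free_carrier G"
  shows "p * q \<in> free_carrier G"
  unfolding mem_free_carrier
proof
  fix w assume "w \<in> Poly_Mapping.keys (p * q)"
  then obtain a b where "w = a + b" "a \<in> Poly_Mapping.keys p" "b \<in> Poly_Mapping.keys q"
    using keys_mult[of p q] by blast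
  then show "set (letters w) \<subseteq> G"
    using assms by (auto simp: mem_free_carrier plus_word_def)
qed

lemma free_carrier_uminus [simp]: "p \<in> free_carrier G \<Longrightarrow> - p \<in> free_carrier G"
  by (simp add: mem_free_carrier in_keys_iff)

lemma free_carrier_diff [simp]:
  "p \<in> free_carrier G \<Longrightarrow> q \<in> free_carrier G \<Longrightarrow> p - q \<in> free_carrier G"
  using free_carrier_add[of p G "- q"] by simp

lemma free_carrier_sum [simp]:
  "(\<And>x. x \<in> A \<Longrightarrow> f x \<in> free_carrier G) \<Longrightarrow> sum f A \<in> free_carrier G"
  by (induction A rule: infinite_finite_induct) auto

lemma free_algebra_simps [simp]:
  "x \<otimes>\<^bsub>free_algebra G\<^esub> y = x * y" "\<one>\<^bsub>free_algebra G\<^esub> = 1"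
  "\<zero>\<^bsub>free_algebra G\<^esub> = 0" "x \<oplus>\<^bsub>free_algebra G\<^esub> y = x + y"
  by (simp_all add: free_algebra_def)

lemma ring_free_algebra: "ring (free_algebra G)"
proof (rule ringI)
  show "abelian_group (free_algebra G)"
  proof (rule abelian_groupI)
    fix x assume "x \<in> free_carrier G"
    then show "\<exists>y\<in>free_carrier G. y \<oplus>\<^bsub>free_algebra G\<^esub> x = \<zero>\<^bsub>free_algebra G\<^esub>"
      by (intro bexI[of _ "- x"]) auto
  qed (auto simp: algebra_simps)
  show "Group.monoid (free_algebra G)"
    by (rule monoidI) (auto simp: algebra_simps)
qed (auto simp: algebra_simps)

lemma gen_Cons: "Poly_Mapping.single (Word (x # l)) c = gen x * Poly_Mapping.single (Word l) c"
  by (simp add: gen_def mult_single plus_word_def)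

text \<open>Letters are split off on the left, in the order in which \<open>foldr\<close> makes them
  act. The scalar sits in the base case, so a scaled word needs no case of its own.\<close>

lemma free_induct [consumes 1, case_names const gen add]:
  assumes "p \<in> free_carrier G"
    and const: "\<And>c. P (const c)"
    and gen: "\<And>x q. x \<in> G \<Longrightarrow> q \<in> free_carrier G \<Longrightarrow> P q \<Longrightarrow> P (gen x * q)"
    and add: "\<And>q r. q \<in> free_carrier G \<Longrightarrow> r \<in> free_carrier G \<Longrightarrow> P q \<Longrightarrow> P r \<Longrightarrow> P (q + r)"
  shows "P p"
proof -
  have word: "Poly_Mapping.single (Word l) c \<in> free_carrier G \<and> P (Poly_Mapping.single (Word l) c)"
    if "set l \<subseteq> G" for l c
    using that
  proof (induction l)
    case Nil
    then show ?case
      using const[of c] free_carrier_const[of c G] by (simp add: const_def zero_word_def)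
  next
    case (Cons x l)
    then show ?case
      using gen by (simp add: gen_Cons)
  qed
  have "(\<Sum>k\<in>A. Poly_Mapping.single k (Poly_Mapping.lookup p k)) \<in> free_carrier G \<and>
      P (\<Sum>k\<in>A. Poly_Mapping.single k (Poly_Mapping.lookup p k))"
    if "A \<subseteq> Poly_Mapping.keys p" "finite A" for A
    using that(2,1)
  proof (induction A rule: finite_induct)
    case empty
    then show ?case
      using const[of 0] by simp
  next
    case (insert k A)
    have "set (letters k) \<subseteq> G"
      using insert.prems assms(1) by (auto simp: mem_free_carrier)
    then show ?case
      using insert word[of "letters k"] add by simp
  qed
  then show ?thesis
    using poly_mapping_eq_sum_single[of p] by fastforce
qed

section \<open>Congruence modulo the ideal of relations\<close>

locale presentation =
  fixes G :: "'g set" and R :: "'g free set"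
  assumes rels: "R \<subseteq> free_carrier G"
begin

text \<open>Calculations stay in the free algebra, with the ring operations of its type, and reach
  the quotient only through this congruence. Membership of both sides is part of it, so that chains
  of congruences carry their own side conditions.\<close>

definition cong :: "'g free \<Rightarrow> 'g free \<Rightarrow> bool" (infix "\<asymp>" 50) where
  "p \<asymp> q \<longleftrightarrow> p \<in> free_carrier G \<and> q \<in> free_carrier G \<and> p - q \<in> genideal (free_algebra G) R"

sublocale F: ring "free_algebra G"
  by (rule ring_free_algebra)

sublocale I: ideal "genideal (free_algebra G) R" "free_algebra G"
  by (rule F.genideal_ideal[OF rels])

lemma ideal_add: "p \<in> genideal (free_algebra G) R \<Longrightarrow> q \<in> genideal (free_algebra G) R
    \<Longrightarrow> p + q \<in> genideal (free_algebra G) R"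
  using I.a_closed by simp

lemma ideal_mult_left: "p \<in> free_carrier G \<Longrightarrow> q \<in> genideal (free_algebra G) R
    \<Longrightarrow> p * q \<in> genideal (free_algebra G) R"
  using I.I_l_closed[of q p] by simp

lemma ideal_mult_right: "p \<in> genideal (free_algebra G) R \<Longrightarrow> q \<in> free_carrier G
    \<Longrightarrow> p * q \<in> genideal (free_algebra G) R"
  using I.I_r_closed[of p q] by simp

lemma ideal_uminus: "p \<in> genideal (free_algebra G) R \<Longrightarrow> - p \<in> genideal (free_algebra G) R"
  using ideal_mult_left[of "const (- 1)" p] by (simp add: const_uminus)

lemma cong_refl: "p \<in> free_carrier G \<Longrightarrow> p \<asymp> p"
  using I.zero_closed by (simp add: cong_def)

lemma cong_sym: "p \<asymp> q \<Longrightarrow> q \<asymp> p"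
  using ideal_uminus[of "p - q"] by (simp add: cong_def)

lemma cong_trans [trans]: "p \<asymp> q \<Longrightarrow> q \<asymp> r \<Longrightarrow> p \<asymp> r"
  using ideal_add[of "p - q" "q - r"] by (simp add: cong_def)

lemma cong_add: "p \<asymp> q \<Longrightarrow> p' \<asymp> q' \<Longrightarrow> p + p' \<asymp> q + q'"
  using ideal_add[of "p - q" "p' - q'"] by (simp add: cong_def algebra_simps)

lemma cong_uminus: "p \<asymp> q \<Longrightarrow> - p \<asymp> - q"
  using ideal_uminus[of "p - q"] by (simp add: cong_def)

lemma cong_diff: "p \<asymp> q \<Longrightarrow> p' \<asymp> q' \<Longrightarrow> p - p' \<asymp> q - q'"
  using cong_add[of p q "- p'" "- q'"] cong_uminus[of p' q'] by simp

lemma cong_mult: 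
  assumes "p \<asymp> q" "p' \<asymp> q'"
  shows "p * p' \<asymp> q * q'"
proof -
  have "p * p' - q * q' = p * (p' - q') + (p - q) * q'"
    by (simp add: algebra_simps)
  then show ?thesis
    using assms ideal_add ideal_mult_left ideal_mult_right by (simp add: cong_def)
qed

lemma cong_const_mult: "p \<asymp> q \<Longrightarrow> const c * p \<asymp> const c * q"
  by (simp add: cong_mult cong_refl)

lemma cong_sum: "(\<And>x. x \<in> A \<Longrightarrow> f x \<asymp> g x) \<Longrightarrow> sum f A \<asymp> sum g A"
  by (induction A rule: infinite_finite_induct) (auto intro: cong_add cong_refl)

lemma cong_rel: 
  assumes "p - q \<in> R" "p \<in> free_carrier G" "q \<in> free_carrier G"
  shows "p \<asymp> q"
  using F.genideal_self[OF rels] assms by (auto simp: cong_def)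

lemma class_eqI: 
  assumes "p \<asymp> q"
  shows "presented_class G R p = presented_class G R q"
proof -
  have "p \<in> presented_class G R q"
    unfolding presented_class_def a_r_coset_def'
    using assms by (force simp: cong_def intro!: bexI[of _ "p - q"])
  then show ?thesis
    using assms F.a_repr_independence[of p "genideal (free_algebra G) R" q] I.a_subgroup
    by (simp add: presented_class_def cong_def)
qed

lemma class_cong: "x \<in> presented_class G R p \<Longrightarrow> p \<in> free_carrier G \<Longrightarrow> x \<asymp> p"
  using I.a_Hcarr by (auto simp: presented_class_def a_r_coset_def' cong_def)

lemma self_in_class: "p \<in> free_carrier G \<Longrightarrow> p \<in> presented_class G R p"
  using I.a_rcos_self by (simp add: presented_class_def)

lemma class_ring_hom: "presented_class G R \<in> ring_hom (free_algebra G) (presented_algebra G R)"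
  using I.rcos_ring_hom unfolding presented_algebra_def
  by (simp add: presented_class_def[abs_def])

lemma carrier_presented: "carrier (presented_algebra G R) = presented_class G R ` free_carrier G"
  by (auto simp: presented_algebra_def FactRing_def A_RCOSETS_def' presented_class_def)

lemma class_carrier: "p \<in> free_carrier G \<Longrightarrow> presented_class G R p \<in> carrier (presented_algebra G R)"
  by (simp add: carrier_presented)

lemma class_mult: "p \<in> free_carrier G \<Longrightarrow> q \<in> free_carrier G \<Longrightarrow>
   presented_class G R p \<otimes>\<^bsub>presented_algebra G R\<^esub> presented_class G R q = presented_class G R (p * q)"
  using ring_hom_mult[OF class_ring_hom] by simp

text \<open>The elements that commute with \<open>z\<close> modulo the ideal contain the scalars and
  are closed under sums and under left multiplication by generators, so the generators
  decide.\<close>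

lemma class_in_center:
  assumes z: "z \<in> free_carrier G" and comm: "\<And>x. x \<in> G \<Longrightarrow> z * gen x \<asymp> gen x * z"
  shows "presented_class G R z \<in> ring_center (presented_algebra G R)"
proof -
  have "z * q \<asymp> q * z" if "q \<in> free_carrier G" for q
    using that
  proof (induction q rule: free_induct)
    case (const c)
    then show ?case
      using z by (simp add: const_commute cong_refl)
  next
    case (gen x q)
    have "z * (gen x * q) \<asymp> gen x * (z * q)"
      using cong_mult[OF comm cong_refl, of x q] gen by (simp add: mult.assoc)
    also have "\<dots> \<asymp> gen x * (q * z)"
      using gen by (intro cong_mult[OF cong_refl]) auto
    finally show ?case
      by (simp add: mult.assoc)
  next
    case (add q r)
    then show ?case
      using cong_add by (simp add: algebra_simps)
  qed
  then show ?thesis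
    using z class_eqI by (auto simp: ring_center_def carrier_presented class_mult)
qed

end

section \<open>The symmetric algebra\<close>

lemma sum_keys_superset:
  assumes "finite A" "Poly_Mapping.keys p \<subseteq> A" "\<And>k. g k 0 = 0"
  shows "(\<Sum>k\<in>Poly_Mapping.keys p. g k (Poly_Mapping.lookup p k)) = (\<Sum>k\<in>A. g k (Poly_Mapping.lookup p k))"
  using assms by (intro sum.mono_neutral_left) (auto simp: in_keys_iff)

text \<open>Cancellation can make the support of \<open>p + q\<close> smaller than the union of the
  two supports. Summing over the union is harmless, because additivity forces
  \<open>g k 0 = 0\<close>.\<close>

lemma sum_keys_add:
  fixes g :: "'a \<Rightarrow> 'b::ab_group_add \<Rightarrow> 'c::ab_group_add"
  assumes "\<And>k a b. g k (a + b) = g k a + g k b"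
  shows "(\<Sum>k\<in>Poly_Mapping.keys (p + q). g k (Poly_Mapping.lookup (p + q) k))
    = (\<Sum>k\<in>Poly_Mapping.keys p. g k (Poly_Mapping.lookup p k))
      + (\<Sum>k\<in>Poly_Mapping.keys q. g k (Poly_Mapping.lookup q k))"
proof -
  let ?A = "Poly_Mapping.keys p \<union> Poly_Mapping.keys q"
  have "g k 0 = 0" for k
    using assms[of k 0 0] by simp
  moreover have "Poly_Mapping.keys (p + q) \<subseteq> ?A"
    by (rule Poly_Mapping.keys_add)
  ultimately show ?thesis
    using sum_keys_superset[of ?A "p + q" g] sum_keys_superset[of ?A p g] sum_keys_superset[of ?A q g]
    by (simp add: lookup_add assms sum.distrib)
qed

lemma sum_keys_single:
  assumes "g k 0 = 0"
  shows "(\<Sum>x\<in>Poly_Mapping.keys (Poly_Mapping.single k a). g x (Poly_Mapping.lookup (Poly_Mapping.single k a) x)) = g k a"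
  using assms by (cases "a = 0") auto

lemma additive_sum:
  fixes f :: "'a::ab_group_add \<Rightarrow> 'b::ab_group_add"
  assumes "\<And>x y. f (x + y) = f x + f y"
  shows "f (sum g A) = (\<Sum>x\<in>A. f (g x))"
proof -
  have "f 0 = 0"
    using assms[of 0 0] by simp
  then show ?thesis
    by (induction A rule: infinite_finite_induct) (simp_all add: assms)
qed

text \<open>Replaces extension by linearity from the monomials: the coefficient stays inside the
  single term, so additivity is enough and the target needs no scalar multiplication. Nested uses
  prove identities in two arguments.\<close>

lemma additive_eqI:
  fixes f g :: "('a \<Rightarrow>\<^sub>0 'b::ab_group_add) \<Rightarrow> 'c::ab_group_add"
  assumes "\<And>p q. f (p + q) = f p + f q" "\<And>p q. g (p + q) = g p + g q"
    and "\<And>k a. f (Poly_Mapping.single k a) = g (Poly_Mapping.single k a)"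
  shows "f p = g p"
proof -
  let ?s = "\<Sum>k\<in>Poly_Mapping.keys p. Poly_Mapping.single k (Poly_Mapping.lookup p k)"
  have "f ?s = g ?s"
    by (simp add: additive_sum[of f] additive_sum[of g] assms)
  then show ?thesis
    using poly_mapping_eq_sum_single[of p] by simp
qed

definition sym_var :: "'n::finite \<Rightarrow> 'n sym" where
  "sym_var j = Poly_Mapping.single (Poly_Mapping.single j 1) 1"

lemma sym_vec_eq: "sym_vec v = (\<Sum>j\<in>UNIV. const (v $ j) * sym_var j)"
  by (simp add: sym_vec_def sym_var_def const_def mult_single)

lemma sym_vec_axis: "sym_vec (axis j 1) = sym_var j"
proof -
  have "sym_vec (axis j 1) = (\<Sum>i\<in>UNIV. if i = j then sym_var i else 0)"
    unfolding sym_vec_eq by (rule sum.cong) (auto simp: axis_def)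
  then show ?thesis
    by simp
qed

lemma sym_vec_add: "sym_vec (u + v) = sym_vec u + sym_vec v"
  by (simp add: sym_vec_eq const_add sum.distrib algebra_simps)

lemma sym_vec_scale: "sym_vec (c *s v) = const c * sym_vec v"
  by (simp add: sym_vec_eq const_mult sum_distrib_left mult.assoc)

lemma sym_var_mult_single:
  "sym_var j * Poly_Mapping.single \<mu> a = Poly_Mapping.single (Poly_Mapping.single j 1 + \<mu>) a"
  by (simp add: sym_var_def mult_single)

lemma exponent_split:
  assumes "Poly_Mapping.lookup \<mu> j \<noteq> 0"
  shows "Poly_Mapping.single j (1::nat) + (\<mu> - Poly_Mapping.single j 1) = \<mu>"
  using assms by (intro poly_mapping_eqI) (auto simp: lookup_add lookup_minus lookup_single when_def)

text \<open>The cases mirror the recursion of the pairing below, whose second argument is consumed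
  one variable at a time. Monomials are reached by induction on the total degree.\<close>

lemma sym_induct [case_names const var add]:
  fixes p :: "'n::finite sym"
  assumes const: "\<And>c. P (const c)"
    and var: "\<And>j q. P q \<Longrightarrow> P (sym_var j * q)"
    and add: "\<And>q r. P q \<Longrightarrow> P r \<Longrightarrow> P (q + r)"
  shows "P p"
proof -
  have monom: "P (Poly_Mapping.single \<mu> a)" for \<mu> and a :: complex
  proof (induction "\<Sum>j\<in>UNIV. Poly_Mapping.lookup \<mu> j" arbitrary: \<mu> rule: less_induct)
    case less
    show ?case
    proof (cases "\<mu> = 0")
      case True
      then show ?thesis
        using const[of a] by (simp add: const_def)
    next
      case False
      then obtain j where j: "Poly_Mapping.lookup \<mu> j \<noteq> 0"
        by (metis lookup_zero poly_mapping_eqI)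
      let ?\<nu> = "\<mu> - Poly_Mapping.single j 1"
      have "(\<Sum>i\<in>UNIV. Poly_Mapping.lookup ?\<nu> i) < (\<Sum>i\<in>UNIV. Poly_Mapping.lookup \<mu> i)"
        by (rule sum_strict_mono_ex1) (use j in \<open>auto simp: lookup_minus lookup_single when_def\<close>)
      then have "P (sym_var j * Poly_Mapping.single ?\<nu> a)"
        by (intro var less)
      then show ?thesis
        by (simp only: sym_var_mult_single exponent_split[OF j])
    qed
  qed
  have "P (\<Sum>k\<in>A. Poly_Mapping.single k (Poly_Mapping.lookup p k))" for A
    by (induction A rule: infinite_finite_induct) (use const[of 0] monom add in auto)
  then show ?thesis
    using poly_mapping_eq_sum_single[of p] by metis
qed

section \<open>Partial derivatives and derivations of the symmetric algebra\<close>

lemma sym_partial_add: "sym_partial j (p + q) = sym_partial j p + sym_partial j q"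
  unfolding sym_partial_def
  by (rule sum_keys_add) (simp add: distrib_left single_add)

lemma sym_partial_single: "sym_partial j (Poly_Mapping.single \<mu> a) =
    Poly_Mapping.single (\<mu> - Poly_Mapping.single j 1) (of_nat (Poly_Mapping.lookup \<mu> j) * a)"
  unfolding sym_partial_def
  by (subst sum_keys_single[where g = "\<lambda>\<mu> a. Poly_Mapping.single (\<mu> - Poly_Mapping.single j 1) (of_nat (Poly_Mapping.lookup \<mu> j) * a)"])
    simp_all

lemma sym_partial_const: "sym_partial j (const c) = 0"
  by (simp add: const_def sym_partial_single)

lemma sym_partial_var: "sym_partial j (sym_var i) = (if i = j then 1 else 0)"
  by (simp add: sym_var_def sym_partial_single lookup_single)

lemma exponent_diff_add:
  assumes "Poly_Mapping.lookup \<mu> j \<noteq> (0::nat)"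
  shows "\<mu> - Poly_Mapping.single j 1 + \<nu> = \<mu> + \<nu> - Poly_Mapping.single j 1"
  using assms by (intro poly_mapping_eqI) (auto simp: lookup_add lookup_minus lookup_single when_def)

lemma sym_partial_mult: "sym_partial j (p * q) = sym_partial j p * q + p * sym_partial j q"
proof (rule additive_eqI[of "\<lambda>p. sym_partial j (p * q)"])
  fix \<mu> a
  show "sym_partial j (Poly_Mapping.single \<mu> a * q)
      = sym_partial j (Poly_Mapping.single \<mu> a) * q + Poly_Mapping.single \<mu> a * sym_partial j q"
  proof (rule additive_eqI[of "\<lambda>q. sym_partial j (Poly_Mapping.single \<mu> a * q)"])
    fix \<nu> b
    let ?e = "Poly_Mapping.single j (1::nat)"
    \<comment> \<open>If the exponent of \<open>j\<close> in \<mu> vanishes, truncated subtraction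
      makes the two exponents differ, but then the coefficient is zero.\<close>
    have "Poly_Mapping.single (\<mu> - ?e + \<nu>) (of_nat (Poly_Mapping.lookup \<mu> j) * a * b)
        = Poly_Mapping.single (\<mu> + \<nu> - ?e) (of_nat (Poly_Mapping.lookup \<mu> j) * a * b)"
      by (cases "Poly_Mapping.lookup \<mu> j = 0") (simp_all add: exponent_diff_add[simplified])
    moreover have "Poly_Mapping.single (\<mu> + (\<nu> - ?e)) (a * (of_nat (Poly_Mapping.lookup \<nu> j) * b))
        = Poly_Mapping.single (\<mu> + \<nu> - ?e) (a * (of_nat (Poly_Mapping.lookup \<nu> j) * b))"
      using exponent_diff_add[of \<nu> j \<mu>]
      by (cases "Poly_Mapping.lookup \<nu> j = 0") (simp_all add: add.commute)
    ultimately show "sym_partial j (Poly_Mapping.single \<mu> a * Poly_Mapping.single \<nu> b)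
      = sym_partial j (Poly_Mapping.single \<mu> a) * Poly_Mapping.single \<nu> b
        + Poly_Mapping.single \<mu> a * sym_partial j (Poly_Mapping.single \<nu> b)"
      by (simp add: mult_single sym_partial_single lookup_add algebra_simps flip: single_add)
  qed (simp_all add: sym_partial_add algebra_simps)
qed (simp_all add: sym_partial_add algebra_simps)

lemma sym_partial_commute: "sym_partial i (sym_partial j p) = sym_partial j (sym_partial i p)"
proof (rule additive_eqI[of "\<lambda>p. sym_partial i (sym_partial j p)"])
  fix \<mu> a
  have "\<mu> - Poly_Mapping.single j (1::nat) - Poly_Mapping.single i 1
      = \<mu> - Poly_Mapping.single i 1 - Poly_Mapping.single j 1"
    by (intro poly_mapping_eqI) (simp add: lookup_minus)
  then show "sym_partial i (sym_partial j (Poly_Mapping.single \<mu> a))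
      = sym_partial j (sym_partial i (Poly_Mapping.single \<mu> a))"
    by (cases "i = j") (simp_all add: sym_partial_single lookup_minus lookup_single when_def mult_ac)
qed (simp_all add: sym_partial_add)

lemma sym_deriv_eq: "sym_deriv f p = (\<Sum>j\<in>UNIV. const (f (axis j 1)) * sym_partial j p)"
  by (simp add: sym_deriv_def sym_scale_def)

lemma sym_deriv_add: "sym_deriv f (p + q) = sym_deriv f p + sym_deriv f q"
  by (simp add: sym_deriv_eq sym_partial_add distrib_left sum.distrib)

lemma sym_deriv_mult: "sym_deriv f (p * q) = sym_deriv f p * q + p * sym_deriv f q"
  by (simp add: sym_deriv_eq sym_partial_mult algebra_simps sum.distrib sum_distrib_left sum_distrib_right)

lemma sym_deriv_const: "sym_deriv f (const c) = 0"
  by (simp add: sym_deriv_eq sym_partial_const)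

lemma sym_deriv_scale: "sym_deriv f (const c * p) = const c * sym_deriv f p"
  by (simp add: sym_deriv_mult sym_deriv_const)

lemma sym_deriv_commute: "sym_deriv f (sym_deriv g p) = sym_deriv g (sym_deriv f p)"
proof -
  have "sym_partial j (const c * p) = const c * sym_partial j p" for j c and p :: "'a sym"
    by (simp add: sym_partial_mult sym_partial_const)
  then have "sym_deriv f (sym_deriv g p) = (\<Sum>i\<in>UNIV. \<Sum>j\<in>UNIV.
      const (f (axis i 1)) * (const (g (axis j 1)) * sym_partial i (sym_partial j p)))" for f g
    by (simp add: sym_deriv_eq additive_sum[of "sym_partial _", OF sym_partial_add] sum_distrib_left)
  note this[of f g] 
  also have "(\<Sum>i\<in>UNIV. \<Sum>j\<in>UNIV.
      const (f (axis i 1)) * (const (g (axis j 1)) * sym_partial i (sym_partial j p)))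
    = (\<Sum>j\<in>UNIV. \<Sum>i\<in>UNIV.
      const (g (axis j 1)) * (const (f (axis i 1)) * sym_partial j (sym_partial i p)))"
    by (subst sum.swap) (intro sum.cong refl, simp add: sym_partial_commute[of _ _ p] mult_ac)
  also have "\<dots> = sym_deriv g (sym_deriv f p)"
    by (simp add: \<open>\<And>f g. sym_deriv f (sym_deriv g p) = _ f g\<close>)
  finally show ?thesis .
qed

lemma sym_deriv_lin: "sym_deriv (\<lambda>z. a * f z + b * g z) p = const a * sym_deriv f p + const b * sym_deriv g p"
  by (simp add: sym_deriv_eq const_add const_mult sum.distrib sum_distrib_left algebra_simps)

lemma sym_deriv_zero [simp]: "sym_deriv (\<lambda>z. 0) p = 0"
  by (simp add: sym_deriv_eq)

lemma cx_linear_eq_sum: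
  assumes "cx_linear f"
  shows "f v = (\<Sum>j\<in>UNIV. v $ j * f (axis j 1))"
proof -
  interpret Vector_Spaces.linear "(*s)" "(*)" f
    using assms by (simp add: cx_linear_def)
  have "f v = f (\<Sum>j\<in>UNIV. v $ j *s axis j 1)"
    by (simp add: basis_expansion)
  then show ?thesis
    by (simp add: sum scale)
qed

lemma sym_deriv_var: "sym_deriv f (sym_var j) = const (f (axis j 1))"
  by (simp add: sym_deriv_eq sym_partial_var if_distrib[of "\<lambda>x. _ * x"] cong: if_cong)

lemma sym_deriv_vec: 
  assumes "cx_linear f"
  shows "sym_deriv f (sym_vec v) = const (f v)"
  by (simp add: cx_linear_eq_sum[OF assms, of v] sym_vec_eq const_sum const_mult sym_deriv_scale
      sym_deriv_var additive_sum[of "sym_deriv f", OF sym_deriv_add])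

lemma commute_funpow_left:
  assumes "f \<circ> g = g \<circ> f"
  shows "(f ^^ m) \<circ> g = g \<circ> (f ^^ m)"
  by (induction m) (simp_all add: fun_eq_iff, metis assms comp_apply)

lemma commute_funpow:
  assumes "f \<circ> g = g \<circ> f"
  shows "(f ^^ m) \<circ> (g ^^ n) = (g ^^ n) \<circ> (f ^^ m)"
  by (metis assms commute_funpow_left)

text \<open>Raising the exponent at \<open>j\<close> by one amounts to one further application of
  \<open>D j\<close>, which commutes with all factors and can be pulled to the right end. The
  distinction on \<open>j \<in> A\<close> keeps the induction over finite sets going until
  \<open>j\<close> itself is inserted. The resulting recursion replaces the fold from here
  on.\<close>

lemma fold_commuting_powers_add_one:
  fixes D :: "'i \<Rightarrow> 'a \<Rightarrow> 'a"
  assumes comm: "\<And>i j. D i \<circ> D j = D j \<circ> D i" and "finite A"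
  shows "Finite_Set.fold (\<lambda>i T. (D i ^^ ((if i = j then 1 else 0) + n i)) \<circ> T) id A
    = Finite_Set.fold (\<lambda>i T. (D i ^^ n i) \<circ> T) id A \<circ> (if j \<in> A then D j else id)"
proof -
  have cf: "comp_fun_commute_on UNIV (\<lambda>i T. (D i ^^ n i) \<circ> T)" for n :: "'i \<Rightarrow> nat"
    by standard (simp add: fun_eq_iff, metis commute_funpow[OF comm] comp_apply)
  let ?F = "\<lambda>n. Finite_Set.fold (\<lambda>i T. (D i ^^ n i) \<circ> T) id"
  have ins: "?F n (insert x A) = (D x ^^ n x) \<circ> ?F n A" if "finite A" "x \<notin> A" for n x A
    using that by (intro comp_fun_commute_on.fold_insert[OF cf]) auto
  have commF: "D j \<circ> ?F n A = ?F n A \<circ> D j" if "finite A" for A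
    using that
  proof (induction A rule: finite_induct)
    case (insert x A)
    have "D j \<circ> ((D x ^^ n x) \<circ> ?F n A) = (D x ^^ n x) \<circ> (D j \<circ> ?F n A)"
      unfolding comp_assoc[symmetric] by (simp only: commute_funpow_left[OF comm])
    then show ?case
      by (simp only: ins[OF insert(1,2)] insert(3) comp_assoc)
  qed simp
  let ?n = "\<lambda>i. (if i = j then 1 else 0) + n i"
  show ?thesis
    using \<open>finite A\<close>
  proof (induction A rule: finite_induct)
    case (insert x A)
    show ?case
    proof (cases "x = j")
      case True
      then have "j \<notin> A"
        using insert(2) by auto
      then have "?F ?n A = ?F n A"
        using insert(3) by (simp only: if_False comp_id)
      then have "?F ?n (insert j A) = (D j ^^ Suc (n j)) \<circ> ?F n A"
        using ins[OF insert(1) \<open>j \<notin> A\<close>, of ?n] by (simp only: if_True refl plus_1_eq_Suc)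
      also have "\<dots> = ?F n (insert j A) \<circ> D j"
        by (simp only: ins[OF insert(1) \<open>j \<notin> A\<close>] funpow_Suc_right comp_assoc commF[OF insert(1)])
      finally show ?thesis
        using True by (simp only: insertI1 if_True)
    next
      case False
      then have "?n x = n x" "j \<in> insert x A \<longleftrightarrow> j \<in> A"
        by auto
      then show ?thesis
        by (simp only: ins[OF insert(1,2)] insert(3) comp_assoc)
    qed
  qed simp
qed

section \<open>Constant-coefficient operators and the pairing on polynomials\<close>

definition coord_deriv :: "('n \<Rightarrow> complex^'n) \<Rightarrow> 'n \<Rightarrow> 'n::finite sym \<Rightarrow> 'n sym" where
  "coord_deriv b j = sym_deriv (to_dual b (axis j 1))"

definition monomial_op :: "('n \<Rightarrow> complex^'n) \<Rightarrow> ('n \<Rightarrow>\<^sub>0 nat) \<Rightarrow> 'n::finite sym \<Rightarrow> 'n sym" where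
  "monomial_op b \<mu> = Finite_Set.fold (\<lambda>j T. (coord_deriv b j ^^ Poly_Mapping.lookup \<mu> j) \<circ> T) id UNIV"

lemma coord_deriv_commute: "coord_deriv b i \<circ> coord_deriv b j = coord_deriv b j \<circ> coord_deriv b i"
  by (simp add: fun_eq_iff coord_deriv_def sym_deriv_commute)

lemma monomial_op_Suc:
  "monomial_op b (Poly_Mapping.single j 1 + \<mu>) Q = monomial_op b \<mu> (coord_deriv b j Q)"
proof -
  have "Poly_Mapping.lookup (Poly_Mapping.single j 1 + \<mu>) i = (if i = j then 1 else 0) + Poly_Mapping.lookup \<mu> i" for i
    by (simp add: lookup_add lookup_single when_def)
  then show ?thesis
    using fold_commuting_powers_add_one[of "coord_deriv b" UNIV j "Poly_Mapping.lookup \<mu>", OF coord_deriv_commute]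
    by (simp add: monomial_op_def)
qed

lemma const_coeff_op_eq:
  "const_coeff_op b P Q = (\<Sum>\<mu>\<in>Poly_Mapping.keys P. const (Poly_Mapping.lookup P \<mu>) * monomial_op b \<mu> Q)"
  by (simp add: const_coeff_op_def monomial_op_def coord_deriv_def sym_scale_def)

lemma const_coeff_op_add: "const_coeff_op b (P + P') Q = const_coeff_op b P Q + const_coeff_op b P' Q"
  unfolding const_coeff_op_eq by (rule sum_keys_add) (simp add: const_add distrib_right)

lemma const_coeff_op_single:
  "const_coeff_op b (Poly_Mapping.single \<mu> a) Q = const a * monomial_op b \<mu> Q"
  unfolding const_coeff_op_eq
  by (subst sum_keys_single[where g = "\<lambda>\<mu> a. const a * monomial_op b \<mu> Q"]) simp_all

lemma const_coeff_op_var_mult: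
  "const_coeff_op b (sym_var j * P) Q = const_coeff_op b P (coord_deriv b j Q)"
proof (rule additive_eqI[of "\<lambda>P. const_coeff_op b (sym_var j * P) Q"])
  show "const_coeff_op b (sym_var j * Poly_Mapping.single \<mu> a) Q
      = const_coeff_op b (Poly_Mapping.single \<mu> a) (coord_deriv b j Q)" for \<mu> a
    by (simp only: sym_var_mult_single const_coeff_op_single monomial_op_Suc)
qed (simp_all add: const_coeff_op_add distrib_left)

lemma const_coeff_op_const: "const_coeff_op b (const c) Q = const c * Q"
proof -
  have "comp_fun_commute_on UNIV (\<lambda>(j::'a) (T :: 'a sym \<Rightarrow> 'a sym). T)"
    by standard simp
  then have "Finite_Set.fold (\<lambda>j T. T) id A = (id :: 'a sym \<Rightarrow> 'a sym)" for A :: "'a set"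
    by (induction A rule: infinite_finite_induct) (simp_all add: comp_fun_commute_on.fold_insert)
  then have "monomial_op b 0 Q = Q"
    by (simp add: monomial_op_def)
  then show ?thesis
    unfolding const_def[of c] using const_coeff_op_single[of b 0 c Q] by (simp add: const_def)
qed

text \<open>The hermitian form without its conjugation. Adjointness and symmetry are proved for this
  complex-bilinear pairing, and conjugation is brought back only at the end, where real polynomials
  make it harmless.\<close>

definition sym_pairing :: "('n \<Rightarrow> complex^'n) \<Rightarrow> 'n::finite sym \<Rightarrow> 'n sym \<Rightarrow> complex" where
  "sym_pairing b P Q = Poly_Mapping.lookup (const_coeff_op b Q P) 0"

lemma sym_form_eq: "sym_form b P Q = sym_pairing (of_real_vec \<circ> b) (sym_cnj P) Q"
  by (simp add: sym_form_def sym_pairing_def)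

lemma sym_pairing_add_right: "sym_pairing b P (Q + Q') = sym_pairing b P Q + sym_pairing b P Q'"
  by (simp add: sym_pairing_def const_coeff_op_add lookup_add)

lemma sym_pairing_const: "sym_pairing b P (const c) = c * Poly_Mapping.lookup P 0"
  by (simp add: sym_pairing_def const_coeff_op_const lookup_const_mult)

lemma sym_pairing_var: "sym_pairing b P (sym_var j * Q) = sym_pairing b (coord_deriv b j P) Q"
  by (simp add: sym_pairing_def const_coeff_op_var_mult)

lemma coord_deriv_add: "coord_deriv b j (P + Q) = coord_deriv b j P + coord_deriv b j Q"
  by (simp add: coord_deriv_def sym_deriv_add)

lemma coord_deriv_scale: "coord_deriv b j (const c * P) = const c * coord_deriv b j P"
  by (simp add: coord_deriv_def sym_deriv_scale)

lemma sym_pairing_add_left: "sym_pairing b (P + P') Q = sym_pairing b P Q + sym_pairing b P' Q"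
  by (induction Q arbitrary: P P' rule: sym_induct)
    (simp_all add: sym_pairing_const sym_pairing_var sym_pairing_add_right coord_deriv_add
      lookup_add distrib_left)

lemma sym_pairing_scale_left: "sym_pairing b (const c * P) Q = c * sym_pairing b P Q"
  by (induction Q arbitrary: P rule: sym_induct)
    (simp_all add: sym_pairing_const sym_pairing_var sym_pairing_add_right coord_deriv_scale
      lookup_const_mult distrib_left)

lemma sym_pairing_scale_right: "sym_pairing b P (const c * Q) = c * sym_pairing b P Q"
proof (induction Q arbitrary: P rule: sym_induct)
  case (const d)
  then show ?case
    by (simp add: sym_pairing_const flip: const_mult)
next
  case (var j q)
  then show ?case
    by (simp add: sym_pairing_var mult.left_commute[of "const c"])
qed (simp_all add: sym_pairing_add_right distrib_left)

lemma to_dual_eq_sum: 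
  assumes "\<And>i. cx_linear (dual_functional b i)"
  shows "to_dual b v u = (\<Sum>j\<in>UNIV. v $ j * to_dual b (axis j 1) u)"
proof -
  have "to_dual b v u = (\<Sum>i\<in>UNIV. \<Sum>j\<in>UNIV. v $ j * (dual_functional b i (axis j 1) * dual_functional b i u))"
    unfolding to_dual_def
    by (intro sum.cong refl) (simp add: cx_linear_eq_sum[OF assms, of _ v] sum_distrib_right mult.assoc)
  also have "\<dots> = (\<Sum>j\<in>UNIV. v $ j * to_dual b (axis j 1) u)"
    by (subst sum.swap) (simp add: to_dual_def sum_distrib_left)
  finally show ?thesis .
qed

lemma to_dual_sym: "to_dual b u v = to_dual b v u"
  by (simp add: to_dual_def mult.commute)

lemma cx_linear_sum_dual: 
  assumes "\<And>i. cx_linear (dual_functional b i)"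
  shows "cx_linear (to_dual b v)"
  using assms unfolding cx_linear_def Vector_Spaces.linear_iff to_dual_def
  by (simp add: sum.distrib distrib_left sum_distrib_left mult_ac)

text \<open>For the coordinate variables this is the recursion of the operator itself; the general
  case follows because \<open>to_dual b v\<close> depends linearly on \<open>v\<close>.\<close>

lemma sym_pairing_vec:
  assumes "\<And>i. cx_linear (dual_functional b i)"
  shows "sym_pairing b P (sym_vec v * Q) = sym_pairing b (sym_deriv (to_dual b v) P) Q"
proof -
  have "sym_deriv (to_dual b v) P = (\<Sum>j\<in>UNIV. const (v $ j) * coord_deriv b j P)"
  proof -
    have "sym_deriv (to_dual b v) P = (\<Sum>i\<in>UNIV. \<Sum>j\<in>UNIV.
        const (v $ j) * (const (to_dual b (axis j 1) (axis i 1)) * sym_partial i P))"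
      unfolding sym_deriv_eq
      by (intro sum.cong refl)
        (simp add: to_dual_eq_sum[OF assms, of v] const_sum const_mult sum_distrib_right mult.assoc)
    then show ?thesis
      by (subst (asm) sum.swap) (simp add: coord_deriv_def sym_deriv_eq sum_distrib_left)
  qed
  then show ?thesis
    by (simp add: sym_vec_eq sum_distrib_right mult.assoc sym_pairing_scale_right sym_pairing_scale_left
        sym_pairing_var additive_sum[of "sym_pairing b P", OF sym_pairing_add_right]
        additive_sum[of "\<lambda>P. sym_pairing b P Q", OF sym_pairing_add_left])
qed

lemma lookup_sym_var_mult_0: "Poly_Mapping.lookup (sym_var j * P) 0 = 0"
proof (rule additive_eqI[of "\<lambda>P. Poly_Mapping.lookup (sym_var j * P) 0" "\<lambda>_. 0"])
  fix \<mu> :: "'a \<Rightarrow>\<^sub>0 nat" and a :: complex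
  have "Poly_Mapping.lookup (Poly_Mapping.single j 1 + \<mu>) j \<noteq> Poly_Mapping.lookup 0 j"
    by (simp add: lookup_add)
  then have "Poly_Mapping.single j 1 + \<mu> \<noteq> 0"
    by metis
  then show "Poly_Mapping.lookup (sym_var j * Poly_Mapping.single \<mu> a) 0 = 0"
    by (simp only: sym_var_mult_single lookup_single when_def if_False)
qed (simp_all add: distrib_left lookup_add)

text \<open>Adjointness in the first argument is not built into the definition. Taking a variable
  off \<open>Q\<close> differentiates \<open>sym_vec v * P\<close>; the extra scalar from the
  product rule is \<open>to_dual b v (axis j 1)\<close>, and by the symmetry of
  \<open>to_dual\<close> it is also the scalar produced when \<open>sym_var j * q\<close> is
  differentiated on the other side.\<close>

lemma sym_pairing_vec_left:
  assumes lin: "\<And>i. cx_linear (dual_functional b i)"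
  shows "sym_pairing b (sym_vec v * P) Q = sym_pairing b P (sym_deriv (to_dual b v) Q)"
proof (induction Q arbitrary: P rule: sym_induct)
  case (const c)
  have "Poly_Mapping.lookup (sym_vec v * P) 0 = 0"
    by (simp add: sym_vec_eq sum_distrib_right lookup_sum mult.assoc lookup_const_mult lookup_sym_var_mult_0)
  moreover have "sym_pairing b P 0 = 0"
    using sym_pairing_const[of b P 0] by simp
  ultimately show ?case
    by (simp add: sym_pairing_const sym_deriv_const)
next
  case (var j q)
  let ?c = "to_dual b v (axis j 1)"
  have "sym_pairing b (sym_vec v * P) (sym_var j * q)
      = sym_pairing b (const ?c * P + sym_vec v * coord_deriv b j P) q"
    by (simp add: sym_pairing_var coord_deriv_def sym_deriv_mult
        sym_deriv_vec[OF cx_linear_sum_dual[OF lin]] to_dual_sym[of b "axis j 1"])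
  also have "\<dots> = sym_pairing b P (const ?c * q) + sym_pairing b (coord_deriv b j P) (sym_deriv (to_dual b v) q)"
    by (simp add: sym_pairing_add_left sym_pairing_scale_left sym_pairing_scale_right var)
  also have "\<dots> = sym_pairing b P (sym_deriv (to_dual b v) (sym_var j * q))"
    by (simp add: sym_deriv_mult sym_deriv_var sym_pairing_add_right sym_pairing_var)
  finally show ?case .
qed (simp_all add: sym_pairing_add_right sym_deriv_add)

text \<open>The two adjointness rules move a variable off either argument in the same way, which
  leaves the case of a constant, where only constant terms count.\<close>

lemma sym_pairing_commute:
  assumes lin: "\<And>i. cx_linear (dual_functional b i)"
  shows "sym_pairing b P Q = sym_pairing b Q P"
proof (induction Q arbitrary: P rule: sym_induct)
  case (const c)
  show ?case
  proof (induction P rule: sym_induct)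
    case (const d)
    then show ?case
      by (simp add: sym_pairing_const) (simp add: const_def)
  next
    case (var j q)
    have "coord_deriv b j (const c) = 0" "sym_pairing b 0 q = 0"
      using sym_pairing_scale_left[of b 0 0 q] by (simp_all add: coord_deriv_def sym_deriv_const)
    then show ?case
      by (simp add: sym_pairing_const sym_pairing_var lookup_sym_var_mult_0)
  qed (simp_all add: sym_pairing_add_right sym_pairing_add_left)
next
  case (var j q)
  have "sym_pairing b (sym_var j * q) P = sym_pairing b q (coord_deriv b j P)"
    using sym_pairing_vec_left[OF lin, of "axis j 1" q P] by (simp add: sym_vec_axis coord_deriv_def)
  then show ?case
    by (simp add: sym_pairing_var var)
qed (simp_all add: sym_pairing_add_right sym_pairing_add_left)

lemma lookup_sym_cnj: "Poly_Mapping.lookup (sym_cnj p) \<mu> = cnj (Poly_Mapping.lookup p \<mu>)"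
  by (simp add: sym_cnj_def Poly_Mapping.map.rep_eq when_def)

lemma sym_cnj_add: "sym_cnj (p + q) = sym_cnj p + sym_cnj q"
  by (intro poly_mapping_eqI) (simp add: lookup_sym_cnj lookup_add)

lemma sym_cnj_scale: "sym_cnj (const c * p) = const (cnj c) * sym_cnj p"
  by (intro poly_mapping_eqI) (simp add: lookup_sym_cnj lookup_const_mult)

lemma sym_form_add_left: "sym_form b (P + P') Q = sym_form b P Q + sym_form b P' Q"
  by (simp add: sym_form_eq sym_cnj_add sym_pairing_add_left)

lemma sym_form_add_right: "sym_form b P (Q + Q') = sym_form b P Q + sym_form b P Q'"
  by (simp add: sym_form_eq sym_pairing_add_right)

lemma sym_form_scale_left: "sym_form b (const c * P) Q = cnj c * sym_form b P Q"
  by (simp add: sym_form_eq sym_cnj_scale sym_pairing_scale_left)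

lemma sym_form_scale_right: "sym_form b P (const c * Q) = c * sym_form b P Q"
  by (simp add: sym_form_eq sym_pairing_scale_right)

section \<open>The action of the Weyl algebra and the tensor product\<close>

definition weyl_gen_act :: "(complex^'n) \<times> 'n::finite cofun \<Rightarrow> 'n sym \<Rightarrow> 'n sym" where
  "weyl_gen_act = (\<lambda>(v, f) p. sym_vec v * p + sym_deriv f p)"

abbreviation weyl_free_act :: "((complex^'n) \<times> 'n::finite cofun) free \<Rightarrow> 'n sym \<Rightarrow> 'n sym" where
  "weyl_free_act \<equiv> free_act sym_scale weyl_gen_act"

lemma weyl_gen_act_pair: "weyl_gen_act (v, f) p = sym_vec v * p + sym_deriv f p"
  by (simp add: weyl_gen_act_def)

lemma weyl_gen_act_add: "weyl_gen_act x (p + q) = weyl_gen_act x p + weyl_gen_act x q"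
  by (cases x) (simp add: weyl_gen_act_pair sym_deriv_add algebra_simps)

lemma weyl_gen_act_scale: "weyl_gen_act x (const c * p) = const c * weyl_gen_act x p"
  by (cases x) (simp add: weyl_gen_act_pair sym_deriv_scale distrib_left mult.left_commute[of _ "const c"])

lemma weyl_free_act_eq:
  "weyl_free_act p q = (\<Sum>w\<in>Poly_Mapping.keys p. const (Poly_Mapping.lookup p w) * foldr weyl_gen_act (letters w) q)"
  by (simp add: free_act_def sym_scale_def)

lemma weyl_free_act_add_left: "weyl_free_act (p + p') q = weyl_free_act p q + weyl_free_act p' q"
  unfolding weyl_free_act_eq by (rule sum_keys_add) (simp add: const_add distrib_right)

lemma weyl_free_act_single:
  "weyl_free_act (Poly_Mapping.single w c) q = const c * foldr weyl_gen_act (letters w) q"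
  unfolding weyl_free_act_eq
  by (subst sum_keys_single[where g = "\<lambda>w c. const c * foldr weyl_gen_act (letters w) q"]) simp_all

lemma weyl_free_act_const: "weyl_free_act (const c) q = const c * q"
  using weyl_free_act_single[of 0 c q] by (simp add: const_def zero_word_def)

lemma weyl_free_act_gen_mult: "weyl_free_act (gen x * p) q = weyl_gen_act x (weyl_free_act p q)"
proof (rule additive_eqI[of "\<lambda>p. weyl_free_act (gen x * p) q"])
  fix w :: "((complex^'a) \<times> 'a cofun) word" and c
  obtain l where w: "w = Word l"
    by (cases w)
  show "weyl_free_act (gen x * Poly_Mapping.single w c) q = weyl_gen_act x (weyl_free_act (Poly_Mapping.single w c) q)"
    unfolding w by (simp add: weyl_free_act_single weyl_gen_act_scale flip: gen_Cons)
qed (simp_all add: weyl_free_act_add_left weyl_gen_act_add distrib_left)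

lemma weyl_free_act_gen: "weyl_free_act (gen x) q = weyl_gen_act x q"
  using weyl_free_act_gen_mult[of x 1 q] weyl_free_act_const[of 1 q] by simp

lemma weyl_free_act_const_mult: "weyl_free_act (const c * p) q = const c * weyl_free_act p q"
proof (rule additive_eqI[of "\<lambda>p. weyl_free_act (const c * p) q"])
  show "weyl_free_act (const c * Poly_Mapping.single w a) q = const c * weyl_free_act (Poly_Mapping.single w a) q" for w a
    using mult_single[of 0 c w a] by (simp add: weyl_free_act_single const_mult mult.assoc flip: const_def)
qed (simp_all add: weyl_free_act_add_left distrib_left)

lemma weyl_free_act_mult: "weyl_free_act (p * p') q = weyl_free_act p (weyl_free_act p' q)"
proof -
  have "p \<in> free_carrier UNIV"
    by (simp add: mem_free_carrier)
  then show ?thesis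
    by (induction p rule: free_induct)
      (simp_all add: weyl_free_act_const_mult weyl_free_act_const weyl_free_act_gen_mult
        weyl_free_act_add_left mult.assoc distrib_right)
qed

lemma weyl_free_act_add_right: "weyl_free_act p (q + q') = weyl_free_act p q + weyl_free_act p q'"
proof -
  have "p \<in> free_carrier UNIV"
    by (simp add: mem_free_carrier)
  then show ?thesis
    by (induction p rule: free_induct)
      (simp_all add: weyl_free_act_const weyl_free_act_gen_mult weyl_gen_act_add
        weyl_free_act_add_left distrib_left)
qed

lemma weyl_free_act_zero_right: "weyl_free_act p 0 = 0"
  using weyl_free_act_add_right[of p 0 0] by simp

lemma weyl_free_act_minus_left: "weyl_free_act (p - p') q = weyl_free_act p q - weyl_free_act p' q"
  using weyl_free_act_add_left[of "p - p'" p' q] by simp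

lemma cx_linear_lin: 
  assumes "cx_linear f" "cx_linear g"
  shows "cx_linear (\<lambda>z. a * f z + b * g z)"
  using assms unfolding cx_linear_def Vector_Spaces.linear_iff by (simp add: algebra_simps)

lemma cx_linear_zero: "cx_linear (\<lambda>z. 0)"
  unfolding cx_linear_def Vector_Spaces.linear_iff 
  using vec.vector_space_axioms vector_space_over_itself.vector_space_axioms by auto

lemma weyl_alg_presentation: "presentation weyl_alg_gens (weyl_alg_rels :: ((complex^'n) \<times> 'n::finite cofun) free set)"
  unfolding presentation_def weyl_alg_rels_def weyl_alg_gens_def
  by (auto simp: cx_linear_lin intro!: free_carrier_diff free_carrier_add free_carrier_mult)

text \<open>Multiplications commute with each other and so do derivations; only the two mixed
  product-rule terms remain.\<close>

lemma weyl_gen_act_commutator: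
  assumes "cx_linear f" "cx_linear g"
  shows "weyl_gen_act (u, f) (weyl_gen_act (v, g) q) - weyl_gen_act (v, g) (weyl_gen_act (u, f) q)
    = const (f v - g u) * q"
  by (simp add: weyl_gen_act_pair sym_deriv_add sym_deriv_mult sym_deriv_vec assms const_diff
      sym_deriv_commute[of f g] algebra_simps)

lemma weyl_rels_act:
  assumes "r \<in> weyl_alg_rels"
  shows "weyl_free_act r q = 0"
  using assms unfolding weyl_alg_rels_def
proof (elim UnE)
  assume "r \<in> {gen (a *s u + b *s v, \<lambda>z. a * f z + b * g z) - (const a * gen (u, f) + const b * gen (v, g))
        | a b u v f g. cx_linear f \<and> cx_linear g}"
  then show ?thesis
    by (auto simp: weyl_free_act_minus_left weyl_free_act_add_left weyl_free_act_gen weyl_free_act_const_mult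
        weyl_gen_act_pair sym_vec_add sym_vec_scale sym_deriv_lin) (simp add: algebra_simps)
next
  assume "r \<in> {gen x * gen y - gen y * gen x - const (symplectic x y)
        | x y. x \<in> weyl_alg_gens \<and> y \<in> weyl_alg_gens}"
  then show ?thesis
    by (auto simp: weyl_free_act_minus_left weyl_free_act_mult weyl_free_act_gen weyl_free_act_const
        weyl_gen_act_commutator weyl_alg_gens_def symplectic_def)
qed

text \<open>The elements of the free algebra that annihilate all polynomials form a two-sided ideal.
  It contains the relations, hence the ideal that they generate.\<close>

lemma weyl_ideal_act:
  assumes "r \<in> genideal (free_algebra weyl_alg_gens) (weyl_alg_rels :: ((complex^'n) \<times> 'n::finite cofun) free set)"
  shows "weyl_free_act r q = 0"
proof -
  let ?F = "free_algebra weyl_alg_gens :: ((complex^'n) \<times> 'n::finite cofun) free ring"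
  let ?K = "{r \<in> carrier ?F. \<forall>q. weyl_free_act r q = 0}"
  interpret P: presentation weyl_alg_gens "weyl_alg_rels :: ((complex^'n) \<times> 'n::finite cofun) free set"
    by (rule weyl_alg_presentation)
  have "ideal ?K ?F"
  proof (rule idealI)
    have neg: "a_inv ?F r = - r" if "r \<in> carrier ?F" for r
      by (rule P.F.minus_equality) (use that in auto)
    show "subgroup ?K (add_monoid ?F)"
    proof (rule P.F.add.subgroupI)
      show "?K \<noteq> {}"
        using weyl_free_act_minus_left[of 0 0] by (auto intro!: exI[of _ 0])
      show "a_inv ?F r \<in> ?K" if "r \<in> ?K" for r
        using that weyl_free_act_minus_left[of 0 r] weyl_free_act_minus_left[of 0 0] by (auto simp: neg)
    qed (auto simp: weyl_free_act_add_left)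
  qed (auto simp: weyl_free_act_mult weyl_free_act_zero_right P.F.ring_axioms)
  moreover have "weyl_alg_rels \<subseteq> ?K"
    using P.rels weyl_rels_act by blast
  ultimately show ?thesis
    using P.F.genideal_minimal assms by blast
qed

text \<open>The representative picked by \<open>SOME\<close> is unknown, but it differs from
  \<open>p\<close> by an element of the ideal, which acts as zero.\<close>

lemma weyl_alg_act_class:
  assumes "p \<in> free_carrier weyl_alg_gens"
  shows "weyl_alg_act (weyl_class p) q = weyl_free_act p q"
proof -
  interpret P: presentation weyl_alg_gens "weyl_alg_rels :: ((complex^'a) \<times> 'a::finite cofun) free set"
    by (rule weyl_alg_presentation)
  have "(SOME x. x \<in> weyl_class p) \<in> weyl_class p"
    using P.self_in_class[OF assms] by (auto simp: weyl_class_def intro: someI)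
  then have "P.cong (SOME x. x \<in> weyl_class p) p"
    using P.class_cong assms by (simp add: weyl_class_def)
  then have "weyl_free_act ((SOME x. x \<in> weyl_class p) - p) q = 0"
    by (intro weyl_ideal_act) (simp add: P.cong_def)
  then show ?thesis
    by (simp add: weyl_alg_act_def weyl_free_act_minus_left flip: weyl_gen_act_def)
qed

lemma weyl_alg_act_vec: "weyl_alg_act (weyl_vec v) q = sym_vec v * q"
  by (simp add: weyl_vec_def weyl_alg_act_class weyl_alg_gens_def cx_linear_zero weyl_free_act_gen
      weyl_gen_act_pair)

lemma sym_vec_0 [simp]: "sym_vec 0 = 0"
  by (simp add: sym_vec_eq)

lemma weyl_alg_act_cov: "cx_linear f \<Longrightarrow> weyl_alg_act (weyl_cov f) q = sym_deriv f q"
  by (simp add: weyl_cov_def weyl_alg_act_class weyl_alg_gens_def weyl_free_act_gen weyl_gen_act_pair)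

section \<open>Simple tensors, operators and forms on the tensor product\<close>

locale complex_space = vector_space scale
  for scale :: "complex \<Rightarrow> 'm \<Rightarrow> 'm::ab_group_add" (infixr "*\<^sub>c" 75)
begin

lemma tensor_add_right: "tensor scale m (p + q) = tensor scale m p + tensor scale m q"
  unfolding tensor_def by (rule sum_keys_add) (simp add: scale_left_distrib single_add)

lemma tensor_single: "tensor scale m (Poly_Mapping.single \<mu> c) = Poly_Mapping.single \<mu> (c *\<^sub>c m)"
  unfolding tensor_def by (subst sum_keys_single[where g = "\<lambda>\<mu> c. Poly_Mapping.single \<mu> (c *\<^sub>c m)"]) simp_all

lemma tensor_add_left: "tensor scale (m + m') p = tensor scale m p + tensor scale m' p"
  by (simp add: tensor_def scale_right_distrib single_add sum.distrib)

lemma tensor_scale_left: "tensor scale (c *\<^sub>c m) p = tensor scale m (const c * p)"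
proof (rule additive_eqI[of "tensor scale (c *\<^sub>c m)"])
  show "tensor scale (c *\<^sub>c m) (Poly_Mapping.single \<mu> a) = tensor scale m (const c * Poly_Mapping.single \<mu> a)" for \<mu> a
    by (simp add: tensor_single const_def mult_single mult.commute)
qed (simp_all add: tensor_add_right distrib_left)

lemma tensor_op_add:
  assumes "\<And>m m'. S (m + m') = S m + S m'"
  shows "tensor_op scale S T (t + t') = tensor_op scale S T t + tensor_op scale S T t'"
  unfolding tensor_op_def by (rule sum_keys_add) (simp add: assms tensor_add_left)

lemma tensor_0_left: "tensor scale 0 p = 0"
  using tensor_add_left[of 0 0 p] by simp

text \<open>\<open>tensor_op\<close> sees only the coefficients of the monomials, not the two
  factors. A coefficient can be moved from \<open>m\<close> to the polynomial, and linearity of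
  \<open>T\<close> reassembles \<open>T p\<close>.\<close>

lemma tensor_op_tensor:
  assumes S: "Vector_Spaces.linear scale scale S"
    and T: "\<And>p q. T (p + q) = T p + T q" "\<And>c p. T (const c * p) = const c * T p"
  shows "tensor_op scale S T (tensor scale m p) = tensor scale (S m) (T p)"
proof (rule additive_eqI[of "\<lambda>p. tensor_op scale S T (tensor scale m p)"])
  interpret S: Vector_Spaces.linear scale scale S
    by (rule S)
  fix \<mu> c
  have "tensor_op scale S T (Poly_Mapping.single \<mu> (c *\<^sub>c m)) = tensor scale (S (c *\<^sub>c m)) (T (Poly_Mapping.single \<mu> 1))"
    unfolding tensor_op_def
    by (subst sum_keys_single[where g = "\<lambda>\<mu> m. tensor scale (S m) (T (Poly_Mapping.single \<mu> 1))"])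
      (simp_all add: tensor_0_left)
  then show "tensor_op scale S T (tensor scale m (Poly_Mapping.single \<mu> c)) = tensor scale (S m) (T (Poly_Mapping.single \<mu> c))"
    using T(2)[of c "Poly_Mapping.single \<mu> 1"]
    by (simp add: tensor_single S.scale tensor_scale_left const_def mult_single)
next
  interpret S: Vector_Spaces.linear scale scale S
    by (rule S)
  show "tensor_op scale S T (tensor scale m (p + q)) = tensor_op scale S T (tensor scale m p) + tensor_op scale S T (tensor scale m q)" for p q
    by (simp add: tensor_add_right tensor_op_add[OF S.add])
qed (simp add: T tensor_add_right)

end

locale hermitian_module = complex_space scale
  for scale :: "complex \<Rightarrow> 'm \<Rightarrow> 'm::ab_group_add" +
  fixes h :: "'m \<Rightarrow> 'm \<Rightarrow> complex" and b :: "'n::finite \<Rightarrow> real^'n"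
  assumes herm: "hermitian_form scale h"
begin

lemma form_linear: "Vector_Spaces.linear scale (*) (h x)"
  using herm unfolding hermitian_form_def by blast

lemma form_add_right: "h x (y + z) = h x y + h x z"
  using form_linear[of x] unfolding Vector_Spaces.linear_iff by blast

lemma form_scale_right: "h x (scale c y) = c * h x y"
  using form_linear[of x] unfolding Vector_Spaces.linear_iff by blast

lemma form_cnj: "h y x = cnj (h x y)"
  using herm unfolding hermitian_form_def by blast

lemma form_add_left: "h (y + z) x = h y x + h z x"
  using form_add_right[of x y z] form_cnj[of x y] form_cnj[of x z] form_cnj[of x "y + z"]
  by (metis complex_cnj_add complex_cnj_cnj)

lemma form_scale_left: "h (scale c y) x = cnj c * h y x"
  using form_scale_right[of x c y] form_cnj[of x y] form_cnj[of x "scale c y"]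
  by (metis complex_cnj_mult complex_cnj_cnj)

lemma form_zero_left [simp]: "h 0 x = 0"
  using form_add_left[of 0 0 x] by simp

lemma form_zero_right [simp]: "h x 0 = 0"
  using form_add_right[of x 0 0] by simp

lemma tensor_form_add_left:
  "tensor_form h (sym_form b) (t + t') u = tensor_form h (sym_form b) t u + tensor_form h (sym_form b) t' u"
  unfolding tensor_form_def
  by (rule sum_keys_add) (simp add: form_add_left distrib_right sum.distrib)

lemma tensor_form_add_right:
  "tensor_form h (sym_form b) u (t + t') = tensor_form h (sym_form b) u t + tensor_form h (sym_form b) u t'"
  unfolding tensor_form_def sum.swap[of _ _ "Poly_Mapping.keys u"]
  by (rule sum_keys_add) (simp add: form_add_right distrib_right sum.distrib)

lemma tensor_form_single:
  "tensor_form h (sym_form b) (Poly_Mapping.single \<mu> x) (Poly_Mapping.single \<nu> y)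
    = h x y * sym_form b (Poly_Mapping.single \<mu> 1) (Poly_Mapping.single \<nu> 1)"
  by (cases "x = 0"; cases "y = 0") (simp_all add: tensor_form_def)

text \<open>A coefficient of \<open>p\<close> is absorbed by the vector \<open>x\<close>. Both forms
  are conjugate-linear in the first variable, so it leaves either of them with the same
  conjugate.\<close>

lemma tensor_form_tensor:
  "tensor_form h (sym_form b) (tensor scale x p) (tensor scale y q) = h x y * sym_form b p q"
proof (rule additive_eqI[of "\<lambda>p. tensor_form h (sym_form b) (tensor scale x p) (tensor scale y q)"])
  fix \<mu> c
  show "tensor_form h (sym_form b) (tensor scale x (Poly_Mapping.single \<mu> c)) (tensor scale y q)
      = h x y * sym_form b (Poly_Mapping.single \<mu> c) q"
  proof (rule additive_eqI[of "\<lambda>q. tensor_form h (sym_form b) (tensor scale x (Poly_Mapping.single \<mu> c)) (tensor scale y q)"])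
    fix \<nu> d
    show "tensor_form h (sym_form b) (tensor scale x (Poly_Mapping.single \<mu> c)) (tensor scale y (Poly_Mapping.single \<nu> d))
      = h x y * sym_form b (Poly_Mapping.single \<mu> c) (Poly_Mapping.single \<nu> d)"
      using sym_form_scale_left[of b c "Poly_Mapping.single \<mu> 1" "Poly_Mapping.single \<nu> d"]
        sym_form_scale_right[of b "Poly_Mapping.single \<mu> 1" d "Poly_Mapping.single \<nu> 1"]
      by (simp add: tensor_single tensor_form_single form_scale_left form_scale_right const_def mult_single)
  qed (simp_all add: tensor_add_right tensor_form_add_right sym_form_add_right distrib_left)
qed (simp_all add: tensor_add_right tensor_form_add_left sym_form_add_left distrib_left)

end

section \<open>Root systems\<close>

locale root_data =
  fixes \<Phi> \<Delta> :: "'n::finite root set" and cr :: "'n root \<Rightarrow> real^'n"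
    and B :: "real^'n \<Rightarrow> real^'n \<Rightarrow> real"
  assumes roots: "root_system \<Phi> cr"
    and simple: "simple_roots \<Phi> \<Delta>"
    and inner: "invariant_inner_product \<Phi> cr B"
begin

abbreviation "rf \<equiv> reflection cr"
abbreviation "W \<equiv> weyl_group \<Phi> cr"
abbreviation "pos \<equiv> positive_roots \<Phi> \<Delta>"

lemma finite_roots: "finite \<Phi>"
  using roots by (simp add: root_system_def)

lemma root_linear: "\<alpha> \<in> \<Phi> \<Longrightarrow> linear \<alpha>"
  using roots by (simp add: root_system_def)

lemma root_coroot [simp]: "\<alpha> \<in> \<Phi> \<Longrightarrow> \<alpha> (cr \<alpha>) = 2"
  using roots by (simp add: root_system_def)

lemma root_refl: "\<alpha> \<in> \<Phi> \<Longrightarrow> \<beta> \<in> \<Phi> \<Longrightarrow> \<alpha> \<circ> rf \<beta> \<in> \<Phi>"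
  using roots by (simp add: root_system_def)

lemma root_reduced: "\<alpha> \<in> \<Phi> \<Longrightarrow> (\<lambda>v. c * \<alpha> v) \<in> \<Phi> \<Longrightarrow> c = 1 \<or> c = - 1"
  using roots by (simp add: root_system_def)

lemma simple_root: "\<beta> \<in> \<Delta> \<Longrightarrow> \<beta> \<in> \<Phi>"
  using simple by (auto simp: simple_roots_def)

lemma finite_simple: "finite \<Delta>"
  using finite_roots simple finite_subset by (auto simp: simple_roots_def)

lemma simple_independent: "(\<And>v. (\<Sum>\<beta>\<in>\<Delta>. c \<beta> * \<beta> v) = 0) \<Longrightarrow> \<beta> \<in> \<Delta> \<Longrightarrow> c \<beta> = 0"
  using simple unfolding simple_roots_def by metis

lemma positive_root: "\<alpha> \<in> pos \<Longrightarrow> \<alpha> \<in> \<Phi>"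
  by (simp add: positive_roots_def)

lemma finite_positive: "finite pos"
  using finite_roots positive_root by (meson finite_subset subsetI)

lemma B_bilinear: "bilinear B" and B_sym: "B u v = B v u" and B_pos: "v \<noteq> 0 \<Longrightarrow> 0 < B v v"
  and B_weyl: "w \<in> W \<Longrightarrow> B (w u) (w v) = B u v"
  using inner unfolding invariant_inner_product_def by blast+

lemmas B_simps = bilinear_ladd[OF B_bilinear] bilinear_radd[OF B_bilinear]
  bilinear_lsub[OF B_bilinear] bilinear_rsub[OF B_bilinear]
  bilinear_lmul[OF B_bilinear] bilinear_rmul[OF B_bilinear]
  bilinear_lneg[OF B_bilinear] bilinear_rneg[OF B_bilinear]
  bilinear_lzero[OF B_bilinear] bilinear_rzero[OF B_bilinear]

lemma refl_weyl: "\<alpha> \<in> \<Phi> \<Longrightarrow> rf \<alpha> \<in> W"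
  using weyl_group.step[OF _ weyl_group.one] by fastforce

lemma refl_linear: "\<alpha> \<in> \<Phi> \<Longrightarrow> linear (rf \<alpha>)"
  using root_linear[of \<alpha>] unfolding reflection_def
  by (intro linearI) (simp_all add: linear_add linear_cmul algebra_simps)

lemma refl_refl: "\<alpha> \<in> \<Phi> \<Longrightarrow> rf \<alpha> (rf \<alpha> v) = v"
  using root_linear[of \<alpha>] by (simp add: reflection_def linear_diff linear_cmul algebra_simps)

lemma refl_comp_refl: "\<alpha> \<in> \<Phi> \<Longrightarrow> rf \<alpha> \<circ> rf \<alpha> = id"
  by (simp add: fun_eq_iff refl_refl)

lemma refl_coroot: "\<alpha> \<in> \<Phi> \<Longrightarrow> rf \<alpha> (cr \<alpha>) = - cr \<alpha>"
  by (simp add: reflection_def scaleR_2)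

lemma weyl_comp: "w \<in> W \<Longrightarrow> w' \<in> W \<Longrightarrow> w \<circ> w' \<in> W"
  by (induction rule: weyl_group.induct) (auto simp: comp_assoc intro: weyl_group.step)

lemma weyl_root: "w \<in> W \<Longrightarrow> \<alpha> \<in> \<Phi> \<Longrightarrow> \<alpha> \<circ> w \<in> \<Phi>"
  by (induction arbitrary: \<alpha> rule: weyl_group.induct) (auto simp: root_refl simp flip: comp_assoc)

text \<open>The reflection preserves \<open>B\<close> and negates \<open>cr \<alpha>\<close>;
  comparing \<open>B (cr \<alpha>) v\<close> before and after reflecting both arguments gives the
  identity. It says that \<open>B\<close> identifies the coroot with a multiple of the root.\<close>

lemma coroot_form: 
  assumes "\<alpha> \<in> \<Phi>"
  shows "2 * B (cr \<alpha>) v = \<alpha> v * B (cr \<alpha>) (cr \<alpha>)"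
proof -
  have "B (rf \<alpha> (cr \<alpha>)) (rf \<alpha> v) = B (cr \<alpha>) v"
    by (rule B_weyl[OF refl_weyl[OF assms]])
  then show ?thesis
    by (simp add: refl_coroot[OF assms]) (simp add: reflection_def B_simps)
qed

lemma coroot_form_pos: 
  assumes "\<alpha> \<in> \<Phi>"
  shows "0 < B (cr \<alpha>) (cr \<alpha>)"
proof (rule B_pos)
  show "cr \<alpha> \<noteq> 0"
    using root_coroot[OF assms] linear_0[OF root_linear[OF assms]] by force
qed

text \<open>The axioms say that reflections permute the set of coroots, not that the bijection
  \<open>cr\<close> is equivariant. Characterizing \<open>cr \<alpha>\<close> through
  \<open>B\<close> and \<alpha> supplies the equivariance in \<open>coroot_refl\<close>.\<close>

lemma coroot_unique:
  assumes \<alpha>: "\<alpha> \<in> \<Phi>" and x: "\<And>v. B x v = c * \<alpha> v" "\<alpha> x = 2"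
  shows "x = cr \<alpha>"
proof -
  let ?d = "B (cr \<alpha>) (cr \<alpha>) / 2"
  have d: "B (cr \<alpha>) v = ?d * \<alpha> v" for v
    using coroot_form[OF \<alpha>, of v] by (simp add: mult.commute)
  have c: "c = ?d"
    using x(1)[of "cr \<alpha>"] d[of x] x(2) B_sym[of x "cr \<alpha>"] root_coroot[OF \<alpha>] by simp
  have "B x v - B (cr \<alpha>) v = 0" for v
    by (simp only: x(1)[of v] d[of v] c diff_self)
  then have "B (x - cr \<alpha>) (x - cr \<alpha>) = 0"
    by (simp only: bilinear_lsub[OF B_bilinear])
  then show ?thesis
    using B_pos[of "x - cr \<alpha>"] by fastforce
qed

lemma coroot_refl:
  assumes \<alpha>: "\<alpha> \<in> \<Phi>" and \<beta>: "\<beta> \<in> \<Phi>"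
  shows "cr (\<alpha> \<circ> rf \<beta>) = rf \<beta> (cr \<alpha>)"
proof (rule coroot_unique[symmetric])
  show "\<alpha> \<circ> rf \<beta> \<in> \<Phi>"
    using assms by (rule root_refl)
  fix v
  have "B (rf \<beta> (cr \<alpha>)) v = B (rf \<beta> (cr \<alpha>)) (rf \<beta> (rf \<beta> v))"
    by (simp add: refl_refl \<beta>)
  also have "\<dots> = B (cr \<alpha>) (rf \<beta> v)"
    by (rule B_weyl[OF refl_weyl[OF \<beta>]])
  also have "\<dots> = (B (cr \<alpha>) (cr \<alpha>) / 2) * (\<alpha> \<circ> rf \<beta>) v"
    using coroot_form[OF \<alpha>, of "rf \<beta> v"] by (simp add: mult.commute)
  finally show "B (rf \<beta> (cr \<alpha>)) v = (B (cr \<alpha>) (cr \<alpha>) / 2) * (\<alpha> \<circ> rf \<beta>) v" .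
qed (simp add: refl_refl assms)

lemma refl_conjugate:
  assumes \<alpha>: "\<alpha> \<in> \<Phi>" and \<beta>: "\<beta> \<in> \<Phi>"
  shows "rf (\<alpha> \<circ> rf \<beta>) = rf \<beta> \<circ> rf \<alpha> \<circ> rf \<beta>"
proof
  fix v
  have "rf (\<alpha> \<circ> rf \<beta>) v = v - \<alpha> (rf \<beta> v) *\<^sub>R rf \<beta> (cr \<alpha>)"
    by (simp add: reflection_def[of cr "\<alpha> \<circ> rf \<beta>"] coroot_refl assms)
  also have "\<dots> = rf \<beta> (rf \<beta> v - \<alpha> (rf \<beta> v) *\<^sub>R cr \<alpha>)"
    using refl_linear[OF \<beta>] by (simp add: linear_diff linear_cmul refl_refl \<beta>)
  finally show "rf (\<alpha> \<circ> rf \<beta>) v = (rf \<beta> \<circ> rf \<alpha> \<circ> rf \<beta>) v"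
    by (simp add: reflection_def[of cr \<alpha>])
qed

text \<open>The conjugation formula solved for the reflection in \<alpha>: the form in which an
  induction reduces \<alpha> to \<open>\<alpha> \<circ> rf \<beta>\<close>.\<close>

lemma refl_conjugate':
  assumes \<alpha>: "\<alpha> \<in> \<Phi>" and \<beta>: "\<beta> \<in> \<Phi>"
  shows "rf \<alpha> = rf \<beta> \<circ> rf (\<alpha> \<circ> rf \<beta>) \<circ> rf \<beta>"
  by (simp add: refl_conjugate[OF assms] fun_eq_iff refl_refl \<beta>)

lemma root_neg: 
  assumes "\<alpha> \<in> \<Phi>"
  shows "(\<lambda>v. - \<alpha> v) \<in> \<Phi>" 
proof -
  have "\<alpha> \<circ> rf \<alpha> = (\<lambda>v. - \<alpha> v)"
    using root_linear[OF assms] assms by (simp add: fun_eq_iff reflection_def linear_diff linear_cmul)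
  then show ?thesis
    using root_refl[OF assms assms] by simp
qed

lemma refl_neg:
  assumes "\<alpha> \<in> \<Phi>"
  shows "rf (\<lambda>v. - \<alpha> v) = rf \<alpha>"
proof -
  have "- cr \<alpha> = cr (\<lambda>v. - \<alpha> v)"
  proof (rule coroot_unique[OF root_neg[OF assms]])
    show "B (- cr \<alpha>) v = B (cr \<alpha>) (cr \<alpha>) / 2 * - \<alpha> v" for v
      using coroot_form[OF assms, of v] by (simp add: B_simps mult.commute)
    show "- \<alpha> (- cr \<alpha>) = 2"
      using root_linear[OF assms] assms by (simp add: linear_neg)
  qed
  then show ?thesis
    by (simp add: fun_eq_iff reflection_def flip: \<open>- cr \<alpha> = cr (\<lambda>v. - \<alpha> v)\<close>)
qed

section \<open>Simple-root coordinates and induction over the positive roots\<close>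

definition coef :: "'n root \<Rightarrow> 'n root \<Rightarrow> real" where
  "coef \<alpha> = (SOME c. (\<forall>\<beta>\<in>\<Delta>. 0 \<le> c \<beta>) \<and> \<alpha> = (\<lambda>v. \<Sum>\<beta>\<in>\<Delta>. c \<beta> * \<beta> v))"

lemma coef:
  assumes "\<alpha> \<in> pos"
  shows "\<beta> \<in> \<Delta> \<Longrightarrow> 0 \<le> coef \<alpha> \<beta>" and "\<alpha> v = (\<Sum>\<beta>\<in>\<Delta>. coef \<alpha> \<beta> * \<beta> v)"
proof -
  have "\<exists>c. (\<forall>\<beta>\<in>\<Delta>. 0 \<le> c \<beta>) \<and> \<alpha> = (\<lambda>v. \<Sum>\<beta>\<in>\<Delta>. c \<beta> * \<beta> v)"
    using assms unfolding positive_roots_def by blast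
  from someI_ex[OF this] have "(\<forall>\<beta>\<in>\<Delta>. 0 \<le> coef \<alpha> \<beta>) \<and> \<alpha> = (\<lambda>v. \<Sum>\<beta>\<in>\<Delta>. coef \<alpha> \<beta> * \<beta> v)"
    unfolding coef_def .
  then show "\<beta> \<in> \<Delta> \<Longrightarrow> 0 \<le> coef \<alpha> \<beta>" "\<alpha> v = (\<Sum>\<beta>\<in>\<Delta>. coef \<alpha> \<beta> * \<beta> v)"
    by (blast, metis)
qed

text \<open>Independence of \<Delta> makes the choice in \<open>coef\<close> immaterial: any
  expansion of a positive root in simple roots has these coefficients.\<close>

lemma coef_unique:
  assumes "\<And>v. (\<Sum>\<beta>\<in>\<Delta>. c \<beta> * \<beta> v) = (\<Sum>\<beta>\<in>\<Delta>. d \<beta> * \<beta> v)" "\<beta> \<in> \<Delta>"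
  shows "c \<beta> = d \<beta>"
  using simple_independent[of "\<lambda>\<beta>. c \<beta> - d \<beta>" \<beta>] assms
  by (simp add: left_diff_distrib sum_subtractf)

lemma simple_sum_delta: "\<beta> \<in> \<Delta> \<Longrightarrow> (\<Sum>\<gamma>\<in>\<Delta>. (if \<gamma> = \<beta> then r else 0) * \<gamma> v) = r * \<beta> v"
  using finite_simple by (simp add: if_distrib[of "\<lambda>x. x * _"] cong: if_cong)

lemma simple_positive:
  assumes "\<beta> \<in> \<Delta>"
  shows "\<beta> \<in> pos"
proof -
  have "\<beta> = (\<lambda>v. \<Sum>\<gamma>\<in>\<Delta>. (if \<gamma> = \<beta> then 1 else 0) * \<gamma> v)"
    using simple_sum_delta[OF assms, of 1] by simp
  then show ?thesis
    using simple_root[OF assms] unfolding positive_roots_def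
    by (intro CollectI conjI exI[of _ "\<lambda>\<gamma>. if \<gamma> = \<beta> then 1 else 0"]) auto
qed

lemma root_comp_refl: 
  assumes "\<alpha> \<in> \<Phi>" 
  shows "(\<alpha> \<circ> rf \<beta>) v = \<alpha> v - \<alpha> (cr \<beta>) * \<beta> v"
  using root_linear[OF assms] by (simp add: reflection_def linear_diff linear_cmul)

lemma coef_refl:
  assumes "\<alpha> \<in> pos" "\<beta> \<in> \<Delta>"
  shows "(\<alpha> \<circ> rf \<beta>) v = (\<Sum>\<gamma>\<in>\<Delta>. (coef \<alpha> \<gamma> - (if \<gamma> = \<beta> then \<alpha> (cr \<beta>) else 0)) * \<gamma> v)"
  using coef(2)[OF assms(1), of v] simple_sum_delta[OF assms(2), of "\<alpha> (cr \<beta>)" v]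
  by (simp add: root_comp_refl[OF positive_root[OF assms(1)]] left_diff_distrib sum_subtractf del: o_apply)

text \<open>A simple reflection permutes the other positive roots: it changes only one coordinate, and
  a positive root other than \<open>\<beta>\<close> has a positive coordinate away from \<open>\<beta>\<close>.\<close>

lemma positive_refl_simple:
  assumes \<alpha>: "\<alpha> \<in> pos" and \<beta>: "\<beta> \<in> \<Delta>" and "\<alpha> \<noteq> \<beta>"
  shows "\<alpha> \<circ> rf \<beta> \<in> pos"
proof (rule ccontr)
  assume "\<alpha> \<circ> rf \<beta> \<notin> pos"
  then have neg: "(\<lambda>v. - (\<alpha> \<circ> rf \<beta>) v) \<in> pos" (is "?\<gamma> \<in> pos")
    using simple root_refl[OF positive_root[OF \<alpha>] simple_root[OF \<beta>]] by (auto simp: simple_roots_def)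
  have "coef \<alpha> \<gamma> = 0" if \<gamma>: "\<gamma> \<in> \<Delta>" "\<gamma> \<noteq> \<beta>" for \<gamma>
  proof -
    have "- coef ?\<gamma> \<gamma> = coef \<alpha> \<gamma> - (if \<gamma> = \<beta> then \<alpha> (cr \<beta>) else 0)"
    proof (rule coef_unique[OF _ \<gamma>(1)])
      show "(\<Sum>\<beta>\<in>\<Delta>. - coef ?\<gamma> \<beta> * \<beta> v) = (\<Sum>\<gamma>\<in>\<Delta>. (coef \<alpha> \<gamma> - (if \<gamma> = \<beta> then \<alpha> (cr \<beta>) else 0)) * \<gamma> v)" for v
        using coef(2)[OF neg, of v] coef_refl[OF \<alpha> \<beta>, of v] by (simp add: sum_negf del: o_apply)
    qed
    then show ?thesis
      using coef(1)[OF \<alpha> \<gamma>(1)] coef(1)[OF neg \<gamma>(1)] \<gamma>(2) by simp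
  qed
  then have "(\<Sum>\<gamma>\<in>\<Delta>. coef \<alpha> \<gamma> * \<gamma> v) = (\<Sum>\<gamma>\<in>\<Delta>. (if \<gamma> = \<beta> then coef \<alpha> \<beta> else 0) * \<gamma> v)" for v
    by (intro sum.cong) auto
  then have eq: "\<alpha> = (\<lambda>v. coef \<alpha> \<beta> * \<beta> v)"
    using coef(2)[OF \<alpha>] simple_sum_delta[OF \<beta>, of "coef \<alpha> \<beta>"] by (simp add: fun_eq_iff)
  then have "coef \<alpha> \<beta> = 1 \<or> coef \<alpha> \<beta> = - 1"
    using root_reduced[OF simple_root[OF \<beta>], of "coef \<alpha> \<beta>"] positive_root[OF \<alpha>] by metis
  then have "coef \<alpha> \<beta> = 1"
    using coef(1)[OF \<alpha> \<beta>] by auto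
  then show False
    using eq \<open>\<alpha> \<noteq> \<beta>\<close> by (auto simp: fun_eq_iff)
qed

text \<open>Expanding \<alpha> in simple roots and evaluating at its own coroot gives 2, so some
  simple \<beta> is positive on \<open>cr \<alpha>\<close>. By \<open>coroot_form\<close> and the
  symmetry of \<open>B\<close>, \<alpha> is then positive on \<open>cr \<beta>\<close>.\<close>

lemma positive_simple_descent:
  assumes \<alpha>: "\<alpha> \<in> pos"
  obtains \<beta> where "\<beta> \<in> \<Delta>" "\<alpha> (cr \<beta>) > 0"
proof -
  note \<alpha>' = positive_root[OF \<alpha>]
  have "(\<Sum>\<beta>\<in>\<Delta>. coef \<alpha> \<beta> * \<beta> (cr \<alpha>)) > 0"
    using coef(2)[OF \<alpha>, of "cr \<alpha>"] \<alpha>' by simp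
  then obtain \<beta> where \<beta>: "\<beta> \<in> \<Delta>" "coef \<alpha> \<beta> * \<beta> (cr \<alpha>) > 0"
    by (meson sum_nonpos not_le)
  then have "\<beta> (cr \<alpha>) > 0"
    using coef(1)[OF \<alpha> \<beta>(1)] by (simp add: zero_less_mult_iff)
  then have "0 < 2 * B (cr \<beta>) (cr \<alpha>)"
    using coroot_form[OF simple_root[OF \<beta>(1)], of "cr \<alpha>"] coroot_form_pos[OF simple_root[OF \<beta>(1)]] by simp
  then have "0 < \<alpha> (cr \<beta>) * B (cr \<alpha>) (cr \<alpha>)"
    using coroot_form[OF \<alpha>', of "cr \<beta>"] B_sym[of "cr \<beta>"] by simp
  then have "\<alpha> (cr \<beta>) > 0"
    using coroot_form_pos[OF \<alpha>'] by (simp add: zero_less_mult_iff)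
  then show ?thesis
    using \<beta>(1) that by blast
qed

text \<open>Induction on the height, the sum of the simple coordinates, which the reflection from
  \<open>positive_simple_descent\<close> lowers by \<open>\<alpha> (cr \<beta>)\<close>. Without
  integrality heights are just real numbers, so a counterexample of least height comes from the
  finiteness of the set of positive roots.\<close>

lemma positive_induct [consumes 1, case_names simple refl]:
  assumes "\<alpha> \<in> pos"
    and simple: "\<And>\<beta>. \<beta> \<in> \<Delta> \<Longrightarrow> P \<beta>"
    and refl: "\<And>\<alpha> \<beta>. \<alpha> \<in> pos \<Longrightarrow> \<beta> \<in> \<Delta> \<Longrightarrow> P (\<alpha> \<circ> rf \<beta>) \<Longrightarrow> P \<alpha>"
  shows "P \<alpha>"
proof (rule ccontr)
  assume "\<not> P \<alpha>"
  let ?ht = "\<lambda>\<alpha>. \<Sum>\<beta>\<in>\<Delta>. coef \<alpha> \<beta>"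
  have fin: "finite {\<alpha> \<in> pos. \<not> P \<alpha>}"
    using finite_positive by simp
  define \<gamma> where "\<gamma> = arg_min_on ?ht {\<alpha> \<in> pos. \<not> P \<alpha>}"
  have \<gamma>: "\<gamma> \<in> pos" "\<not> P \<gamma>"
    using arg_min_if_finite(1)[OF fin, of ?ht] \<open>\<alpha> \<in> pos\<close> \<open>\<not> P \<alpha>\<close> unfolding \<gamma>_def by blast+
  have min: "?ht \<gamma> \<le> ?ht \<delta>" if "\<delta> \<in> pos" "\<not> P \<delta>" for \<delta>
    using arg_min_least[OF fin, of \<delta> ?ht] that unfolding \<gamma>_def by blast
  obtain \<beta> where \<beta>: "\<beta> \<in> \<Delta>" "\<gamma> (cr \<beta>) > 0"
    using positive_simple_descent[OF \<gamma>(1)] by blast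
  have "\<gamma> \<noteq> \<beta>"
    using \<gamma>(2) simple[OF \<beta>(1)] by blast
  then have pos: "\<gamma> \<circ> rf \<beta> \<in> pos"
    by (rule positive_refl_simple[OF \<gamma>(1) \<beta>(1)])
  moreover have "\<not> P (\<gamma> \<circ> rf \<beta>)"
    using refl \<gamma> \<beta>(1) by blast
  ultimately have "?ht \<gamma> \<le> ?ht (\<gamma> \<circ> rf \<beta>)"
    by (rule min)
  also have "\<dots> = (\<Sum>\<delta>\<in>\<Delta>. coef \<gamma> \<delta> - (if \<delta> = \<beta> then \<gamma> (cr \<beta>) else 0))"
  proof (rule sum.cong[OF HOL.refl])
    show "coef (\<gamma> \<circ> rf \<beta>) \<delta> = coef \<gamma> \<delta> - (if \<delta> = \<beta> then \<gamma> (cr \<beta>) else 0)" if "\<delta> \<in> \<Delta>" for \<delta>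
      by (rule coef_unique[OF _ that]) (simp only: coef_refl[OF \<gamma>(1) \<beta>(1), symmetric] coef(2)[OF pos, symmetric])
  qed
  also have "\<dots> = ?ht \<gamma> - \<gamma> (cr \<beta>)"
    using \<beta>(1) finite_simple by (simp add: sum_subtractf)
  finally show False
    using \<beta>(2) by simp
qed

text \<open>W is defined by all reflections; this is its generation by the simple ones. A reflection
  in a negative root equals the one in the opposite positive root.\<close>

lemma weyl_simple_induct [consumes 1, case_names id step]:
  assumes "w \<in> W"
    and id: "P id"
    and step: "\<And>\<beta> w. \<beta> \<in> \<Delta> \<Longrightarrow> w \<in> W \<Longrightarrow> P w \<Longrightarrow> P (rf \<beta> \<circ> w)"
  shows "P w"
proof -
  \<comment> \<open>Quantified over all \<open>w\<close>, because the induction hypothesis for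
    \<open>\<alpha> \<circ> rf \<beta>\<close> is applied after \<open>w\<close> has been multiplied
    by \<open>rf \<beta>\<close>.\<close>
  have pos: "\<forall>w\<in>W. P w \<longrightarrow> P (rf \<alpha> \<circ> w)" if "\<alpha> \<in> pos" for \<alpha>
    using that
  proof (induction rule: positive_induct)
    case (refl \<alpha> \<beta>)
    show ?case
    proof (intro ballI impI)
      fix w assume w: "w \<in> W" "P w"
      note roots = positive_root[OF refl(1)] simple_root[OF refl(2)]
      have 1: "rf \<beta> \<circ> w \<in> W" "P (rf \<beta> \<circ> w)"
        using w step[OF refl(2)] weyl_group.step[OF roots(2)] by auto
      have 2: "rf (\<alpha> \<circ> rf \<beta>) \<circ> (rf \<beta> \<circ> w) \<in> W"
        using 1 weyl_group.step root_refl[OF roots] by blast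
      then have "P (rf \<beta> \<circ> (rf (\<alpha> \<circ> rf \<beta>) \<circ> (rf \<beta> \<circ> w)))"
        using 1 refl(3) step[OF refl(2)] by blast
      then show "P (rf \<alpha> \<circ> w)"
        by (subst refl_conjugate'[OF roots]) (simp only: comp_assoc)
    qed
  qed (use step in blast)
  show ?thesis
    using assms(1)
  proof (induction rule: weyl_group.induct)
    case (step \<alpha> w)
    then have "\<alpha> \<in> pos \<or> (\<lambda>v. - \<alpha> v) \<in> pos"
      using simple by (auto simp: simple_roots_def)
    then show ?case
      using pos step refl_neg by metis
  qed (rule id)
qed

section \<open>Finiteness of the Weyl group\<close>

lemma weyl_diff_span: 
  assumes "w \<in> W"
  shows "w v - v \<in> span (cr ` \<Phi>)"
  using assms
proof (induction rule: weyl_group.induct)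
  case (step \<alpha> w)
  have "(w v - v) - \<alpha> (w v) *\<^sub>R cr \<alpha> \<in> span (cr ` \<Phi>)"
    using step by (intro span_diff[OF step(3)] span_scale span_base) auto
  then show ?case
    by (simp add: reflection_def algebra_simps)
qed (simp add: span_zero)

text \<open>An element is recovered from the way it permutes the roots. As the roots need not span
  the dual space, equal permutations only show that \<open>w v - w' v\<close> is killed by every
  root, that is, orthogonal to every coroot. But both \<open>w v - v\<close> and
  \<open>w' v - v\<close> lie in the span of the coroots, so the difference is orthogonal to
  itself.\<close>

lemma finite_weyl: "finite W"
proof -
  let ?f = "\<lambda>w. restrict (\<lambda>\<alpha>. \<alpha> \<circ> w) \<Phi>"
  have "inj_on ?f W"
  proof (rule inj_onI)
    fix w w' assume w: "w \<in> W" "w' \<in> W" and eq: "?f w = ?f w'"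
    have "w v = w' v" for v
    proof -
      let ?x = "w v - w' v"
      have 0: "\<alpha> ?x = 0" if "\<alpha> \<in> \<Phi>" for \<alpha>
        using fun_cong[OF eq, of \<alpha>] that root_linear[OF that]
        by (simp add: linear_diff fun_eq_iff)
      have 0: "B ?x (cr \<alpha>) = 0" if "\<alpha> \<in> \<Phi>" for \<alpha>
        using coroot_form[OF that, of ?x] 0[OF that] B_sym[of ?x "cr \<alpha>"] by simp
      have "B ?x y = 0" if "y \<in> span (cr ` \<Phi>)" for y
        using that by (induction rule: span_induct_alt) (use 0 in \<open>auto simp: B_simps\<close>)
      moreover have "?x \<in> span (cr ` \<Phi>)"
        using span_diff[OF weyl_diff_span[OF w(1), of v] weyl_diff_span[OF w(2), of v]] by simp
      ultimately show ?thesis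
        using B_pos[of ?x] by fastforce
    qed
    then show "w = w'"
      by blast
  qed
  moreover have "?f ` W \<subseteq> (\<Pi>\<^sub>E \<alpha>\<in>\<Phi>. \<Phi>)"
    using weyl_root by auto
  ultimately show ?thesis
    using finite_PiE[OF finite_roots, of "\<lambda>_. \<Phi>"] finite_roots by (metis finite_imageD finite_subset)
qed

end

section \<open>Complexification\<close>

lemma re_im_vec_simps [simp]:
  "re_vec (u + v) = re_vec u + re_vec v" "im_vec (u + v) = im_vec u + im_vec v"
  "re_vec (u - v) = re_vec u - re_vec v" "im_vec (u - v) = im_vec u - im_vec v"
  "re_vec (c *s v) = Re c *\<^sub>R re_vec v - Im c *\<^sub>R im_vec v"
  "im_vec (c *s v) = Re c *\<^sub>R im_vec v + Im c *\<^sub>R re_vec v"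
  "re_vec (of_real_vec x) = x" "im_vec (of_real_vec x) = 0"
  by (simp_all add: re_vec_def im_vec_def of_real_vec_def vec_eq_iff)

lemma cx_linearI:
  assumes "\<And>u v. f (u + v) = f u + f v" "\<And>c v. f (c *s v) = c * f v"
  shows "cx_linear f"
  using assms cx_linear_zero unfolding cx_linear_def Vector_Spaces.linear_iff by blast

lemma cx_linear_add: "cx_linear f \<Longrightarrow> f (u + v) = f u + f v"
  unfolding cx_linear_def Vector_Spaces.linear_iff by blast

lemma cx_linear_scale: "cx_linear f \<Longrightarrow> f (c *s v) = c * f v"
  unfolding cx_linear_def Vector_Spaces.linear_iff by blast

lemma cx_linear_diff: "cx_linear f \<Longrightarrow> f (u - v) = f u - f v"
  using cx_linear_add[of f "u - v" v] by simp

lemma cx_linear_sum: "cx_linear f \<Longrightarrow> f (\<Sum>i\<in>A. g i) = (\<Sum>i\<in>A. f (g i))"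
  by (rule additive_sum) (rule cx_linear_add)

lemma cx_linear_cx_fun: 
  assumes "linear \<alpha>"
  shows "cx_linear (cx_fun \<alpha>)"
  by (rule cx_linearI) (simp_all add: cx_fun_def complex_eq_iff linear_add[OF assms] linear_diff[OF assms]
      linear_cmul[OF assms])

lemma cx_fun_of_real [simp]: "linear \<alpha> \<Longrightarrow> cx_fun \<alpha> (of_real_vec x) = of_real (\<alpha> x)"
  by (simp add: cx_fun_def complex_eq_iff linear_0)

locale real_form =
  fixes B :: "real^'n \<Rightarrow> real^'n \<Rightarrow> real" and b :: "'n::finite \<Rightarrow> real^'n"
  assumes bilin: "bilinear B" and symm: "B x y = B y x" and orthonormal: "orthonormal_basis B b"
begin

abbreviation BC :: "complex^'n \<Rightarrow> complex^'n \<Rightarrow> complex" where "BC \<equiv> cx_form B"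
abbreviation E :: "'n \<Rightarrow> complex^'n" where "E j \<equiv> of_real_vec (b j)"

lemmas form_simps = bilinear_ladd[OF bilin] bilinear_radd[OF bilin]
  bilinear_lsub[OF bilin] bilinear_rsub[OF bilin]
  bilinear_lmul[OF bilin] bilinear_rmul[OF bilin]
  bilinear_lzero[OF bilin] bilinear_rzero[OF bilin]

lemma BC_sym: "BC u v = BC v u"
  by (simp add: cx_form_def symm[of "re_vec u"] symm[of "im_vec u"])

lemma cx_linear_BC: "cx_linear (BC u)"
  by (rule cx_linearI) (simp_all add: cx_form_def complex_eq_iff form_simps algebra_simps)

lemmas BC_right = cx_linear_add[OF cx_linear_BC] cx_linear_scale[OF cx_linear_BC]
  cx_linear_diff[OF cx_linear_BC] cx_linear_sum[OF cx_linear_BC]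

lemma BC_left: "BC (u + v) w = BC u w + BC v w" "BC (c *s u) w = c * BC u w"
   "BC (\<Sum>i\<in>A. g i) w = (\<Sum>i\<in>A. BC (g i) w)"
  by (simp_all add: BC_sym[of _ w] BC_right)

lemma BC_real [simp]: "BC (of_real_vec x) (of_real_vec y) = of_real (B x y)"
  by (simp add: cx_form_def complex_eq_iff form_simps)

lemma b_orthonormal: "B (b i) (b j) = (if i = j then 1 else 0)"
  using orthonormal by (simp add: orthonormal_basis_def)

lemma BC_E: "BC (E i) (E j) = (if i = j then 1 else 0)"
  by (simp add: b_orthonormal)

lemma orthonormal_expansion: "x = (\<Sum>j\<in>UNIV. B x (b j) *\<^sub>R b j)"
proof -
  have "x \<in> span (range b)"
    using orthonormal by (simp add: orthonormal_basis_def)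
  then show ?thesis
  proof (induction rule: span_induct_alt)
    case base
    show ?case
      by (simp add: form_simps)
  next
    case (step c x y)
    then obtain i where i: "x = b i"
      by auto
    have "(\<Sum>j\<in>UNIV. B (c *\<^sub>R b i + y) (b j) *\<^sub>R b j)
        = (\<Sum>j\<in>UNIV. (if i = j then c *\<^sub>R b j else 0)) + (\<Sum>j\<in>UNIV. B y (b j) *\<^sub>R b j)"
      unfolding sum.distrib[symmetric]
      by (intro sum.cong refl) (simp add: form_simps b_orthonormal algebra_simps)
    then show ?case
      using step by (simp add: i)
  qed
qed

lemma cx_expansion: "v = (\<Sum>j\<in>UNIV. BC v (E j) *s E j)"
proof -
  have 1: "BC v (E j) = Complex (B (re_vec v) (b j)) (B (im_vec v) (b j))" for j
    by (simp add: cx_form_def form_simps)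
  have E: "E j $ i = of_real (b j $ i)" for i j
    by (simp add: of_real_vec_def)
  have "v $ i = (\<Sum>j\<in>UNIV. BC v (E j) *s E j) $ i" for i
  proof (rule complex_eqI)
    have "Re (v $ i) = re_vec v $ i" "Im (v $ i) = im_vec v $ i"
      by (simp_all add: re_vec_def im_vec_def)
    moreover have "re_vec v $ i = (\<Sum>j\<in>UNIV. B (re_vec v) (b j) *\<^sub>R b j) $ i"
      "im_vec v $ i = (\<Sum>j\<in>UNIV. B (im_vec v) (b j) *\<^sub>R b j) $ i"
      using orthonormal_expansion by (metis, metis)
    ultimately show "Re (v $ i) = Re ((\<Sum>j\<in>UNIV. BC v (E j) *s E j) $ i)"
      "Im (v $ i) = Im ((\<Sum>j\<in>UNIV. BC v (E j) *s E j) $ i)"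
      by (simp_all only: sum_component vector_smult_component vector_scaleR_component 1 E)
        (simp_all)
  qed
  then show ?thesis
    by (simp add: vec_eq_iff del: sum_component)
qed

lemma BC_nondegenerate: "(\<And>j. BC u (E j) = BC v (E j)) \<Longrightarrow> u = v"
  by (subst cx_expansion[of u], subst cx_expansion[of v]) simp

lemma cx_linear_eq_BC:
  assumes "cx_linear f"
  shows "f v = BC (\<Sum>j\<in>UNIV. f (E j) *s E j) v"
proof -
  have "f v = f (\<Sum>j\<in>UNIV. BC v (E j) *s E j)"
    using cx_expansion[of v] by simp
  also have "\<dots> = BC (\<Sum>j\<in>UNIV. f (E j) *s E j) v"
    by (simp only: cx_linear_sum[OF assms] cx_linear_scale[OF assms] BC_left BC_sym[of v] mult.commute)
  finally show ?thesis .
qed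

section \<open>Bases of V, their duals and the canonical tensor\<close>

lemma cx_basis_functional:
  fixes v :: "'n \<Rightarrow> complex^'n"
  assumes v: "cx_basis v"
  obtains f where "cx_linear f" "\<And>j. f (v j) = (if i = j then 1 else 0)"
proof -
  let ?g = "\<lambda>x. if x = v i then 1 else 0 :: complex"
  interpret p: vector_space_pair "(*s) :: complex \<Rightarrow> complex^'n \<Rightarrow> _" "(*) :: complex \<Rightarrow> complex \<Rightarrow> _"
    using vec.vector_space_axioms vector_space_over_itself.vector_space_axioms
    by (simp add: vector_space_pair_def)
  have "vec.independent (range v)"
    using v by (simp add: cx_basis_def)
  then have "\<exists>f. Vector_Spaces.linear (*s) (*) f \<and> (\<forall>x\<in>range v. f x = ?g x)"
    by (rule p.linear_independent_extend)
  then obtain f where f: "Vector_Spaces.linear (*s) (*) f" "\<forall>x\<in>range v. f x = ?g x"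
    by blast
  have "f (v j) = (if i = j then 1 else 0)" for j
    using f(2) v by (auto simp: cx_basis_def inj_eq)
  then show ?thesis
    using that f(1) by (simp add: cx_linear_def)
qed

lemma cx_basis_ext:
  fixes v :: "'n \<Rightarrow> complex^'n"
  assumes v: "cx_basis v" and f: "cx_linear f" "cx_linear g" "\<And>j. f (v j) = g (v j)"
  shows "f = g"
proof
  fix x
  have "x \<in> vec.span (range v)"
    using v by (simp add: cx_basis_def)
  then show "f x = g x"
  proof (induction rule: vec.span_induct_alt)
    case base
    show ?case
      using cx_linear_diff[OF f(1), of 0 0] cx_linear_diff[OF f(2), of 0 0] by simp
  next
    case (step c x y)
    then show ?case
      using f by (auto simp: cx_linear_add cx_linear_scale)
  qed
qed

lemma B_dual_vector:
  assumes v: "cx_basis v"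
  shows "BC (B_dual_vector B v i) (v j) = (if i = j then 1 else 0)"
proof -
  obtain f where f: "cx_linear f" "\<And>j. f (v j) = (if i = j then 1 else 0)"
    using cx_basis_functional[OF v] by metis
  have "\<exists>!u. \<forall>j. BC u (v j) = (if i = j then 1 else 0)"
  proof (rule ex1I)
    show "\<forall>j. BC (\<Sum>j\<in>UNIV. f (E j) *s E j) (v j) = (if i = j then 1 else 0)"
      by (simp only: cx_linear_eq_BC[OF f(1), symmetric] f(2)) simp
    fix u assume "\<forall>j. BC u (v j) = (if i = j then 1 else 0)"
    then have "BC u = f"
      by (intro cx_basis_ext[OF v cx_linear_BC f(1)]) (simp add: f(2))
    then show "u = (\<Sum>j\<in>UNIV. f (E j) *s E j)"
      by (intro BC_nondegenerate) (simp only: cx_linear_eq_BC[OF f(1), symmetric])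
  qed
  from theI'[OF this] show ?thesis
    unfolding B_dual_vector_def by blast
qed

lemma dual_functional_eq:
  assumes v: "cx_basis v"
  shows "dual_functional v i = BC (B_dual_vector B v i)"
  unfolding dual_functional_def
  by (rule the_equality)
    (auto intro: cx_basis_ext[OF v] simp: cx_linear_BC B_dual_vector[OF v])

lemma cx_basis_E: "cx_basis E"
proof -
  have "inj E"
  proof (rule injI)
    fix i j assume eq: "E i = E j"
    have "BC (E i) (E i) = BC (E i) (E j)"
      using eq by (simp only:)
    then show "i = j"
      unfolding BC_E by (auto split: if_splits)
  qed
  moreover have "vec.span (range E) = UNIV"
  proof -
    have "v \<in> vec.span (range E)" for v
      by (subst cx_expansion[of v]) (intro vec.span_sum vec.span_scale vec.span_base rangeI)
    then show ?thesis
      by blast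
  qed
  moreover have "vec.independent (range E)"
  proof (rule vec.card_le_dim_spanning[of _ UNIV])
    show "card (range E) \<le> vec.dim (UNIV :: (complex^'n) set)"
      using card_image[OF \<open>inj E\<close>] by (simp add: vec.dim_UNIV card_cart_basis vec.dimension_def)
  qed (use \<open>vec.span (range E) = UNIV\<close> in auto)
  ultimately show ?thesis
    by (simp add: cx_basis_def)
qed

text \<open>An orthonormal basis is its own \<open>B\<close>-dual, so the map from basis vectors to
  dual functionals is the identification of V with its dual by \<open>B\<close>.\<close>

lemma to_dual_E: "to_dual E u = BC u" 
proof -
  have "B_dual_vector B E i = E i" for i
  proof (rule BC_nondegenerate)
    show "BC (B_dual_vector B E i) (E j) = BC (E i) (E j)" for j
      using B_dual_vector[OF cx_basis_E, of i j] BC_E[of i j] by simp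
  qed
  then have "to_dual E u v = BC (\<Sum>i\<in>UNIV. BC u (E i) *s E i) v" for v
    unfolding to_dual_def dual_functional_eq[OF cx_basis_E] by (simp only: BC_left BC_sym[of u])
  then show ?thesis
    using cx_expansion[of u] by fastforce
qed

lemma cx_linear_dual_E: "cx_linear (dual_functional E i)"
  by (simp add: dual_functional_eq[OF cx_basis_E] cx_linear_BC)

lemma B_dual_expansion:
  assumes v: "cx_basis v"
  shows "(\<Sum>i\<in>UNIV. BC (v i) w *s B_dual_vector B v i) = w"
proof (rule BC_nondegenerate)
  let ?v = "B_dual_vector B v"
  fix j
  have "BC (\<Sum>i\<in>UNIV. BC (v i) w *s ?v i) = BC w"
  proof (rule cx_basis_ext[OF v])
    fix k
    have "(\<Sum>i\<in>UNIV. BC (v i) w * BC (?v i) (v k)) = (\<Sum>i\<in>UNIV. if i = k then BC (v i) w else 0)"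
      by (intro sum.cong refl) (simp add: B_dual_vector[OF v])
    then show "BC (\<Sum>i\<in>UNIV. BC (v i) w *s ?v i) (v k) = BC w (v k)"
      by (simp add: BC_left BC_sym[of w])
  qed (rule cx_linear_BC)+
  then show "BC (\<Sum>i\<in>UNIV. BC (v i) w *s ?v i) (E j) = BC w (E j)"
    by simp
qed

text \<open>The target is a mere abelian group, since polynomials with coefficients in M carry no
  scalar multiplication here. Additivity and the passage of scalars between the two arguments are
  all that a map out of the tensor product has to satisfy.\<close>

lemma canonical_tensor:
  fixes F :: "complex^'n \<Rightarrow> complex^'n \<Rightarrow> 'a::ab_group_add"
  assumes v: "cx_basis v"
    and F: "\<And>u u' w. F (u + u') w = F u w + F u' w" "\<And>u w w'. F u (w + w') = F u w + F u w'"
      "\<And>c u w. F (c *s u) w = F u (c *s w)"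
  shows "(\<Sum>i\<in>UNIV. F (v i) (B_dual_vector B v i)) = (\<Sum>j\<in>UNIV. F (E j) (E j))"
proof -
  let ?v = "B_dual_vector B v"
  have "(\<Sum>i\<in>UNIV. F (v i) (?v i)) = (\<Sum>i\<in>UNIV. F (\<Sum>j\<in>UNIV. BC (v i) (E j) *s E j) (?v i))"
    using cx_expansion by simp
  also have "\<dots> = (\<Sum>i\<in>UNIV. \<Sum>j\<in>UNIV. F (E j) (BC (v i) (E j) *s ?v i))"
    by (simp only: additive_sum[of "\<lambda>u. F u _", OF F(1)] F(3))
  also have "\<dots> = (\<Sum>j\<in>UNIV. F (E j) (\<Sum>i\<in>UNIV. BC (v i) (E j) *s ?v i))"
    by (subst sum.swap) (simp only: additive_sum[of "F _", OF F(2)])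
  also have "\<dots> = (\<Sum>j\<in>UNIV. F (E j) (E j))"
    by (simp only: B_dual_expansion[OF v])
  finally show ?thesis .
qed

end

section \<open>Identities in the graded Hecke algebra\<close>

lemma re_im_vec_eqI: "re_vec u = re_vec v \<Longrightarrow> im_vec u = im_vec v \<Longrightarrow> u = v"
  by (simp add: re_vec_def im_vec_def vec_eq_iff complex_eq_iff)

lemma re_im_cx_reflection:
  "re_vec (cx_reflection cr \<alpha> v) = reflection cr \<alpha> (re_vec v)"
  "im_vec (cx_reflection cr \<alpha> v) = reflection cr \<alpha> (im_vec v)"
  by (simp_all add: cx_reflection_def reflection_def cx_fun_def)

locale hecke = root_data \<Phi> \<Delta> cr B + real_form B b
  for \<Phi> \<Delta> :: "'n::finite root set" and cr B and b :: "'n \<Rightarrow> real^'n" +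
  fixes k :: "'n root \<Rightarrow> complex"
  assumes param: "invariant_parameter \<Phi> cr k"
begin

abbreviation "gens \<equiv> hecke_gens \<Phi> cr"
abbreviation "crf \<equiv> cx_reflection cr"
abbreviation S :: "(real^'n \<Rightarrow> real^'n) \<Rightarrow> 'n hgen free" where "S w \<equiv> gen (GW w)"
abbreviation X :: "complex^'n \<Rightarrow> 'n hgen free" where "X v \<equiv> gen (GV v)"
abbreviation T :: "complex^'n \<Rightarrow> 'n hgen free" where "T \<equiv> tilde \<Phi> cr \<Delta> k"

definition t :: "complex^'n \<Rightarrow> 'n hgen free" where
  "t v = const (1/2) * (\<Sum>\<alpha>\<in>pos. const (k \<alpha> * cx_fun \<alpha> v) * S (rf \<alpha>))"

lemma T_eq: "T v = X v - t v"
  by (simp add: tilde_def t_def)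

lemma X_gens [simp]: "GV v \<in> gens"
  by (simp add: hecke_gens_def)

lemma S_gens [simp]: "w \<in> W \<Longrightarrow> GW w \<in> gens"
  by (simp add: hecke_gens_def)

lemma refl_pos_weyl [simp]: "\<alpha> \<in> pos \<Longrightarrow> rf \<alpha> \<in> W"
  by (simp add: refl_weyl positive_root)

lemma id_weyl [simp]: "id \<in> W"
  by (rule weyl_group.one)

lemma refl_simple_weyl [simp]: "\<beta> \<in> \<Delta> \<Longrightarrow> rf \<beta> \<in> W"
  by (simp add: refl_weyl simple_root)

lemma t_carrier [simp]: "t v \<in> free_carrier gens"
  by (simp add: t_def)

lemma T_carrier [simp]: "T v \<in> free_carrier gens"
  by (simp add: T_eq)

lemma hecke_presentation: "presentation gens (hecke_rels \<Phi> cr \<Delta> k)"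
  unfolding presentation_def hecke_rels_def
  by (auto intro!: free_carrier_diff free_carrier_add free_carrier_mult simp: weyl_comp)

sublocale H: presentation gens "hecke_rels \<Phi> cr \<Delta> k"
  by (rule hecke_presentation)

notation H.cong (infix "\<asymp>" 50)

lemma S_mult:
  assumes "w \<in> W" "w' \<in> W"
  shows "S w * S w' \<asymp> S (w \<circ> w')"
proof (rule H.cong_rel)
  show "S w * S w' - S (w \<circ> w') \<in> hecke_rels \<Phi> cr \<Delta> k"
    using assms unfolding hecke_rels_def by blast
qed (use assms in \<open>auto simp: weyl_comp\<close>)

lemma S_id: "S id \<asymp> 1"
proof (rule H.cong_rel)
  show "S id - 1 \<in> hecke_rels \<Phi> cr \<Delta> k"
    unfolding hecke_rels_def by blast
qed auto

lemma X_lin: "X (c *s u + d *s v) \<asymp> const c * X u + const d * X v"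
proof (rule H.cong_rel)
  show "X (c *s u + d *s v) - (const c * X u + const d * X v) \<in> hecke_rels \<Phi> cr \<Delta> k"
    unfolding hecke_rels_def by blast
qed auto

lemma X_commute: "X u * X v \<asymp> X v * X u"
proof (rule H.cong_rel)
  show "X u * X v - X v * X u \<in> hecke_rels \<Phi> cr \<Delta> k"
    unfolding hecke_rels_def by blast
qed auto

lemma X_cross: 
  assumes "\<beta> \<in> \<Delta>"
  shows "X v * S (rf \<beta>) \<asymp> S (rf \<beta>) * X (crf \<beta> v) + const (k \<beta> * cx_fun \<beta> v)"
proof (rule H.cong_rel)
  show "X v * S (rf \<beta>) - (S (rf \<beta>) * X (crf \<beta> v) + const (k \<beta> * cx_fun \<beta> v)) \<in> hecke_rels \<Phi> cr \<Delta> k"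
    using assms unfolding hecke_rels_def diff_diff_eq[symmetric] by blast
qed (use assms in auto)

lemma cx_linear_root: "\<alpha> \<in> \<Phi> \<Longrightarrow> cx_linear (cx_fun \<alpha>)"
  by (rule cx_linear_cx_fun) (rule root_linear)

lemma t_lin: "t (c *s u + d *s v) = const c * t u + const d * t v"
proof -
  have "const (k \<alpha> * cx_fun \<alpha> (c *s u + d *s v)) * S (rf \<alpha>)
      = const c * (const (k \<alpha> * cx_fun \<alpha> u) * S (rf \<alpha>)) + const d * (const (k \<alpha> * cx_fun \<alpha> v) * S (rf \<alpha>))"
    if "\<alpha> \<in> pos" for \<alpha>
  proof -
    have "k \<alpha> * cx_fun \<alpha> (c *s u + d *s v) = c * (k \<alpha> * cx_fun \<alpha> u) + d * (k \<alpha> * cx_fun \<alpha> v)"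
      using cx_linear_root[OF positive_root[OF that]] by (simp add: cx_linear_add cx_linear_scale algebra_simps)
    then show ?thesis
      by (simp only: const_add const_mult distrib_right mult.assoc)
  qed
  then have "(\<Sum>\<alpha>\<in>pos. const (k \<alpha> * cx_fun \<alpha> (c *s u + d *s v)) * S (rf \<alpha>))
      = (\<Sum>\<alpha>\<in>pos. const c * (const (k \<alpha> * cx_fun \<alpha> u) * S (rf \<alpha>)) + const d * (const (k \<alpha> * cx_fun \<alpha> v) * S (rf \<alpha>)))"
    by (rule sum.cong[OF refl])
  then have "t (c *s u + d *s v) = const (1/2) * (const c * (\<Sum>\<alpha>\<in>pos. const (k \<alpha> * cx_fun \<alpha> u) * S (rf \<alpha>))
      + const d * (\<Sum>\<alpha>\<in>pos. const (k \<alpha> * cx_fun \<alpha> v) * S (rf \<alpha>)))"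
    by (simp only: t_def sum.distrib sum_distrib_left)
  also have "\<dots> = const c * t u + const d * t v"
    unfolding t_def distrib_left by (simp only: const_left_commute[of "const (1/2)"])
  finally show ?thesis .
qed

lemma T_lin: "T (c *s u + d *s v) \<asymp> const c * T u + const d * T v"
proof -
  have "T (c *s u + d *s v) \<asymp> (const c * X u + const d * X v) - t (c *s u + d *s v)"
    unfolding T_eq by (intro H.cong_diff X_lin H.cong_refl) simp
  also have "\<dots> = const c * T u + const d * T v"
    by (simp add: t_lin T_eq algebra_simps)
  finally show ?thesis .
qed

text \<open>Linearity modulo the relations. Both \<open>X\<close> and \<open>T\<close> have it, so
  each argument about the canonical tensor is made once for the two of them.\<close>

definition lin :: "(complex^'n \<Rightarrow> 'n hgen free) \<Rightarrow> bool" where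
  "lin Y \<longleftrightarrow> (\<forall>c u d v. Y (c *s u + d *s v) \<asymp> const c * Y u + const d * Y v) \<and> (\<forall>v. Y v \<in> free_carrier gens)"

lemma lin_X: "lin X" and lin_T: "lin T"
  by (simp_all add: lin_def X_lin T_lin)

lemma lin_carrier: "lin Y \<Longrightarrow> Y v \<in> free_carrier gens"
  by (simp add: lin_def)

lemma lin_zero: "lin Y \<Longrightarrow> Y 0 \<asymp> 0"
  unfolding lin_def by (metis const_0 mult_zero_left add_0 vector_smult_lzero)

lemma lin_add: "lin Y \<Longrightarrow> Y (u + v) \<asymp> Y u + Y v"
  unfolding lin_def by (metis const_1 mult_1 vec.scale_one)

lemma lin_scale: "lin Y \<Longrightarrow> Y (c *s v) \<asymp> const c * Y v"
  unfolding lin_def by (metis const_0 mult_zero_left add_0_right vector_smult_lzero)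

lemma lin_sum:
  assumes Y: "lin Y"
  shows "Y (\<Sum>j\<in>A. c j *s v j) \<asymp> (\<Sum>j\<in>A. const (c j) * Y (v j))"
proof (induction A rule: infinite_finite_induct)
  case (insert j A)
  have "Y (c j *s v j + (\<Sum>j\<in>A. c j *s v j)) \<asymp> Y (c j *s v j) + Y (\<Sum>j\<in>A. c j *s v j)"
    by (rule lin_add[OF Y])
  also have "\<dots> \<asymp> const (c j) * Y (v j) + (\<Sum>j\<in>A. const (c j) * Y (v j))"
    by (intro H.cong_add lin_scale[OF Y] insert)
  finally show ?case
    using insert by simp
qed (simp_all add: lin_zero[OF Y])

text \<open>The hypothesis says that \<open>\<Sum> x\<^sub>i \<otimes> y\<^sub>i\<close> is the canonical tensor of \<open>B\<close>.\<close>

lemma lin_canonical: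
  assumes Y: "lin Y"
    and xy: "\<And>j l. (\<Sum>i\<in>UNIV. BC (x i) (E j) * BC (y i) (E l)) = (if j = l then 1 else 0)"
  shows "(\<Sum>i\<in>(UNIV::'n set). Y (x i) * Y (y i)) \<asymp> (\<Sum>j\<in>UNIV. Y (E j) * Y (E j))"
proof -
  note carr [simp] = lin_carrier[OF Y]
  have exp: "Y u \<asymp> (\<Sum>j\<in>UNIV. const (BC u (E j)) * Y (E j))" for u
    using lin_sum[OF Y, of "\<lambda>j. BC u (E j)" E UNIV] cx_expansion[of u] by simp
  have "(\<Sum>i\<in>UNIV. Y (x i) * Y (y i)) \<asymp> (\<Sum>i\<in>UNIV. (\<Sum>j\<in>UNIV. const (BC (x i) (E j)) * Y (E j)) *
      (\<Sum>l\<in>UNIV. const (BC (y i) (E l)) * Y (E l)))"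
    by (intro H.cong_sum H.cong_mult exp)
  also have "\<dots> = (\<Sum>i\<in>UNIV. \<Sum>j\<in>UNIV. \<Sum>l\<in>UNIV. const (BC (x i) (E j) * BC (y i) (E l)) * (Y (E j) * Y (E l)))"
    by (simp only: sum_product const_mult mult.assoc const_left_commute[of "Y _"])
  also have "\<dots> = (\<Sum>j\<in>UNIV. \<Sum>l\<in>UNIV. \<Sum>i\<in>UNIV. const (BC (x i) (E j) * BC (y i) (E l)) * (Y (E j) * Y (E l)))"
    by (subst sum.swap) (intro sum.cong refl sum.swap)
  also have "\<dots> = (\<Sum>j\<in>UNIV. \<Sum>l\<in>UNIV. const (if j = l then 1 else 0) * (Y (E j) * Y (E l)))"
    by (simp only: sum_distrib_right[symmetric] const_sum[symmetric] xy)
  also have "\<dots> = (\<Sum>j\<in>UNIV. \<Sum>l\<in>UNIV. if j = l then Y (E j) * Y (E l) else 0)"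
    by (intro sum.cong refl) simp
  also have "\<dots> = (\<Sum>j\<in>UNIV. Y (E j) * Y (E j))"
    by simp
  finally show ?thesis .
qed

lemma BC_crf:
  assumes "\<alpha> \<in> \<Phi>"
  shows "BC (crf \<alpha> u) (crf \<alpha> v) = BC u v"
  using B_weyl[OF refl_weyl[OF assms]] by (simp add: cx_form_def re_im_cx_reflection)

lemma crf_crf: 
  assumes "\<alpha> \<in> \<Phi>"
  shows "crf \<alpha> (crf \<alpha> v) = v"
  by (rule re_im_vec_eqI) (simp_all add: re_im_cx_reflection refl_refl assms)

text \<open>A reflection is orthogonal for \<open>BC\<close>, so it carries the orthonormal basis to
  another one with the same canonical tensor.\<close>

lemma lin_canonical_refl:
  assumes "lin Y" "\<alpha> \<in> \<Phi>"
  shows "(\<Sum>i\<in>UNIV. Y (crf \<alpha> (E i)) * Y (crf \<alpha> (E i))) \<asymp> (\<Sum>j\<in>UNIV. Y (E j) * Y (E j))"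
proof (rule lin_canonical[OF assms(1)])
  fix j l
  \<comment> \<open>An orthogonal involution is self-adjoint.\<close>
  have swap: "BC (crf \<alpha> (E i)) (E m) = BC (crf \<alpha> (E m)) (E i)" for i m
    using BC_crf[OF assms(2), of "E i" "crf \<alpha> (E m)"] by (simp add: crf_crf assms BC_sym)
  have "(\<Sum>i\<in>UNIV. BC (crf \<alpha> (E i)) (E j) * BC (crf \<alpha> (E i)) (E l))
      = BC (\<Sum>i\<in>UNIV. BC (crf \<alpha> (E j)) (E i) *s E i) (crf \<alpha> (E l))"
    unfolding BC_left by (intro sum.cong refl) (metis swap BC_sym)
  also have "\<dots> = BC (E j) (E l)"
    by (simp only: cx_expansion[symmetric] BC_crf[OF assms(2)])
  finally show "(\<Sum>i\<in>UNIV. BC (crf \<alpha> (E i)) (E j) * BC (crf \<alpha> (E i)) (E l)) = (if j = l then 1 else 0)"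
    by (simp only: BC_E)
qed

lemma lin_canonical_basis:
  assumes "lin Y" "cx_basis v"
  shows "(\<Sum>i\<in>UNIV. Y (v i) * Y (B_dual_vector B v i)) \<asymp> (\<Sum>j\<in>UNIV. Y (E j) * Y (E j))"
proof (rule lin_canonical[OF assms(1)])
  fix j l
  have "(\<Sum>i\<in>UNIV. BC (v i) (E j) * BC (B_dual_vector B v i) (E l))
      = BC (\<Sum>i\<in>UNIV. BC (v i) (E j) *s B_dual_vector B v i) (E l)"
    by (simp only: BC_left)
  then show "(\<Sum>i\<in>UNIV. BC (v i) (E j) * BC (B_dual_vector B v i) (E l)) = (if j = l then 1 else 0)"
    by (simp only: B_dual_expansion[OF assms(2)] BC_E)
qed

end

context hecke
begin

section \<open>Twisted commutation of the tilde elements with reflections\<close>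

lemma param_refl: "\<alpha> \<in> \<Phi> \<Longrightarrow> \<beta> \<in> \<Phi> \<Longrightarrow> k (\<alpha> \<circ> rf \<beta>) = k \<alpha>"
  using param refl_weyl unfolding invariant_parameter_def by blast

lemma cx_fun_comp_refl: "cx_fun (\<alpha> \<circ> rf \<beta>) v = cx_fun \<alpha> (crf \<beta> v)"
  by (simp add: cx_fun_def re_im_cx_reflection)

text \<open>\<open>positive_refl_simple\<close> gives positivity of the image, and
  \<open>rf \<beta>\<close> is an involution. What remains is that no positive root is sent to
  \<beta>: such a root would be the negative of \<beta>, with coordinate -1 at \<beta>.\<close>

lemma bij_positive_refl:
  assumes "\<beta> \<in> \<Delta>"
  shows "bij_betw (\<lambda>\<alpha>. \<alpha> \<circ> rf \<beta>) (pos - {\<beta>}) (pos - {\<beta>})"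
proof (rule bij_betw_byWitness[where f' = "\<lambda>\<alpha>. \<alpha> \<circ> rf \<beta>"])
  have ne: "\<alpha> \<circ> rf \<beta> \<noteq> \<beta>" if "\<alpha> \<in> pos" for \<alpha>
  proof
    assume eq: "\<alpha> \<circ> rf \<beta> = \<beta>"
    have neg: "\<alpha> v = - \<beta> v" for v
    proof -
      have "\<alpha> v = \<beta> (rf \<beta> v)"
        using fun_cong[OF eq, of "rf \<beta> v"] by (simp add: refl_refl simple_root assms)
      then show ?thesis
        using root_linear[OF simple_root[OF assms]] simple_root[OF assms]
        by (simp add: reflection_def linear_diff linear_cmul)
    qed
    have "- coef \<alpha> \<beta> = coef \<beta> \<beta>"
    proof (rule coef_unique[where c = "\<lambda>\<gamma>. - coef \<alpha> \<gamma>" and d = "coef \<beta>", OF _ assms])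
      show "(\<Sum>\<gamma>\<in>\<Delta>. - coef \<alpha> \<gamma> * \<gamma> v) = (\<Sum>\<gamma>\<in>\<Delta>. coef \<beta> \<gamma> * \<gamma> v)" for v
        using coef(2)[OF that, of v] coef(2)[OF simple_positive[OF assms], of v] neg[of v]
        by (simp add: sum_negf)
    qed
    moreover have "coef \<beta> \<beta> = 1"
    proof -
      have "coef \<beta> \<beta> = (if \<beta> = \<beta> then 1 else 0)"
      proof (rule coef_unique[where c = "coef \<beta>" and d = "\<lambda>\<gamma>. if \<gamma> = \<beta> then 1 else 0", OF _ assms])
        show "(\<Sum>\<gamma>\<in>\<Delta>. coef \<beta> \<gamma> * \<gamma> v) = (\<Sum>\<gamma>\<in>\<Delta>. (if \<gamma> = \<beta> then 1 else 0) * \<gamma> v)" for v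
          using coef(2)[OF simple_positive[OF assms], of v] simple_sum_delta[OF assms, of 1 v] by simp
      qed
      then show ?thesis
        by simp
    qed
    ultimately show False
      using coef(1)[OF that assms] by simp
  qed
  show sub: "(\<lambda>\<alpha>. \<alpha> \<circ> rf \<beta>) ` (pos - {\<beta>}) \<subseteq> pos - {\<beta>}"
  proof (rule image_subsetI)
    fix \<alpha> assume "\<alpha> \<in> pos - {\<beta>}"
    then show "\<alpha> \<circ> rf \<beta> \<in> pos - {\<beta>}"
      using positive_refl_simple[OF _ assms, of \<alpha>] ne[of \<alpha>] by simp
  qed
  show "(\<lambda>\<alpha>. \<alpha> \<circ> rf \<beta>) ` (pos - {\<beta>}) \<subseteq> pos - {\<beta>}"
    by (rule sub)
qed (simp_all add: comp_assoc refl_comp_refl simple_root assms)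

lemma S_mult_const_sum:
  assumes "w \<in> W" "\<And>\<alpha>. \<alpha> \<in> A \<Longrightarrow> g \<alpha> \<in> W"
  shows "(\<Sum>\<alpha>\<in>A. const (c \<alpha>) * S (g \<alpha>)) * S w \<asymp> (\<Sum>\<alpha>\<in>A. const (c \<alpha>) * S (g \<alpha> \<circ> w))"
    and "S w * (\<Sum>\<alpha>\<in>A. const (c \<alpha>) * S (g \<alpha>)) \<asymp> (\<Sum>\<alpha>\<in>A. const (c \<alpha>) * S (w \<circ> g \<alpha>))"
proof -
  show "(\<Sum>\<alpha>\<in>A. const (c \<alpha>) * S (g \<alpha>)) * S w \<asymp> (\<Sum>\<alpha>\<in>A. const (c \<alpha>) * S (g \<alpha> \<circ> w))"
    unfolding sum_distrib_right mult.assoc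
    by (intro H.cong_sum H.cong_const_mult S_mult assms)
  show "S w * (\<Sum>\<alpha>\<in>A. const (c \<alpha>) * S (g \<alpha>)) \<asymp> (\<Sum>\<alpha>\<in>A. const (c \<alpha>) * S (w \<circ> g \<alpha>))"
    unfolding sum_distrib_left const_left_commute[of "S w"]
    by (intro H.cong_sum H.cong_const_mult S_mult assms)
qed

text \<open>Multiplying \<open>t v\<close> by the reflection on the right and
  \<open>t (crf \<beta> v)\<close> by it on the left gives the same terms \<open>A\<close> for the
  roots other than \<beta>, as these are permuted and \<open>k\<close> is invariant. The
  \<beta>-terms have opposite signs, and their difference is the scalar in the cross
  relation.\<close>

lemma T_simple:
  assumes \<beta>: "\<beta> \<in> \<Delta>"
  shows "T v * S (rf \<beta>) \<asymp> S (rf \<beta>) * T (crf \<beta> v)"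
proof -
  note \<beta>' = simple_root[OF \<beta>]
  note bp = simple_positive[OF \<beta>]
  let ?c = "k \<beta> * cx_fun \<beta> v" and ?v = "crf \<beta> v"
  define A where "A = (\<Sum>\<alpha>\<in>pos - {\<beta>}. const (k \<alpha> * cx_fun \<alpha> v) * S (rf \<alpha> \<circ> rf \<beta>))"
  have A [simp]: "A \<in> free_carrier gens"
    unfolding A_def by (intro free_carrier_sum free_carrier_mult) (use \<beta> in \<open>auto intro!: S_gens weyl_comp\<close>)
  have "(\<Sum>\<alpha>\<in>pos. const (k \<alpha> * cx_fun \<alpha> v) * S (rf \<alpha> \<circ> rf \<beta>)) = const ?c * S id + A"
    unfolding A_def using finite_positive bp
    by (subst sum.remove[of _ \<beta>]) (simp_all add: refl_comp_refl \<beta>')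
  then have 1: "t v * S (rf \<beta>) \<asymp> const (1/2) * (const ?c * S id + A)"
    unfolding t_def mult.assoc
    using S_mult_const_sum(1)[of "rf \<beta>" pos rf "\<lambda>\<alpha>. k \<alpha> * cx_fun \<alpha> v"] \<beta>
    by (intro H.cong_const_mult) simp
  have neg: "cx_fun \<beta> ?v = - cx_fun \<beta> v"
    using root_linear[OF \<beta>'] \<beta>'
    by (simp add: cx_fun_def re_im_cx_reflection reflection_def linear_diff linear_cmul complex_eq_iff)
  have "(\<Sum>\<alpha>\<in>pos - {\<beta>}. const (k \<alpha> * cx_fun \<alpha> ?v) * S (rf \<beta> \<circ> rf \<alpha>))
    = (\<Sum>\<alpha>\<in>pos - {\<beta>}. const (k (\<alpha> \<circ> rf \<beta>) * cx_fun (\<alpha> \<circ> rf \<beta>) ?v) * S (rf \<beta> \<circ> rf (\<alpha> \<circ> rf \<beta>)))"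
    by (rule sum.reindex_bij_betw[OF bij_positive_refl[OF \<beta>], symmetric])
  also have "\<dots> = A"
    unfolding A_def
  proof (rule sum.cong[OF refl])
    fix \<alpha> assume "\<alpha> \<in> pos - {\<beta>}"
    then have \<alpha>: "\<alpha> \<in> \<Phi>"
      by (simp add: positive_root)
    have "rf \<beta> \<circ> rf (\<alpha> \<circ> rf \<beta>) = rf \<alpha> \<circ> rf \<beta>"
      unfolding refl_conjugate[OF \<alpha> \<beta>'] by (simp add: fun_eq_iff refl_refl \<beta>')
    then show "const (k (\<alpha> \<circ> rf \<beta>) * cx_fun (\<alpha> \<circ> rf \<beta>) ?v) * S (rf \<beta> \<circ> rf (\<alpha> \<circ> rf \<beta>))
        = const (k \<alpha> * cx_fun \<alpha> v) * S (rf \<alpha> \<circ> rf \<beta>)"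
      by (simp only: param_refl[OF \<alpha> \<beta>'] cx_fun_comp_refl crf_crf[OF \<beta>'])
  qed
  finally have "(\<Sum>\<alpha>\<in>pos. const (k \<alpha> * cx_fun \<alpha> ?v) * S (rf \<beta> \<circ> rf \<alpha>)) = const (- ?c) * S id + A"
    using finite_positive bp by (subst sum.remove[of _ \<beta>]) (simp_all add: refl_comp_refl \<beta>' neg)
  then have 2: "S (rf \<beta>) * t ?v \<asymp> const (1/2) * (const (- ?c) * S id + A)"
    unfolding t_def const_left_commute[of "S _"]
    using S_mult_const_sum(2)[of "rf \<beta>" pos rf "\<lambda>\<alpha>. k \<alpha> * cx_fun \<alpha> ?v"] \<beta>
    by (intro H.cong_const_mult) simp
  have "T v * S (rf \<beta>) = X v * S (rf \<beta>) - t v * S (rf \<beta>)"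
    by (simp add: T_eq left_diff_distrib)
  also have "\<dots> \<asymp> (S (rf \<beta>) * X ?v + const ?c) - const (1/2) * (const ?c * S id + A)"
    by (intro H.cong_diff X_cross[OF \<beta>] 1)
  also have "\<dots> \<asymp> (S (rf \<beta>) * X ?v + const ?c) - const (1/2) * (const ?c * 1 + A)"
    by (intro H.cong_diff H.cong_add H.cong_const_mult S_id H.cong_refl) (use \<beta> in auto)
  \<comment> \<open>The scalar \<open>?c\<close> minus its half leaves a half of \<open>?c\<close>,
    which is the \<beta>-term of \<open>t ?v\<close> with its reversed sign.\<close>
  also have "\<dots> = S (rf \<beta>) * X ?v - const (1/2) * (const (- ?c) * 1 + A)"
  proof -
    have "const ?c = const (1/2) * const ?c + const (1/2) * const ?c"
      unfolding distrib_right[symmetric] const_add[symmetric] by simp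
    then show ?thesis
      by (simp add: const_uminus distrib_left algebra_simps)
  qed
  also have "\<dots> \<asymp> S (rf \<beta>) * X ?v - const (1/2) * (const (- ?c) * S id + A)"
    by (intro H.cong_diff H.cong_add H.cong_const_mult S_id[THEN H.cong_sym] H.cong_refl) (use \<beta> in auto)
  also have "\<dots> \<asymp> S (rf \<beta>) * X ?v - S (rf \<beta>) * t ?v"
    by (intro H.cong_diff H.cong_sym[OF 2] H.cong_refl) (use \<beta> in auto)
  also have "\<dots> = S (rf \<beta>) * T ?v"
    by (simp add: T_eq right_diff_distrib)
  finally show ?thesis .
qed

lemma T_comp:
  assumes "\<And>v. T v * S w \<asymp> S w * T (L v)" "\<And>v. T v * S w' \<asymp> S w' * T (L' v)"
    and w: "w \<in> W" "w' \<in> W"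
  shows "T v * S (w \<circ> w') \<asymp> S (w \<circ> w') * T (L' (L v))"
proof -
  have "T v * S (w \<circ> w') \<asymp> (T v * S w) * S w'"
    unfolding mult.assoc by (intro H.cong_mult H.cong_refl H.cong_sym[OF S_mult] w T_carrier)
  also have "\<dots> \<asymp> S w * (T (L v) * S w')"
    unfolding mult.assoc[symmetric] by (intro H.cong_mult assms H.cong_refl) (simp add: w)
  also have "\<dots> \<asymp> S w * (S w' * T (L' (L v)))"
    by (intro H.cong_mult[OF H.cong_refl] assms) (simp add: w)
  also have "\<dots> \<asymp> S (w \<circ> w') * T (L' (L v))"
    unfolding mult.assoc[symmetric] by (intro H.cong_mult S_mult w H.cong_refl T_carrier)
  finally show ?thesis .
qed

text \<open>Having no remainder term, the relation composes along products of reflections. Writing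
  the reflection in \<alpha> as a conjugate of the one in \<open>\<alpha> \<circ> rf \<beta>\<close>
  therefore lifts it from simple roots to all positive ones.\<close>

lemma T_refl: 
  assumes "\<alpha> \<in> pos"
  shows "T v * S (rf \<alpha>) \<asymp> S (rf \<alpha>) * T (crf \<alpha> v)"
  using assms
proof (induction arbitrary: v rule: positive_induct)
  case (simple \<beta>)
  then show ?case
    by (rule T_simple)
next
  case (refl \<alpha> \<beta>)
  note \<alpha> = positive_root[OF refl(1)] and \<beta> = simple_root[OF refl(2)]
  have w: "rf (\<alpha> \<circ> rf \<beta>) \<in> W" "rf \<beta> \<in> W"
    using refl_weyl root_refl[OF \<alpha> \<beta>] \<beta> by auto
  have "T v * S (rf \<beta> \<circ> rf (\<alpha> \<circ> rf \<beta>) \<circ> rf \<beta>)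
      \<asymp> S (rf \<beta> \<circ> rf (\<alpha> \<circ> rf \<beta>) \<circ> rf \<beta>) * T (crf \<beta> (crf (\<alpha> \<circ> rf \<beta>) (crf \<beta> v)))"
    by (intro T_comp T_simple refl weyl_comp w)
  moreover have "crf \<beta> (crf (\<alpha> \<circ> rf \<beta>) (crf \<beta> v)) = crf \<alpha> v"
    using refl_conjugate'[OF \<alpha> \<beta>] by (intro re_im_vec_eqI) (simp_all add: re_im_cx_reflection)
  ultimately show ?case
    by (simp only: refl_conjugate'[OF \<alpha> \<beta>, symmetric])
qed

section \<open>The Casimir elements and the decomposition of \<Omega>\<close>

definition Casimir_T :: "'n hgen free" where "Casimir_T = (\<Sum>i\<in>UNIV. T (E i) * T (E i))"
definition Casimir_X :: "'n hgen free" where "Casimir_X = (\<Sum>i\<in>UNIV. X (E i) * X (E i))"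
text \<open>The products of reflections are kept as words of two letters, not contracted to single
  group elements. In this form the sum is the square of the \<open>t\<close>-part literally, and it
  acts on a module by composing the operators of two reflections.\<close>

definition Omega_W_elt :: "'n hgen free" where
  "Omega_W_elt = (\<Sum>\<alpha>\<in>pos. \<Sum>\<beta>\<in>pos. const (1/4 * k \<alpha> * k \<beta> * of_real (dual_form B \<alpha> \<beta>)) * (S (rf \<alpha>) * S (rf \<beta>)))"

lemma Casimir_carrier [simp]: "Casimir_T \<in> free_carrier gens" "Casimir_X \<in> free_carrier gens"
  "Omega_W_elt \<in> free_carrier gens"
  by (auto simp: Casimir_T_def Casimir_X_def Omega_W_elt_def)

lemma Casimir_T_simple:
  assumes \<beta>: "\<beta> \<in> \<Delta>"
  shows "Casimir_T * S (rf \<beta>) \<asymp> S (rf \<beta>) * Casimir_T"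
proof -
  have S: "S (rf \<beta>) \<in> free_carrier gens"
    using \<beta> by simp
  have "T v * T v * S (rf \<beta>) \<asymp> S (rf \<beta>) * (T (crf \<beta> v) * T (crf \<beta> v))" for v
  proof -
    have "T v * T v * S (rf \<beta>) \<asymp> T v * S (rf \<beta>) * T (crf \<beta> v)"
      unfolding mult.assoc by (intro H.cong_mult[OF H.cong_refl] T_simple \<beta> T_carrier)
    also have "\<dots> \<asymp> S (rf \<beta>) * T (crf \<beta> v) * T (crf \<beta> v)"
      by (intro H.cong_mult T_simple \<beta> H.cong_refl T_carrier)
    finally show ?thesis
      by (simp only: mult.assoc)
  qed
  then have "Casimir_T * S (rf \<beta>) \<asymp> S (rf \<beta>) * (\<Sum>i\<in>UNIV. T (crf \<beta> (E i)) * T (crf \<beta> (E i)))"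
    unfolding Casimir_T_def sum_distrib_left sum_distrib_right by (intro H.cong_sum)
  also have "\<dots> \<asymp> S (rf \<beta>) * Casimir_T"
    unfolding Casimir_T_def
    by (intro H.cong_mult[OF H.cong_refl] S lin_canonical_refl lin_T simple_root \<beta>)
  finally show ?thesis .
qed

text \<open>The Riesz representative of \<alpha> for \<open>B\<close>, expanded in the orthonormal
  basis so that sums over \<open>E\<close> with coefficients from \<alpha> are recognized as this
  one vector.\<close>

definition root_vec :: "'n root \<Rightarrow> real^'n" where
  "root_vec \<alpha> = (\<Sum>i\<in>UNIV. \<alpha> (b i) *\<^sub>R b i)"

lemma root_vec_form: 
  assumes "linear \<alpha>"
  shows "B (root_vec \<alpha>) v = \<alpha> v"
proof -
  have "\<alpha> v = \<alpha> (\<Sum>j\<in>UNIV. B v (b j) *\<^sub>R b j)"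
    using orthonormal_expansion by simp
  also have "\<dots> = (\<Sum>j\<in>UNIV. B v (b j) * \<alpha> (b j))"
    by (simp add: linear_sum[OF assms] linear_cmul[OF assms])
  also have "\<dots> = B (root_vec \<alpha>) v"
    by (simp add: root_vec_def B_sym[of _ v] linear_sum[OF bilinear_def[THEN iffD1, OF B_bilinear, THEN conjunct1, rule_format]]
        B_simps mult.commute)
  finally show ?thesis
    by simp
qed

lemma dual_form_eq:
  assumes "\<alpha> \<in> \<Phi>" "\<beta> \<in> \<Phi>"
  shows "dual_form B \<alpha> \<beta> = (\<Sum>i\<in>UNIV. \<alpha> (b i) * \<beta> (b i))"
proof -
  have the: "(THE a. \<forall>v. B a v = \<alpha> v) = root_vec \<alpha>" if "\<alpha> \<in> \<Phi>" for \<alpha>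
  proof (rule the_equality)
    show "\<forall>v. B (root_vec \<alpha>) v = \<alpha> v"
      using root_vec_form[OF root_linear[OF that]] by blast
    fix a assume "\<forall>v. B a v = \<alpha> v"
    then have "B (a - root_vec \<alpha>) v = 0" for v
      using root_vec_form[OF root_linear[OF that]] by (simp add: B_simps)
    then show "a = root_vec \<alpha>"
      using B_pos[of "a - root_vec \<alpha>"] by fastforce
  qed
  have "dual_form B \<alpha> \<beta> = \<alpha> (root_vec \<beta>)"
    using root_vec_form[OF root_linear[OF assms(1)]] by (simp add: dual_form_def the assms)
  then show ?thesis
    using root_linear[OF assms(1)] by (simp add: root_vec_def linear_sum linear_cmul mult.commute)
qed

text \<open>By \<open>coroot_form\<close> the vector is proportional to the coroot, which its
  reflection negates.\<close>

lemma refl_root_vec: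
  assumes \<alpha>: "\<alpha> \<in> \<Phi>"
  shows "rf \<alpha> (root_vec \<alpha>) = - root_vec \<alpha>"
proof -
  let ?d = "B (cr \<alpha>) (cr \<alpha>) / 2"
  have d: "B (cr \<alpha>) v = ?d * \<alpha> v" for v
    using coroot_form[OF \<alpha>, of v] by (simp add: mult.commute)
  have "B (cr \<alpha> - ?d *\<^sub>R root_vec \<alpha>) v = 0" for v
    by (simp only: B_simps root_vec_form[OF root_linear[OF \<alpha>]] d[of v] real_scaleR_def diff_self)
  then have eq: "cr \<alpha> = ?d *\<^sub>R root_vec \<alpha>"
    using B_pos[of "cr \<alpha> - ?d *\<^sub>R root_vec \<alpha>"] by fastforce
  have "\<alpha> (cr \<alpha>) = ?d * \<alpha> (root_vec \<alpha>)"
    by (rule trans[OF arg_cong[OF eq, of \<alpha>]]) (simp add: linear_cmul[OF root_linear[OF \<alpha>]])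
  then have "\<alpha> (root_vec \<alpha>) * ?d = 2"
    using \<alpha> by (simp add: mult.commute)
  moreover have "\<alpha> (root_vec \<alpha>) *\<^sub>R cr \<alpha> = (\<alpha> (root_vec \<alpha>) * ?d) *\<^sub>R root_vec \<alpha>"
    by (rule trans[OF arg_cong[OF eq]]) (rule scaleR_scaleR)
  ultimately have "\<alpha> (root_vec \<alpha>) *\<^sub>R cr \<alpha> = 2 *\<^sub>R root_vec \<alpha>"
    by simp
  then show ?thesis
    by (simp add: reflection_def scaleR_2)
qed

lemma cx_fun_E: "\<alpha> \<in> \<Phi> \<Longrightarrow> cx_fun \<alpha> (E i) = of_real (\<alpha> (b i))"
  by (simp add: root_linear)

lemma of_real_root_vec:
  assumes "\<alpha> \<in> \<Phi>"
  shows "of_real_vec (root_vec \<alpha>) = (\<Sum>i\<in>UNIV. cx_fun \<alpha> (E i) *s E i)"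
  by (simp add: vec_eq_iff of_real_vec_def[of "root_vec \<alpha>"] root_vec_def cx_fun_E assms)
    (simp add: of_real_vec_def)

text \<open>Up to the relations the sum is \<open>T\<close> of the vector representing \<alpha>. The
  reflection negates that vector, which turns the twisted commutation of \<open>T_refl\<close> into
  anticommutation.\<close>

lemma T_root_anticommute:
  assumes \<alpha>: "\<alpha> \<in> pos"
  shows "(\<Sum>i\<in>UNIV. const (cx_fun \<alpha> (E i)) * T (E i)) * S (rf \<alpha>)
    + S (rf \<alpha>) * (\<Sum>i\<in>UNIV. const (cx_fun \<alpha> (E i)) * T (E i)) \<asymp> 0"
    (is "?u * ?S + ?S * ?u \<asymp> 0")
proof -
  let ?r = "of_real_vec (root_vec \<alpha>)"
  note \<alpha>' = positive_root[OF \<alpha>]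
  have S [simp]: "?S \<in> free_carrier gens"
    using \<alpha> by simp
  have u: "?u \<asymp> T ?r"
    using lin_sum[OF lin_T, of "\<lambda>i. cx_fun \<alpha> (E i)" E UNIV, THEN H.cong_sym]
    by (simp only: of_real_root_vec[OF \<alpha>'])
  have r: "crf \<alpha> ?r + ?r = 0"
    by (rule re_im_vec_eqI)
      (simp_all add: re_im_cx_reflection refl_root_vec[OF \<alpha>'] linear_0[OF refl_linear[OF \<alpha>']],
       simp_all add: re_vec_def im_vec_def zero_vec_def)
  have "?u * ?S + ?S * ?u \<asymp> T ?r * ?S + ?S * T ?r"
    by (intro H.cong_add H.cong_mult u H.cong_refl S)
  also have "\<dots> \<asymp> ?S * T (crf \<alpha> ?r) + ?S * T ?r"
    by (intro H.cong_add T_refl \<alpha> H.cong_refl) (use \<alpha> in simp)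
  also have "\<dots> = ?S * (T (crf \<alpha> ?r) + T ?r)"
    by (simp only: distrib_left)
  also have "\<dots> \<asymp> ?S * T (crf \<alpha> ?r + ?r)"
    by (intro H.cong_mult[OF H.cong_refl] H.cong_sym[OF lin_add] lin_T S)
  also have "\<dots> \<asymp> ?S * 0"
    unfolding r by (intro H.cong_mult[OF H.cong_refl] lin_zero lin_T S)
  finally show ?thesis
    by simp
qed

lemma t_eq: "t v = (\<Sum>\<alpha>\<in>pos. const (k \<alpha> / 2 * cx_fun \<alpha> v) * S (rf \<alpha>))"
  by (simp add: t_def sum_distrib_left mult.assoc[symmetric] flip: const_mult)

text \<open>The factor 1/4 is the product of the two halves in \<open>t\<close>, and summing the
  products of two roots over an orthonormal basis gives the dual form.\<close>

lemma Omega_W_eq: "Omega_W_elt = (\<Sum>i\<in>UNIV. t (E i) * t (E i))"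
proof -
  let ?c = "\<lambda>i \<alpha> \<beta>. (k \<alpha> / 2 * cx_fun \<alpha> (E i)) * (k \<beta> / 2 * cx_fun \<beta> (E i))"
  have "(\<Sum>i\<in>UNIV. t (E i) * t (E i)) = (\<Sum>i\<in>UNIV. \<Sum>\<alpha>\<in>pos. \<Sum>\<beta>\<in>pos. const (?c i \<alpha> \<beta>) * (S (rf \<alpha>) * S (rf \<beta>)))"
    unfolding t_eq by (simp only: sum_product const_mult mult.assoc const_left_commute[of "S _"])
  also have "\<dots> = (\<Sum>\<alpha>\<in>pos. \<Sum>\<beta>\<in>pos. \<Sum>i\<in>UNIV. const (?c i \<alpha> \<beta>) * (S (rf \<alpha>) * S (rf \<beta>)))"
    by (subst sum.swap) (intro sum.cong refl sum.swap)
  also have "\<dots> = Omega_W_elt"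
    unfolding Omega_W_elt_def
  proof (intro sum.cong refl)
    fix \<alpha> \<beta> assume "\<alpha> \<in> pos" "\<beta> \<in> pos"
    then have roots: "\<alpha> \<in> \<Phi>" "\<beta> \<in> \<Phi>"
      by (simp_all add: positive_root)
    have "(\<Sum>i\<in>UNIV. ?c i \<alpha> \<beta>) = 1/4 * k \<alpha> * k \<beta> * of_real (dual_form B \<alpha> \<beta>)"
      unfolding dual_form_eq[OF roots] cx_fun_E[OF roots(1)] cx_fun_E[OF roots(2)]
      by (simp add: sum_distrib_left mult_ac)
    then show "(\<Sum>i\<in>UNIV. const (?c i \<alpha> \<beta>) * (S (rf \<alpha>) * S (rf \<beta>)))
        = const (1/4 * k \<alpha> * k \<beta> * of_real (dual_form B \<alpha> \<beta>)) * (S (rf \<alpha>) * S (rf \<beta>))"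
      by (simp only: sum_distrib_right[symmetric] const_sum[symmetric])
  qed
  finally show ?thesis
    by simp
qed

text \<open>The cross terms of \<open>(T + t)\<^sup>2\<close> cancel, because \<open>s\<^sub>\<alpha>\<close> anticommutes with the
  \<open>T\<close> of the vector that represents \<open>\<alpha>\<close>.\<close>

lemma Casimir_X_cong: "Casimir_X \<asymp> Casimir_T + Omega_W_elt"
proof -
  let ?c = "\<lambda>i \<alpha>. k \<alpha> / 2 * cx_fun \<alpha> (E i)"
  let ?u = "\<lambda>\<alpha>. \<Sum>i\<in>UNIV. const (cx_fun \<alpha> (E i)) * T (E i)"
  have X: "X v = T v + t v" for v
    by (simp add: T_eq)
  have eq: "Casimir_X = Casimir_T + Omega_W_elt + (\<Sum>i\<in>UNIV. T (E i) * t (E i) + t (E i) * T (E i))"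
    unfolding Casimir_X_def Casimir_T_def Omega_W_eq X sum.distrib[symmetric]
    by (intro sum.cong refl) (simp add: algebra_simps)
  have "(\<Sum>i\<in>UNIV. T (E i) * t (E i) + t (E i) * T (E i))
    = (\<Sum>i\<in>UNIV. \<Sum>\<alpha>\<in>pos. const (?c i \<alpha>) * (T (E i) * S (rf \<alpha>) + S (rf \<alpha>) * T (E i)))"
    unfolding t_eq
    by (simp only: sum_distrib_left sum_distrib_right sum.distrib[symmetric] distrib_left mult.assoc
        const_left_commute[of "T _"])
  also have "\<dots> = (\<Sum>\<alpha>\<in>pos. \<Sum>i\<in>UNIV. const (?c i \<alpha>) * (T (E i) * S (rf \<alpha>) + S (rf \<alpha>) * T (E i)))"
    by (rule sum.swap)
  also have "\<dots> = (\<Sum>\<alpha>\<in>pos. const (k \<alpha> / 2) * (?u \<alpha> * S (rf \<alpha>) + S (rf \<alpha>) * ?u \<alpha>))"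
    by (simp only: sum_distrib_left sum_distrib_right sum.distrib[symmetric] distrib_left mult.assoc
        const_left_commute[of "S _"] const_mult)
  also have "\<dots> \<asymp> (\<Sum>\<alpha>\<in>pos. const (k \<alpha> / 2) * 0)"
    by (intro H.cong_sum H.cong_const_mult T_root_anticommute)
  finally have "(\<Sum>i\<in>UNIV. T (E i) * t (E i) + t (E i) * T (E i)) \<asymp> 0"
    by simp
  then have "Casimir_X \<asymp> Casimir_T + Omega_W_elt + 0"
    unfolding eq by (intro H.cong_add H.cong_refl) auto
  then show ?thesis
    by simp
qed

text \<open>Taken from the cross relation itself, since the commutation of
  \<open>Omega_W_elt\<close> with W is deduced from this lemma. Passing the reflection through both
  factors reflects the canonical tensor, which does not change it. The remainders add up to
  \<open>X\<close> of a multiple of \<open>r + s r\<close>, with \<open>r\<close> the vector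
  representing \<beta>, and \<open>r + s r = 0\<close>.\<close>

lemma Casimir_X_simple:
  assumes \<beta>: "\<beta> \<in> \<Delta>"
  shows "Casimir_X * S (rf \<beta>) \<asymp> S (rf \<beta>) * Casimir_X"
proof -
  let ?S = "S (rf \<beta>)" and ?s = "crf \<beta>" and ?c = "\<lambda>v. k \<beta> * cx_fun \<beta> v"
  note \<beta>' = simple_root[OF \<beta>]
  have S [simp]: "?S \<in> free_carrier gens"
    using \<beta> by simp
  let ?r = "of_real_vec (root_vec \<beta>)"
  have r: "?s ?r + ?r = 0"
    by (rule re_im_vec_eqI)
      (simp_all add: re_im_cx_reflection refl_root_vec[OF \<beta>'] linear_0[OF refl_linear[OF \<beta>']],
       simp_all add: re_vec_def im_vec_def zero_vec_def)
  have "X v * X v * ?S \<asymp> ?S * (X (?s v) * X (?s v)) + const (?c v) * X (?s v + v)" for v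
  proof -
    have "X v * X v * ?S \<asymp> X v * (?S * X (?s v) + const (?c v))"
      unfolding mult.assoc by (intro H.cong_mult[OF H.cong_refl] X_cross \<beta>) simp
    also have "\<dots> = X v * ?S * X (?s v) + const (?c v) * X v"
      by (simp only: distrib_left mult.assoc const_commute)
    also have "\<dots> \<asymp> (?S * X (?s v) + const (?c v)) * X (?s v) + const (?c v) * X v"
      by (intro H.cong_add H.cong_mult X_cross \<beta> H.cong_refl) (use \<beta> in auto)
    also have "\<dots> = ?S * (X (?s v) * X (?s v)) + const (?c v) * (X (?s v) + X v)"
      by (simp add: distrib_left distrib_right mult.assoc)
    also have "\<dots> \<asymp> ?S * (X (?s v) * X (?s v)) + const (?c v) * X (?s v + v)"
      by (intro H.cong_add H.cong_const_mult H.cong_sym[OF lin_add] lin_X H.cong_refl) (use \<beta> in auto)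
    finally show ?thesis .
  qed
  then have "Casimir_X * ?S \<asymp> (\<Sum>i\<in>UNIV. ?S * (X (?s (E i)) * X (?s (E i))) + const (?c (E i)) * X (?s (E i) + E i))"
    unfolding Casimir_X_def sum_distrib_right by (intro H.cong_sum)
  also have "\<dots> = ?S * (\<Sum>i\<in>UNIV. X (?s (E i)) * X (?s (E i))) + (\<Sum>i\<in>UNIV. const (?c (E i)) * X (?s (E i) + E i))"
    by (simp only: sum.distrib sum_distrib_left)
  also have "\<dots> \<asymp> ?S * Casimir_X + X (\<Sum>i\<in>UNIV. ?c (E i) *s (?s (E i) + E i))"
    unfolding Casimir_X_def
    by (intro H.cong_add H.cong_mult[OF H.cong_refl] lin_canonical_refl lin_X \<beta>' S lin_sum[THEN H.cong_sym])
  also have "(\<Sum>i\<in>UNIV. ?c (E i) *s (?s (E i) + E i)) = k \<beta> *s (?s ?r + ?r)"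
  proof -
    have s_lin: "?s (u + v) = ?s u + ?s v" "?s (c *s v) = c *s ?s v" for u v c
      using cx_linear_root[OF \<beta>']
      by (simp_all add: cx_reflection_def cx_linear_add cx_linear_scale vec.scale_left_distrib
          vec.scale_right_diff_distrib)
    have "?s ?r = (\<Sum>i\<in>UNIV. cx_fun \<beta> (E i) *s ?s (E i))"
      unfolding of_real_root_vec[OF \<beta>'] by (simp only: additive_sum[of ?s, OF s_lin(1)] s_lin(2))
    then have "?s ?r + ?r = (\<Sum>i\<in>UNIV. cx_fun \<beta> (E i) *s (?s (E i) + E i))"
      unfolding of_real_root_vec[OF \<beta>'] by (simp only: sum.distrib[symmetric] vec.scale_right_distrib)
    then show ?thesis
      by (simp add: vec.scale_sum_right)
  qed
  also have "?S * Casimir_X + X (k \<beta> *s (?s ?r + ?r)) \<asymp> ?S * Casimir_X + 0"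
    unfolding r using lin_zero[OF lin_X] by (intro H.cong_add H.cong_refl) (use \<beta> in auto)
  finally show ?thesis
    by simp
qed

lemma commute_weyl:
  assumes Z: "Z \<in> free_carrier gens" and comm: "\<And>\<beta>. \<beta> \<in> \<Delta> \<Longrightarrow> Z * S (rf \<beta>) \<asymp> S (rf \<beta>) * Z"
    and "w \<in> W"
  shows "Z * S w \<asymp> S w * Z"
  using \<open>w \<in> W\<close>
proof (induction rule: weyl_simple_induct)
  case id
  have "Z * S id \<asymp> Z * 1"
    by (intro H.cong_mult[OF H.cong_refl] S_id Z)
  also have "Z * 1 = 1 * Z"
    by simp
  also have "\<dots> \<asymp> S id * Z"
    by (intro H.cong_mult[OF _ H.cong_refl] H.cong_sym[OF S_id] Z)
  finally show ?case .
next
  case (step \<beta> w)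
  have "Z * S (rf \<beta> \<circ> w) \<asymp> Z * S (rf \<beta>) * S w"
    unfolding mult.assoc using step by (intro H.cong_mult[OF H.cong_refl] H.cong_sym[OF S_mult] Z) auto
  also have "\<dots> \<asymp> S (rf \<beta>) * Z * S w"
    using step by (intro H.cong_mult[OF _ H.cong_refl] comm) auto
  also have "\<dots> \<asymp> S (rf \<beta>) * S w * Z"
    unfolding mult.assoc using step by (intro H.cong_mult[OF H.cong_refl]) auto
  also have "\<dots> \<asymp> S (rf \<beta> \<circ> w) * Z"
    using step by (intro H.cong_mult[OF _ H.cong_refl] S_mult Z) auto
  finally show ?case .
qed

text \<open>A central character provides scalars only for the centre of the quotient algebra; this
  places \<Omega> there.\<close>

lemma Casimir_X_central: "presented_class gens (hecke_rels \<Phi> cr \<Delta> k) Casimir_X \<in> ring_center (hecke_algebra \<Phi> cr \<Delta> k)"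
  unfolding hecke_algebra_def
proof (rule H.class_in_center)
  fix g assume "g \<in> gens"
  then consider w where "w \<in> W" "g = GW w" | v where "g = GV v"
    by (auto simp: hecke_gens_def)
  then show "Casimir_X * gen g \<asymp> gen g * Casimir_X"
  proof cases
    case 1
    then show ?thesis
      using commute_weyl[of Casimir_X] Casimir_X_simple by simp
  next
    case 2
    have "X u * X u * X v \<asymp> X v * (X u * X u)" for u
    proof -
      have "X u * X u * X v \<asymp> X u * X v * X u"
        unfolding mult.assoc by (intro H.cong_mult[OF H.cong_refl] X_commute) simp
      also have "\<dots> \<asymp> X v * X u * X u"
        by (intro H.cong_mult[OF _ H.cong_refl] X_commute) simp
      finally show ?thesis
        by (simp only: mult.assoc)
    qed
    then show ?thesis
      unfolding 2 Casimir_X_def sum_distrib_left sum_distrib_right by (intro H.cong_sum)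
  qed
qed simp

text \<open>As a difference of two elements already known to commute with W, it requires no account
  of how W permutes pairs of positive roots up to sign.\<close>

lemma Omega_W_elt_commute:
  assumes "w \<in> W"
  shows "Omega_W_elt * S w \<asymp> S w * Omega_W_elt"
proof -
  have O: "Omega_W_elt \<asymp> Casimir_X - Casimir_T"
    using H.cong_diff[OF H.cong_sym[OF Casimir_X_cong] H.cong_refl[of Casimir_T]] by simp
  have "Omega_W_elt * S w \<asymp> (Casimir_X - Casimir_T) * S w"
    using assms by (intro H.cong_mult[OF O] H.cong_refl) simp
  also have "\<dots> \<asymp> S w * Casimir_X - S w * Casimir_T"
    unfolding left_diff_distrib
    by (rule H.cong_diff[OF commute_weyl[OF _ Casimir_X_simple assms] commute_weyl[OF _ Casimir_T_simple assms]])
      simp_all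
  also have "\<dots> = S w * (Casimir_X - Casimir_T)"
    by (simp only: right_diff_distrib)
  also have "\<dots> \<asymp> S w * Omega_W_elt"
    using assms by (intro H.cong_mult[OF H.cong_refl] H.cong_sym[OF O]) simp
  finally show ?thesis .
qed

end

section \<open>The scalar of a central operator\<close>

context complex_space
begin

text \<open>The vector \<open>p(T) x\<close>, evaluated by Horner's scheme.\<close>

definition poly_orbit :: "('m \<Rightarrow> 'm) \<Rightarrow> 'm \<Rightarrow> complex poly \<Rightarrow> 'm" where
  "poly_orbit T x p = fold_coeffs (\<lambda>a v. a *\<^sub>c x + T v) p 0"

lemma poly_orbit_pCons:
  assumes "Vector_Spaces.linear scale scale T"
  shows "poly_orbit T x (pCons a p) = a *\<^sub>c x + T (poly_orbit T x p)"
proof -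
  interpret T: Vector_Spaces.linear scale scale T
    by (rule assms)
  show ?thesis
    \<comment> \<open>If both vanish, \<open>pCons a p\<close> is the zero polynomial, whose
      coefficient list is empty; the fold then returns its start value 0.\<close>
    by (cases "a = 0 \<and> p = 0") (auto simp: poly_orbit_def)
qed

lemma poly_orbit_0 [simp]: "poly_orbit T x 0 = 0"
  by (simp add: poly_orbit_def)

lemma poly_orbit_add:
  assumes "Vector_Spaces.linear scale scale T"
  shows "poly_orbit T x (p + q) = poly_orbit T x p + poly_orbit T x q"
proof -
  interpret T: Vector_Spaces.linear scale scale T
    by (rule assms)
  show ?thesis
    by (induction p q rule: poly_induct2)
      (simp_all add: poly_orbit_pCons[OF assms] T.add scale_left_distrib algebra_simps)
qed

lemma poly_orbit_smult:
  assumes "Vector_Spaces.linear scale scale T"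
  shows "poly_orbit T x (smult c p) = c *\<^sub>c poly_orbit T x p"
proof -
  interpret T: Vector_Spaces.linear scale scale T
    by (rule assms)
  show ?thesis
    by (induction p) (simp_all add: poly_orbit_pCons[OF assms] T.scale scale_right_distrib)
qed

text \<open>Otherwise the images of the monomials, the vectors obtained by iterating
  \<open>T\<close> on \<open>x\<close>, would be an infinite independent family in a space with a
  finite spanning set.\<close>

lemma poly_orbit_not_inj:
  assumes T: "Vector_Spaces.linear scale scale T" and A: "finite A" "span A = UNIV"
  obtains p where "p \<noteq> 0" "poly_orbit T x p = 0"
proof (rule ccontr)
  assume "\<not> thesis"
  then have ker: "p = 0" if "poly_orbit T x p = 0" for p
    using that \<open>\<And>p. p \<noteq> 0 \<Longrightarrow> poly_orbit T x p = 0 \<Longrightarrow> thesis\<close> by blast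
  let ?f = "\<lambda>n. poly_orbit T x (monom 1 n)"
  have sum: "(\<Sum>n\<in>I. c n *\<^sub>c ?f n) = poly_orbit T x (\<Sum>n\<in>I. monom (c n) n)" for c I
    by (simp add: additive_sum[of "poly_orbit T x", OF poly_orbit_add[OF T]]
        poly_orbit_smult[OF T, symmetric] smult_monom)
  have inj: "inj ?f"
  proof (rule injI)
    fix i j assume "?f i = ?f j"
    moreover have "?f i = poly_orbit T x (monom 1 i - monom 1 j) + ?f j"
      unfolding poly_orbit_add[OF T, symmetric] by simp
    ultimately have "monom 1 i - monom 1 j = (0 :: complex poly)"
      by (intro ker) simp
    then show "i = j"
      by (simp add: monom_eq_iff')
  qed
  have "independent (range ?f)"
    unfolding independent_explicit_module
  proof (intro allI impI)
    fix t u v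
    assume t: "finite t" "t \<subseteq> range ?f" "(\<Sum>v\<in>t. u v *\<^sub>c v) = 0" "v \<in> t"
    obtain I where I: "t = ?f ` I"
      using t(2) by (meson subset_imageE)
    have injI: "inj_on ?f I"
      using inj by (rule inj_on_subset) simp
    then have fin: "finite I"
      using t(1) finite_imageD by (auto simp: I)
    have "(\<Sum>v\<in>t. u v *\<^sub>c v) = (\<Sum>n\<in>I. u (?f n) *\<^sub>c ?f n)"
      unfolding I by (simp add: sum.reindex[OF injI])
    then have 0: "(\<Sum>n\<in>I. monom (u (?f n)) n) = 0"
      using t(3) ker by (simp add: sum)
    obtain j where j: "j \<in> I" "v = ?f j"
      using t(4) I by blast
    have "coeff (\<Sum>n\<in>I. monom (u (?f n)) n) j = u (?f j)"
      using fin j(1) by (simp add: coeff_sum)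
    then show "u v = 0"
      using 0 j by simp
  qed
  then have "finite (range ?f)"
    using independent_span_bound[OF A(1)] A(2) by auto
  then show False
    using inj finite_imageD by blast
qed

text \<open>Among the nonzero polynomials with \<open>p(T) x = 0\<close> take one of least degree
  and split off a root \<open>a\<close>, so that \<open>p\<close> is \<open>q\<close> times a linear
  factor. By minimality \<open>q(T) x\<close> is nonzero, and the linear factor kills it.\<close>

lemma exists_eigenvector:
  fixes x :: 'm
  assumes T: "Vector_Spaces.linear scale scale T" and A: "finite A" "span A = UNIV" and "x \<noteq> 0"
  obtains a y where "y \<noteq> 0" "T y = a *\<^sub>c y"
proof -
  interpret T: Vector_Spaces.linear scale scale T
    by (rule T)
  define p where "p = (ARG_MIN degree p. p \<noteq> 0 \<and> poly_orbit T x p = 0)"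
  obtain p0 where p0: "p0 \<noteq> 0 \<and> poly_orbit T x p0 = 0"
    using poly_orbit_not_inj[OF T A] by metis
  have p: "p \<noteq> 0" "poly_orbit T x p = 0"
    using arg_min_natI[of "\<lambda>p. p \<noteq> 0 \<and> poly_orbit T x p = 0", OF p0] unfolding p_def by auto
  have min: "degree p \<le> degree q" if "q \<noteq> 0" "poly_orbit T x q = 0" for q
    using arg_min_nat_le[of "\<lambda>p. p \<noteq> 0 \<and> poly_orbit T x p = 0" q degree] that unfolding p_def by auto
  \<comment> \<open>A nonzero constant polynomial sends \<open>x\<close> to a nonzero multiple of
    \<open>x\<close>.\<close>
  have "degree p \<noteq> 0"
  proof
    assume "degree p = 0"
    then obtain c where c: "p = [:c:]"
      by (rule degree_eq_zeroE)
    then show False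
      using p \<open>x \<noteq> 0\<close> by (simp add: poly_orbit_pCons[OF T])
  qed
  then obtain a where "poly p a = 0"
    using fundamental_theorem_of_algebra[of p] by (metis constant_degree)
  then obtain q where q: "p = [:- a, 1:] * q"
    by (metis poly_eq_0_iff_dvd dvd_def)
  then have "q \<noteq> 0"
    using p(1) by auto
  have "degree p = Suc (degree q)"
    unfolding q using \<open>q \<noteq> 0\<close> by (subst degree_mult_eq) auto
  then have ne: "poly_orbit T x q \<noteq> 0"
    using min[of q] \<open>q \<noteq> 0\<close> by auto
  have "p = smult (- a) q + pCons 0 q"
    by (simp add: q)
  then have "(- a) *\<^sub>c poly_orbit T x q + T (poly_orbit T x q) = 0"
    using p(2) by (simp only: poly_orbit_add[OF T] poly_orbit_smult[OF T] poly_orbit_pCons[OF T])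
      simp
  then have "T (poly_orbit T x q) = a *\<^sub>c poly_orbit T x q"
    by (simp add: scale_minus_left)
  then show ?thesis
    using that ne by blast
qed

end

section \<open>Schur's lemma for W\<close>

lemma group_algebra_act_add:
  assumes "vector_space s"
  shows "group_algebra_act s \<tau> (x + y) u = group_algebra_act s \<tau> x u + group_algebra_act s \<tau> y u"
proof -
  interpret vector_space s
    by (rule assms)
  show ?thesis
    unfolding group_algebra_act_def by (rule sum_keys_add) (rule scale_left_distrib)
qed

lemma group_algebra_act_single:
  assumes "vector_space s"
  shows "group_algebra_act s \<tau> (Poly_Mapping.single w c) u = s c (\<tau> w u)"
proof -
  interpret vector_space s
    by (rule assms)
  show ?thesis
    unfolding group_algebra_act_def
    by (subst sum_keys_single[where g = "\<lambda>w c. s c (\<tau> w u)"]) simp_all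
qed

text \<open>The orbit of a nonzero vector is finite and spans a nonzero subrepresentation, hence
  everything. This gives the finite spanning set from which \<open>T\<close> gets an eigenvector;
  the corresponding eigenspace is a subrepresentation.\<close>

lemma (in root_data) schur_scalar:
  fixes s :: "complex \<Rightarrow> 'u \<Rightarrow> 'u::ab_group_add"
  assumes irr: "irreducible_weyl_rep \<Phi> cr s \<tau>"
    and T: "Vector_Spaces.linear s s T"
    and comm: "\<And>w u. w \<in> W \<Longrightarrow> T (\<tau> w u) = \<tau> w (T u)"
  obtains c where "\<And>u. T u = s c u"
proof -
  have rep: "weyl_rep \<Phi> cr s \<tau>" and "\<exists>u::'u. u \<noteq> 0"
    and inv: "\<And>S. module.subspace s S \<Longrightarrow> (\<And>w. w \<in> W \<Longrightarrow> \<tau> w ` S \<subseteq> S) \<Longrightarrow> S = {0} \<or> S = UNIV"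
    using irr unfolding irreducible_weyl_rep_def by blast+
  then obtain x :: 'u where "x \<noteq> 0"
    by blast
  interpret complex_space s
    using rep by (simp add: complex_space_def weyl_rep_def)
  have lin: "Vector_Spaces.linear s s (\<tau> w)" if "w \<in> W" for w
    using rep that by (simp add: weyl_rep_def)
  have mult: "\<tau> w (\<tau> w' u) = \<tau> (w \<circ> w') u" if "w \<in> W" "w' \<in> W" for w w' u
    using rep that by (simp add: weyl_rep_def)
  let ?A = "(\<lambda>w. \<tau> w x) ` W"
  have "x \<in> ?A"
    using rep weyl_group.one by (auto simp: weyl_rep_def intro!: image_eqI[of _ _ id])
  moreover have "\<tau> w ` span ?A \<subseteq> span ?A" if "w \<in> W" for w
  proof -
    interpret L: Vector_Spaces.linear s s "\<tau> w"
      by (rule lin[OF that])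
    have "\<tau> w ` ?A \<subseteq> ?A"
      using that by (auto simp: mult weyl_comp)
    then show ?thesis
      using L.span_image[of ?A] span_mono by metis
  qed
  ultimately have span: "span ?A = UNIV"
    using inv[of "span ?A"] \<open>x \<noteq> 0\<close> span_base by auto
  obtain c y where y: "y \<noteq> 0" "T y = s c y"
    by (rule exists_eigenvector[OF T finite_imageI[OF finite_weyl] span \<open>x \<noteq> 0\<close>])
  interpret T: Vector_Spaces.linear s s T
    by (rule T)
  let ?E = "{u. T u = s c u}"
  have "subspace ?E"
    by (rule subspaceI) (auto simp: T.add T.scale scale_right_distrib scale_left_commute)
  moreover have "\<tau> w ` ?E \<subseteq> ?E" if "w \<in> W" for w
  proof -
    interpret L: Vector_Spaces.linear s s "\<tau> w"
      by (rule lin[OF that])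
    show ?thesis
      using comm[OF that] by (auto simp: L.scale)
  qed
  ultimately have "?E = UNIV"
    using inv[of ?E] y by auto
  then show ?thesis
    using that by blast
qed

section \<open>The operators D on simple tensors\<close>

lemma sym_cnj_single: "sym_cnj (Poly_Mapping.single \<mu> c) = Poly_Mapping.single \<mu> (cnj c)"
  by (simp add: sym_cnj_def)

lemma sym_cnj_mult: "sym_cnj (p * q) = sym_cnj p * sym_cnj q"
proof (rule additive_eqI[of "\<lambda>p. sym_cnj (p * q)"])
  show "sym_cnj (Poly_Mapping.single \<mu> a * q) = sym_cnj (Poly_Mapping.single \<mu> a) * sym_cnj q" for \<mu> a
  proof (rule additive_eqI[of "\<lambda>q. sym_cnj (Poly_Mapping.single \<mu> a * q)"])
    show "sym_cnj (Poly_Mapping.single \<mu> a * Poly_Mapping.single \<nu> c)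
        = sym_cnj (Poly_Mapping.single \<mu> a) * sym_cnj (Poly_Mapping.single \<nu> c)" for \<nu> c
      by (simp add: mult_single sym_cnj_single)
  qed (simp_all add: sym_cnj_add distrib_left)
qed (simp_all add: sym_cnj_add distrib_right)

lemma sym_cnj_partial: "sym_cnj (sym_partial j p) = sym_partial j (sym_cnj p)"
proof (rule additive_eqI[of "\<lambda>p. sym_cnj (sym_partial j p)"])
  show "sym_cnj (sym_partial j (Poly_Mapping.single \<mu> a)) = sym_partial j (sym_cnj (Poly_Mapping.single \<mu> a))" for \<mu> a
    by (simp add: sym_partial_single sym_cnj_single)
qed (simp_all add: sym_cnj_add sym_partial_add)

lemma sym_cnj_vec: "sym_cnj (sym_vec (of_real_vec x)) = sym_vec (of_real_vec x)"
proof -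
  have "sym_cnj (sym_var j) = sym_var j" for j :: 'a
    by (simp add: sym_var_def sym_cnj_single)
  then show ?thesis
    by (simp add: sym_vec_eq additive_sum[of sym_cnj, OF sym_cnj_add] sym_cnj_scale of_real_vec_def)
qed

lemma sym_cnj_deriv:
  assumes "\<And>j. cnj (f (axis j 1)) = f (axis j 1)"
  shows "sym_cnj (sym_deriv f p) = sym_deriv f (sym_cnj p)"
  by (simp add: sym_deriv_eq additive_sum[of sym_cnj, OF sym_cnj_add] sym_cnj_scale assms sym_cnj_partial)

lemma sym_cnj_real: "p \<in> real_sym \<Longrightarrow> sym_cnj p = p"
  by (intro poly_mapping_eqI) (simp add: lookup_sym_cnj real_sym_def Reals_cnj_iff)

context real_form
begin

lemma BC_axis_real: "cnj (BC (E i) (axis j 1)) = BC (E i) (axis j 1)"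
proof -
  have "axis j 1 = of_real_vec (axis j 1)"
    by (simp add: of_real_vec_def axis_def vec_eq_iff)
  then show ?thesis
    by (metis BC_real complex_cnj_complex_of_real)
qed

text \<open>Moving both multiplications across the form exchanges \<open>i\<close> and \<open>j\<close>; since \<open>p\<close> is real, the
  symmetry of the pairing undoes the exchange.\<close>

lemma sym_form_vec_deriv:
  assumes p: "p \<in> real_sym"
  shows "sym_form b (sym_vec (E i) * p) (sym_vec (E j) * p)
    = (if i = j then sym_form b p p else 0) + sym_form b (sym_deriv (BC (E i)) p) (sym_deriv (BC (E j)) p)"
proof -
  note lin = cx_linear_dual_E
  let ?q = "sym_pairing E" and ?d = "\<lambda>i. sym_deriv (BC (E i))"
  have cnj_d: "sym_cnj (?d i p) = ?d i (sym_cnj p)" for i p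
    by (rule sym_cnj_deriv) (rule BC_axis_real)
  have form: "sym_form b P Q = ?q (sym_cnj P) Q" for P Q
    by (simp add: sym_form_eq comp_def)
  have "sym_form b (sym_vec (E i) * p) (sym_vec (E j) * p) = ?q (sym_vec (E i) * p) (sym_vec (E j) * p)"
    by (simp add: form sym_cnj_mult sym_cnj_vec sym_cnj_real[OF p])
  also have "\<dots> = ?q (?d j (sym_vec (E i) * p)) p"
    by (simp only: sym_pairing_vec[OF lin] to_dual_E)
  also have "?d j (sym_vec (E i) * p) = const (BC (E j) (E i)) * p + sym_vec (E i) * ?d j p"
    by (simp only: sym_deriv_mult sym_deriv_vec[OF cx_linear_BC])
  also have "?q (\<dots>) p = BC (E j) (E i) * ?q p p + ?q (sym_vec (E i) * ?d j p) p"
    by (simp only: sym_pairing_add_left sym_pairing_scale_left)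
  also have "?q (sym_vec (E i) * ?d j p) p = ?q (?d i p) (?d j p)"
    by (simp only: sym_pairing_vec_left[OF lin] to_dual_E sym_pairing_commute[OF lin, of _ "?d i p"])
  also have "\<dots> = sym_form b (?d i p) (?d j p)"
    by (simp only: form cnj_d sym_cnj_real[OF p])
  also have "BC (E j) (E i) * ?q p p = (if i = j then sym_form b p p else 0)"
    by (simp add: BC_E form sym_cnj_real[OF p] del: BC_real)
  finally show ?thesis .
qed

end

section \<open>The module M, the operators D and the two scalars\<close>

locale hecke_rep = hecke \<Phi> \<Delta> cr B b k + complex_space scale
  for \<Phi> \<Delta> :: "'n::finite root set" and cr B and b :: "'n \<Rightarrow> real^'n" and k
    and scale :: "complex \<Rightarrow> 'm \<Rightarrow> 'm::ab_group_add" (infixr "*\<^sub>c" 75) +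
  fixes \<pi> :: "'n hgen free set \<Rightarrow> 'm \<Rightarrow> 'm"
  assumes module: "hecke_module \<Phi> cr \<Delta> k scale \<pi>"
begin

text \<open>The action pulled back to the free algebra, where congruence of representatives becomes
  equality of operators.\<close>

definition \<rho> :: "'n hgen free \<Rightarrow> 'm \<Rightarrow> 'm" where
  "\<rho> p = \<pi> (hecke_class \<Phi> cr \<Delta> k p)"

lemma hecke_class_eq: "hecke_class \<Phi> cr \<Delta> k = presented_class gens (hecke_rels \<Phi> cr \<Delta> k)"
  by (simp add: hecke_class_def)

lemma \<rho>_hom: "\<rho> \<in> ring_hom (free_algebra gens) (End_ring scale)"
proof -
  have "\<pi> \<circ> presented_class gens (hecke_rels \<Phi> cr \<Delta> k) \<in> ring_hom (free_algebra gens) (End_ring scale)"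
    using module H.class_ring_hom unfolding hecke_module_def hecke_algebra_def
    by (intro ring_hom_trans) auto
  then show ?thesis
    by (simp add: \<rho>_def[abs_def] hecke_class_eq comp_def)
qed

lemma \<rho>_add: "p \<in> free_carrier gens \<Longrightarrow> q \<in> free_carrier gens \<Longrightarrow> \<rho> (p + q) m = \<rho> p m + \<rho> q m"
  using ring_hom_add[OF \<rho>_hom, of p q] by (simp add: End_ring_def)

lemma \<rho>_mult: "p \<in> free_carrier gens \<Longrightarrow> q \<in> free_carrier gens \<Longrightarrow> \<rho> (p * q) m = \<rho> p (\<rho> q m)"
  using ring_hom_mult[OF \<rho>_hom, of p q] by (simp add: End_ring_def)

lemma \<rho>_const: "\<rho> (const c) m = c *\<^sub>c m"
  using module by (simp add: hecke_module_def \<rho>_def)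

lemma \<rho>_linear: "p \<in> free_carrier gens \<Longrightarrow> Vector_Spaces.linear scale scale (\<rho> p)"
  using ring_hom_closed[OF \<rho>_hom, of p] by (simp add: End_ring_def)

lemma \<rho>_cong: "p \<asymp> q \<Longrightarrow> \<rho> p = \<rho> q"
  using H.class_eqI[of p q] by (simp add: \<rho>_def hecke_class_eq)

lemma \<rho>_sum:
  assumes "\<And>x. x \<in> A \<Longrightarrow> f x \<in> free_carrier gens"
  shows "\<rho> (sum f A) m = (\<Sum>x\<in>A. \<rho> (f x) m)"
  using assms
proof (induction A rule: infinite_finite_induct)
  case (insert x A)
  then show ?case
    by (simp add: \<rho>_add)
qed (use \<rho>_const[of 0] in simp_all)

lemma \<rho>_T_lin: "\<rho> (T (u + v)) m = \<rho> (T u) m + \<rho> (T v) m" "\<rho> (T (c *s v)) m = c *\<^sub>c \<rho> (T v) m"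
  using \<rho>_cong[OF lin_add[OF lin_T]] \<rho>_cong[OF lin_scale[OF lin_T]] by (simp_all add: \<rho>_add \<rho>_mult \<rho>_const)

lemma D_plus_tensor:
  assumes v: "cx_basis v"
  shows "D_plus \<Phi> cr \<Delta> k B scale \<pi> v (tensor scale m p)
    = (\<Sum>i\<in>UNIV. tensor scale (\<rho> (T (E i)) m) (sym_vec (E i) * p))"
proof -
  have "D_plus \<Phi> cr \<Delta> k B scale \<pi> v (tensor scale m p)
      = (\<Sum>i\<in>UNIV. tensor scale (\<rho> (T (v i)) m) (sym_vec (B_dual_vector B v i) * p))"
    unfolding D_plus_def \<rho>_def[symmetric]
    by (intro sum.cong refl, subst tensor_op_tensor)
      (simp_all add: \<rho>_linear weyl_alg_act_vec distrib_left mult.left_commute[of _ "const _"])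
  also have "\<dots> = (\<Sum>i\<in>UNIV. tensor scale (\<rho> (T (E i)) m) (sym_vec (E i) * p))"
    by (rule canonical_tensor[OF v, where F = "\<lambda>u w. tensor scale (\<rho> (T u) m) (sym_vec w * p)"])
      (simp_all add: \<rho>_T_lin tensor_add_left tensor_add_right tensor_scale_left sym_vec_add
        sym_vec_scale distrib_right mult.assoc)
  finally show ?thesis .
qed

text \<open>The functional dual to \<open>v i\<close> is \<open>BC\<close> of the
  \<open>B\<close>-dual vector. Hence this operator, too, is a balanced expression in the canonical
  tensor, and the basis can be exchanged.\<close>

lemma D_minus_tensor:
  assumes v: "cx_basis v"
  shows "D_minus \<Phi> cr \<Delta> k scale \<pi> v (tensor scale m p)
    = (\<Sum>i\<in>UNIV. tensor scale (\<rho> (T (E i)) m) (sym_deriv (BC (E i)) p))"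
proof -
  have "D_minus \<Phi> cr \<Delta> k scale \<pi> v (tensor scale m p)
      = (\<Sum>i\<in>UNIV. tensor scale (\<rho> (T (v i)) m) (sym_deriv (BC (B_dual_vector B v i)) p))"
    unfolding D_minus_def \<rho>_def[symmetric] dual_functional_eq[OF v]
    by (intro sum.cong refl, subst tensor_op_tensor)
      (simp_all add: \<rho>_linear weyl_alg_act_cov[OF cx_linear_BC] sym_deriv_add sym_deriv_scale)
  also have "\<dots> = (\<Sum>i\<in>UNIV. tensor scale (\<rho> (T (E i)) m) (sym_deriv (BC (E i)) p))"
  proof (rule canonical_tensor[OF v, where F = "\<lambda>u w. tensor scale (\<rho> (T u) m) (sym_deriv (BC w) p)"])
    have "sym_deriv (BC (w + w')) p = sym_deriv (BC w) p + sym_deriv (BC w') p" for w w'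
      using sym_deriv_lin[of 1 "BC w" 1 "BC w'" p] by (simp add: BC_left flip: BC_left(1))
    then show "tensor scale (\<rho> (T u) m) (sym_deriv (BC (w + w')) p)
        = tensor scale (\<rho> (T u) m) (sym_deriv (BC w) p) + tensor scale (\<rho> (T u) m) (sym_deriv (BC w') p)" for u w w'
      by (simp add: tensor_add_right)
    have "sym_deriv (BC (c *s w)) p = const c * sym_deriv (BC w) p" for c w
    proof -
      have "BC (c *s w) = (\<lambda>z. c * BC w z + 0 * BC w z)"
        by (simp add: BC_left fun_eq_iff)
      then show ?thesis
        using sym_deriv_lin[of c "BC w" 0 "BC w" p] by simp
    qed
    then show "tensor scale (\<rho> (T (c *s u)) m) (sym_deriv (BC w) p)
        = tensor scale (\<rho> (T u) m) (sym_deriv (BC (c *s w)) p)" for c u w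
      by (simp add: \<rho>_T_lin tensor_scale_left)
  qed (simp add: \<rho>_T_lin tensor_add_left)
  finally show ?thesis .
qed

lemma \<rho>_Omega_W:
  "\<rho> Omega_W_elt m = (\<Sum>\<alpha>\<in>pos. \<Sum>\<beta>\<in>pos.
     (1/4 * k \<alpha> * k \<beta> * of_real (dual_form B \<alpha> \<beta>)) *\<^sub>c \<rho> (S (rf \<alpha>)) (\<rho> (S (rf \<beta>)) m))"
  unfolding Omega_W_elt_def by (simp add: \<rho>_sum \<rho>_mult \<rho>_const)

text \<open>\<sigma> is a representation of W only, so the Hecke identities do not apply to it
  directly. An injective intertwiner into M transports them back: commutation with W is checked in M
  and reflected to \<sigma>. Schur's lemma yields one scalar, which every embedding carries to its
  image and hence to the span.\<close>

lemma isotypic_scalar: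
  fixes sU :: "complex \<Rightarrow> 'u \<Rightarrow> 'u::ab_group_add"
  assumes irr: "irreducible_weyl_rep \<Phi> cr sU \<tau>"
    and ne: "isotypic_component \<Phi> cr sU \<tau> scale (\<lambda>w. \<rho> (S w)) \<noteq> {0}"
  obtains c where "scalar_of sU (group_algebra_act sU \<tau> (Omega_W \<Phi> cr \<Delta> k B)) = c"
    and "\<And>m. m \<in> isotypic_component \<Phi> cr sU \<tau> scale (\<lambda>w. \<rho> (S w)) \<Longrightarrow> \<rho> Omega_W_elt m = c *\<^sub>c m"
proof -
  let ?maps = "{f. Vector_Spaces.linear sU scale f \<and> inj f \<and> (\<forall>w\<in>W. \<forall>u. f (\<tau> w u) = \<rho> (S w) (f u))}"
  let ?T = "group_algebra_act sU \<tau> (Omega_W \<Phi> cr \<Delta> k B)"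
  have iso: "isotypic_component \<Phi> cr sU \<tau> scale (\<lambda>w. \<rho> (S w)) = span (\<Union> (range ` ?maps))"
    unfolding isotypic_component_def by (simp add: setcompr_eq_image)
  have rep: "weyl_rep \<Phi> cr sU \<tau>" and ex: "\<exists>u::'u. u \<noteq> 0"
    using irr unfolding irreducible_weyl_rep_def by blast+
  have vs: "vector_space sU"
    using rep by (simp add: weyl_rep_def)
  interpret U: complex_space sU
    using vs by (simp add: complex_space_def)
  have lin: "Vector_Spaces.linear sU sU (\<tau> w)" if "w \<in> W" for w
    using rep that by (simp add: weyl_rep_def)
  have T: "?T u = (\<Sum>\<alpha>\<in>pos. \<Sum>\<beta>\<in>pos.
      sU (1/4 * k \<alpha> * k \<beta> * of_real (dual_form B \<alpha> \<beta>)) (\<tau> (rf \<alpha>) (\<tau> (rf \<beta>) u)))" for u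
  proof -
    have "\<tau> (rf \<alpha> \<circ> rf \<beta>) = \<tau> (rf \<alpha>) \<circ> \<tau> (rf \<beta>)" if "\<alpha> \<in> pos" "\<beta> \<in> pos" for \<alpha> \<beta>
      using rep refl_pos_weyl that unfolding weyl_rep_def by blast
    then show ?thesis
      unfolding Omega_W_def
      by (simp add: additive_sum[of "\<lambda>a. group_algebra_act sU \<tau> a u", OF group_algebra_act_add[OF vs]]
          group_algebra_act_single[OF vs])
  qed
  have f_T: "f (?T u) = \<rho> Omega_W_elt (f u)" if "f \<in> ?maps" for f u
  proof -
    interpret f: Vector_Spaces.linear sU scale f
      using that by simp
    show ?thesis
      using that by (simp add: T \<rho>_Omega_W f.sum f.scale)
  qed
  \<comment> \<open>Without any embedding the component would be the span of the empty set, which is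
    zero.\<close>
  have "?maps \<noteq> {}"
  proof
    assume "?maps = {}"
    then show False
      using ne unfolding iso by (simp only: image_empty Union_empty span_empty)
  qed
  then obtain f where f: "f \<in> ?maps"
    by (meson all_not_in_conv)
  have T_lin: "Vector_Spaces.linear sU sU ?T"
  proof -
    have "\<tau> w (x + y) = \<tau> w x + \<tau> w y" "\<tau> w (sU c x) = sU c (\<tau> w x)" if "w \<in> W" for w x y c
      using lin[OF that] unfolding Vector_Spaces.linear_iff by blast+
    then show ?thesis
      unfolding Vector_Spaces.linear_iff using vs
      by (simp add: T U.scale_right_distrib sum.distrib U.scale_sum_right mult.commute)
  qed
  \<comment> \<open>Both sides are compared after applying the injective map
    \<open>f\<close>.\<close>
  have "?T (\<tau> w u) = \<tau> w (?T u)" if "w \<in> W" for w u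
  proof -
    have "f (?T (\<tau> w u)) = \<rho> (Omega_W_elt * S w) (f u)"
      using f that by (simp add: f_T[OF f] \<rho>_mult)
    also have "\<dots> = \<rho> (S w * Omega_W_elt) (f u)"
      by (simp only: \<rho>_cong[OF Omega_W_elt_commute[OF that]])
    also have "\<dots> = f (\<tau> w (?T u))"
      using f that f_T[OF f, of u] by (simp add: \<rho>_mult)
    finally show ?thesis
      using f by (simp add: inj_eq)
  qed
  then obtain c where c: "\<And>u. ?T u = sU c u"
    using schur_scalar[OF irr T_lin] by blast
  \<comment> \<open>The scalar is unique because an irreducible representation is nonzero.\<close>
  have "scalar_of sU ?T = c"
    unfolding scalar_of_def
  proof (rule the_equality)
    show "\<And>d. \<forall>u. ?T u = sU d u \<Longrightarrow> d = c"
      using ex c by (metis U.scale_right_imp_eq)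
  qed (simp add: c)
  moreover have "\<rho> Omega_W_elt m = c *\<^sub>c m"
    if "m \<in> isotypic_component \<Phi> cr sU \<tau> scale (\<lambda>w. \<rho> (S w))" for m
    using that unfolding iso
  proof (induction rule: span_induct_alt)
    interpret L: Vector_Spaces.linear scale scale "\<rho> Omega_W_elt"
      by (rule \<rho>_linear) simp
    case base
    show ?case
      by simp
  next
    interpret L: Vector_Spaces.linear scale scale "\<rho> Omega_W_elt"
      by (rule \<rho>_linear) simp
    case (step d x y)
    then obtain g u where g: "g \<in> ?maps" "x = g u"
      by auto
    then have "Vector_Spaces.linear sU scale g"
      by simp
    then have "g (sU c u) = c *\<^sub>c g u"
      unfolding Vector_Spaces.linear_iff by blast
    then have "\<rho> Omega_W_elt x = c *\<^sub>c x"
      using f_T[OF g(1), of u] c[of u] g(2) by simp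
    then show ?case
      using step by (simp add: L.add L.scale scale_right_distrib scale_left_commute)
  qed
  ultimately show ?thesis
    using that by blast
qed

text \<open>The nonzero vector \<open>m0\<close> makes the scalar unique; on a zero space
  \<open>scalar_of\<close> would be undetermined. The element \<Omega>, given in the basis
  \<open>v\<close>, is congruent to its version in the orthonormal basis.\<close>

lemma Omega_scalar:
  assumes v: "cx_basis v" and central: "has_central_character \<Phi> cr \<Delta> k scale \<pi>" and "(m0::'m) \<noteq> 0"
  shows "\<rho> Casimir_X m = scalar_of scale (\<pi> (Omega \<Phi> cr \<Delta> k B v)) *\<^sub>c m"
proof -
  have O: "\<pi> (Omega \<Phi> cr \<Delta> k B v) = \<rho> Casimir_X"
    using \<rho>_cong[OF lin_canonical_basis[OF lin_X v]] by (simp add: Omega_def \<rho>_def Casimir_X_def)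
  obtain c where c: "\<rho> Casimir_X = scale c"
    using central Casimir_X_central unfolding has_central_character_def \<rho>_def hecke_class_eq by blast
  have "scalar_of scale (\<rho> Casimir_X) = c"
    unfolding scalar_of_def
    by (rule the_equality) (use c \<open>m0 \<noteq> 0\<close> in \<open>auto intro: scale_right_imp_eq\<close>)
  then show ?thesis
    by (simp add: O c)
qed

end

theorem proposition4p23:
  fixes \<Phi> \<Delta> :: "(real^'n \<Rightarrow> real) set"
    and cr :: "(real^'n \<Rightarrow> real) \<Rightarrow> real^'n"
    and B :: "real^'n \<Rightarrow> real^'n \<Rightarrow> real"
    and k :: "(real^'n \<Rightarrow> real) \<Rightarrow> complex"
    and star :: "'n hgen free set \<Rightarrow> 'n hgen free set"
    and scM :: "complex \<Rightarrow> 'm \<Rightarrow> 'm::ab_group_add"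
    and \<pi> :: "'n hgen free set \<Rightarrow> 'm \<Rightarrow> 'm"
    and formM :: "'m \<Rightarrow> 'm \<Rightarrow> complex"
    and scU :: "complex \<Rightarrow> 'u \<Rightarrow> 'u::ab_group_add"
    and \<sigma> :: "(real^'n \<Rightarrow> real^'n) \<Rightarrow> 'u \<Rightarrow> 'u"
    and b :: "'n \<Rightarrow> real^'n"
    and v :: "'n \<Rightarrow> complex^'n"
    and m :: 'm
    and p :: "'n sym"
  assumes "root_system \<Phi> cr"
    and "simple_roots \<Phi> \<Delta>"
    and "invariant_inner_product \<Phi> cr B"
    and "invariant_parameter \<Phi> cr k"
    and "hecke_star \<Phi> cr \<Delta> k star"
    and "hecke_module \<Phi> cr \<Delta> k scM \<pi>"
    and "has_central_character \<Phi> cr \<Delta> k scM \<pi>"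
    and "hermitian_form scM formM"
    and "nondegenerate_form formM"
    and "star_invariant \<Phi> cr \<Delta> k star \<pi> formM"
    and "irreducible_weyl_rep \<Phi> cr scU \<sigma>"
    and "isotypic_component \<Phi> cr scU \<sigma> scM (\<lambda>w. \<pi> (hecke_class \<Phi> cr \<Delta> k (gen (GW w))))
           \<noteq> {0}"
    and "orthonormal_basis B b"
    and "cx_basis v"
    and "m \<in> isotypic_component \<Phi> cr scU \<sigma> scM (\<lambda>w. \<pi> (hecke_class \<Phi> cr \<Delta> k (gen (GW w))))"
    and "p \<in> real_sym"
  shows "tensor_form formM (sym_form b)
        (D_plus \<Phi> cr \<Delta> k B scM \<pi> v (tensor scM m p)) (D_plus \<Phi> cr \<Delta> k B scM \<pi> v (tensor scM m p))
    - tensor_form formM (sym_form b)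
        (D_minus \<Phi> cr \<Delta> k scM \<pi> v (tensor scM m p)) (D_minus \<Phi> cr \<Delta> k scM \<pi> v (tensor scM m p))
    = (- scalar_of scM (\<pi> (Omega \<Phi> cr \<Delta> k B v))
        + scalar_of scU (group_algebra_act scU \<sigma> (Omega_W \<Phi> cr \<Delta> k B)))
      * tensor_form formM (sym_form b) (tensor scM m p) (tensor scM m p)"
proof -
  interpret root_data \<Phi> \<Delta> cr B
    using assms(1-3) by (simp add: root_data_def)
  interpret hecke \<Phi> \<Delta> cr B b k
    by unfold_locales (use assms(4,13) B_bilinear B_sym in auto)
  have "vector_space scM"
    using assms(6) by (simp add: hecke_module_def)
  then interpret hermitian_module scM formM b
    using assms(8) by (simp add: hermitian_module_def hermitian_module_axioms_def complex_space_def)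
  interpret hecke_rep \<Phi> \<Delta> cr B b k scM \<pi>
    by unfold_locales (rule assms(6))
  let ?iso = "isotypic_component \<Phi> cr scU \<sigma> scM (\<lambda>w. \<rho> (S w))"
  let ?M = "\<lambda>i. \<rho> (T (E i))" and ?d = "\<lambda>i. sym_deriv (BC (E i))" and ?e = "\<lambda>i q. sym_vec (E i) * q"
  let ?\<omega> = "scalar_of scM (\<pi> (Omega \<Phi> cr \<Delta> k B v))"
  have ne: "?iso \<noteq> {0}" and m: "m \<in> ?iso"
    using assms(12,15) by (simp_all add: \<rho>_def)
  obtain c where c: "scalar_of scU (group_algebra_act scU \<sigma> (Omega_W \<Phi> cr \<Delta> k B)) = c"
    and Om_W: "\<rho> Omega_W_elt m = scM c m"
    using isotypic_scalar[OF assms(11) ne] m by metis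
  \<comment> \<open>A zero space has no isotypic component other than zero. The vector
    \<open>m\<close> itself may vanish, so it cannot serve as the witness.\<close>
  have "\<exists>m0::'m. m0 \<noteq> 0"
  proof (rule ccontr)
    assume "\<nexists>m0::'m. m0 \<noteq> 0"
    then have zero: "x = 0" for x :: 'm
      by blast
    have "0 \<in> ?iso"
      using m by (simp only: zero[of m])
    then have "?iso = {0}"
      using zero by blast
    then show False
      using ne by blast
  qed
  then have Om: "\<rho> Casimir_X m = scM ?\<omega> m"
    using Omega_scalar[OF assms(14,7)] by blast
  \<comment> \<open>The star condition concerns arguments of the form \<open>of_real_vec x\<close>,
    and \<open>E i\<close> is such a vector. The sign is written as the factor
    \<open>const (- 1)\<close> so that \<rho> turns it into a scalar.\<close>
  have skew: "formM (?M i x) y = - formM x (?M i y)" for i x y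
  proof -
    have "T (E i) \<in> free_carrier gens"
      by simp
    then have "hecke_class \<Phi> cr \<Delta> k (T (E i)) \<in> carrier (hecke_algebra \<Phi> cr \<Delta> k)"
      unfolding hecke_class_eq hecke_algebra_def by (rule H.class_carrier)
    then have "formM (?M i x) y = formM x (\<pi> (star (hecke_class \<Phi> cr \<Delta> k (T (E i)))) y)"
      using assms(10) by (simp add: star_invariant_def \<rho>_def)
    also have "star (hecke_class \<Phi> cr \<Delta> k (T (E i))) = hecke_class \<Phi> cr \<Delta> k (const (- 1) * T (E i))"
      using assms(5) by (simp add: hecke_star_def Let_def const_uminus)
    also have "\<pi> (\<dots>) y = scM (- 1) (?M i y)"
      by (simp only: \<rho>_def[symmetric] \<rho>_mult[OF free_carrier_const T_carrier] \<rho>_const)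
    finally show ?thesis
      by (simp only: form_scale_right) simp
  qed
  have "\<rho> (Casimir_T + Omega_W_elt) m = scM ?\<omega> m"
    using \<rho>_cong[OF Casimir_X_cong] Om by simp
  then have "\<rho> Casimir_T m = scM (?\<omega> - c) m"
    by (simp add: \<rho>_add Om_W scale_left_diff_distrib algebra_simps)
  then have cas: "(\<Sum>i\<in>UNIV. ?M i (?M i m)) = scM (?\<omega> - c) m"
    unfolding Casimir_T_def by (simp add: \<rho>_sum \<rho>_mult)
  have form_D: "tensor_form formM (sym_form b) (\<Sum>i\<in>UNIV. tensor scM (?M i m) (P i)) (\<Sum>i\<in>UNIV. tensor scM (?M i m) (P i))
    = (\<Sum>i\<in>UNIV. \<Sum>j\<in>UNIV. formM (?M i m) (?M j m) * sym_form b (P i) (P j))" for P :: "'n \<Rightarrow> 'n sym"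
    by (simp only: additive_sum[of "\<lambda>t. tensor_form formM (sym_form b) t _", OF tensor_form_add_left]
        additive_sum[of "tensor_form formM (sym_form b) _", OF tensor_form_add_right] tensor_form_tensor)
      (rule sum.swap)
  \<comment> \<open>\<open>sym_form_vec_deriv\<close> is applied to every pair of indices, not just
    to equal ones: the derivative terms match those of the second norm pair by pair and cancel, and
    the Kronecker delta reduces the double sum to its diagonal.\<close>
  have "tensor_form formM (sym_form b)
        (D_plus \<Phi> cr \<Delta> k B scM \<pi> v (tensor scM m p)) (D_plus \<Phi> cr \<Delta> k B scM \<pi> v (tensor scM m p))
    - tensor_form formM (sym_form b)
        (D_minus \<Phi> cr \<Delta> k scM \<pi> v (tensor scM m p)) (D_minus \<Phi> cr \<Delta> k scM \<pi> v (tensor scM m p))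
    = (\<Sum>i\<in>UNIV. \<Sum>j\<in>UNIV. formM (?M i m) (?M j m) * (if i = j then sym_form b p p else 0))"
    unfolding D_plus_tensor[OF assms(14)] D_minus_tensor[OF assms(14)] form_D sym_form_vec_deriv[OF assms(16)]
    by (simp only: distrib_left sum.distrib add_diff_cancel_right')
  also have "\<dots> = (\<Sum>i\<in>UNIV. formM (?M i m) (?M i m)) * sym_form b p p"
    by (simp add: sum_distrib_right if_distrib[of "\<lambda>x. _ * x"] cong: if_cong)
  also have "(\<Sum>i\<in>UNIV. formM (?M i m) (?M i m)) = - formM m (\<Sum>i\<in>UNIV. ?M i (?M i m))"
    by (simp add: skew[of _ m] sum_negf additive_sum[of "formM m", OF form_add_right])
  also have "\<dots> = (- ?\<omega> + c) * formM m m"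
    unfolding cas form_scale_right by (simp add: algebra_simps)
  finally show ?thesis
    by (simp only: c tensor_form_tensor mult.assoc)
qed

end
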